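(* Let $G_1$ and $G_2$ be connected graphs with $L(G_1)=L(G_2)$ and such that $L(G_1)$ has at least two circuits. If $|V(\mathrm{co}(G_1))|\ge 5$, then $G_1$ and $G_2$ are $2$-isomorphic.
   Context: Graphs are finite and may have loops and parallel edges; edges are labelled. For $X\subseteq E(G)$, $G|X$ is the subgraph of $G$ with edge set $X$ and no isolated vertices. A set $X\subseteq E(G)$ is a cycle if $G|X$ is a connected $2$-regular graph (so a loop is a cycle, and so is a pair of parallel edges). The bicircular lift matroid $L(G)$ is the matroid on $E(G)$ whose circuits are the edge sets of those subgraphs of $G$ that contain at least two cycles and are minimal with respect to this property. The equality $L(G_1)=L(G_2)$ means equality as matroids on the common edge set $E(G_1)=E(G_2)$. Two edges form a series pair of $G$ if and only if no cycle of $G$ meets them in exactly one element. A series class is a maximal set $X\subseteq E(G)$ such that every two edges of $X$ form a series pair. $\mathrm{co}(G)$ denotes a graph obtained from $G$ by contracting all cut-edges and then, for each series class $X$, contracting all but one distinguished element of $X$. Whitney switching: if $(X_1,X_2)$ is a partition of $E(G)$ with $V(G|X_1)\cap V(G|X_2)=\{u_1,u_2\}$, then $G'$ is obtained by a Whitney switching on $\{u_1,u_2\}$ if $G'$ is obtained by identifying the vertices $u_1,u_2$ of $G|X_1$ with the vertices $u_2,u_1$ of $G|X_2$, respectively. A graph $G'$ is $2$-isomorphic to $G$ if it is obtained from $G$ by a sequence of the operations: Whitney switchings, identifying two vertices from distinct components, or partitioning a graph into components each of which is a block of the original graph. Edge labels are kept; by Whitney's theorem, $G$ and $G'$ are $2$-isomorphic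 in this sense exactly when they have the same edge set and the same cycles. *)

theory Defs
  imports Main
begin

section \<open>Finite multigraphs with labelled edges\<close>

text \<open>
  The ends of an edge form a one-element set (a loop) or a two-element set.
  Outside the edge set the incidence function is required to be empty, so that
  \<open>=\<close> on this type is equality of labelled graphs.
\<close>

record ('v, 'e) mgraph =
  mverts :: "'v set"
  medges :: "'e set"
  mends :: "'e \<Rightarrow> 'v set"

definition multigraph :: "('v, 'e) mgraph \<Rightarrow> bool" where
  "multigraph G \<longleftrightarrow>
     finite (mverts G) \<and> finite (medges G) \<and>
     (\<forall>e\<in>medges G. mends G e \<subseteq> mverts G \<and> card (mends G e) \<in> {1, 2}) \<and>
     (\<forall>e. e \<notin> medges G \<longrightarrow> mends G e = {})"

definition make_mgraph :: "'v set \<Rightarrow> 'e set \<Rightarrow> ('e \<Rightarrow> 'v set) \<Rightarrow> ('v, 'e) mgraph" where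
  "make_mgraph V E f = \<lparr>mverts = V, medges = E, mends = (\<lambda>e. if e \<in> E then f e else {})\<rparr>"

definition msubgraph :: "('v, 'e) mgraph \<Rightarrow> ('v, 'e) mgraph \<Rightarrow> bool" where
  "msubgraph H G \<longleftrightarrow>
     multigraph H \<and> mverts H \<subseteq> mverts G \<and> medges H \<subseteq> medges G \<and>
     (\<forall>e\<in>medges H. mends H e = mends G e)"

definition edge_restrict :: "('v, 'e) mgraph \<Rightarrow> 'e set \<Rightarrow> ('v, 'e) mgraph" where
  "edge_restrict G X = make_mgraph (\<Union>e\<in>X. mends G e) X (mends G)"

definition spanning_restrict :: "('v, 'e) mgraph \<Rightarrow> 'e set \<Rightarrow> ('v, 'e) mgraph" where
  "spanning_restrict G X = make_mgraph (mverts G) X (mends G)"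

definition mgraph_iso :: "('v, 'e) mgraph \<Rightarrow> ('w, 'e) mgraph \<Rightarrow> bool" where
  \<comment> \<open>Vertices may be renamed, edge labels are kept.\<close>
  "mgraph_iso G H \<longleftrightarrow>
     medges H = medges G \<and>
     (\<exists>f. bij_betw f (mverts G) (mverts H) \<and> (\<forall>e\<in>medges G. mends H e = f ` mends G e))"

definition madjacent :: "('v, 'e) mgraph \<Rightarrow> ('v \<times> 'v) set" where
  "madjacent G = {(u, v). \<exists>e\<in>medges G. mends G e = {u, v}}"

definition connected_mgraph :: "('v, 'e) mgraph \<Rightarrow> bool" where
  \<comment> \<open>The graph without vertices is not connected; in particular the empty edge set is not a cycle.\<close>
  "connected_mgraph G \<longleftrightarrow>
     mverts G \<noteq> {} \<and> (\<forall>u\<in>mverts G. \<forall>v\<in>mverts G. (u, v) \<in> (madjacent G)\<^sup>*)"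

definition mcomponents :: "('v, 'e) mgraph \<Rightarrow> ('v, 'e) mgraph set" where
  "mcomponents G =
     {H. msubgraph H G \<and> connected_mgraph H \<and>
         (\<forall>K. msubgraph K G \<and> connected_mgraph K \<and> msubgraph H K \<longrightarrow> K = H)}"

definition mdegree :: "('v, 'e) mgraph \<Rightarrow> 'v \<Rightarrow> nat" where
  \<comment> \<open>A loop contributes 2.\<close>
  "mdegree G v = card {e \<in> medges G. v \<in> mends G e} + card {e \<in> medges G. mends G e = {v}}"

definition is_mcycle :: "('v, 'e) mgraph \<Rightarrow> 'e set \<Rightarrow> bool" where
  "is_mcycle G X \<longleftrightarrow>
     X \<subseteq> medges G \<and> connected_mgraph (edge_restrict G X) \<and>
     (\<forall>v\<in>mverts (edge_restrict G X). mdegree (edge_restrict G X) v = 2)"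


section \<open>The bicircular lift matroid\<close>

text \<open>A matroid is given by its ground set and its set of circuits, which determine it.\<close>

record 'e circuit_matroid =
  ground_set :: "'e set"
  circuits :: "'e set set"

definition has_two_cycles :: "('v, 'e) mgraph \<Rightarrow> bool" where
  "has_two_cycles H \<longleftrightarrow> (\<exists>C D. C \<noteq> D \<and> is_mcycle H C \<and> is_mcycle H D)"

definition bicircular_lift :: "('v, 'e) mgraph \<Rightarrow> 'e circuit_matroid" where
  "bicircular_lift G =
     \<lparr>ground_set = medges G,
      circuits = {medges H | H. msubgraph H G \<and> has_two_cycles H \<and>
                    (\<forall>K. msubgraph K H \<and> has_two_cycles K \<longrightarrow> K = H)}\<rparr>"


section \<open>Contraction and cosimplification\<close>

definition mcontract :: "('v, 'e) mgraph \<Rightarrow> 'e set \<Rightarrow> ('v set, 'e) mgraph" where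
  \<comment> \<open>The vertices of the contraction are the vertex sets of the components of the
      spanning subgraph with edge set \<open>Z\<close>.\<close>
  "mcontract G Z =
     (let V = mverts ` mcomponents (spanning_restrict G Z)
      in make_mgraph V (medges G - Z) (\<lambda>e. {U \<in> V. U \<inter> mends G e \<noteq> {}}))"

definition cut_edges :: "('v, 'e) mgraph \<Rightarrow> 'e set" where
  "cut_edges G =
     {e \<in> medges G.
        card (mcomponents (spanning_restrict G (medges G - {e}))) > card (mcomponents G)}"

definition series_pair :: "('v, 'e) mgraph \<Rightarrow> 'e \<Rightarrow> 'e \<Rightarrow> bool" where
  "series_pair G e f \<longleftrightarrow> \<not> (\<exists>C. is_mcycle G C \<and> card (C \<inter> {e, f}) = 1)"

definition series_classes :: "('v, 'e) mgraph \<Rightarrow> 'e set set" where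
  \<comment> \<open>The nonemptiness condition matters only if \<open>G\<close> has no edges.\<close>
  "series_classes G =
     {X. X \<noteq> {} \<and> X \<subseteq> medges G \<and> pairwise (series_pair G) X \<and>
         (\<forall>Y. X \<subseteq> Y \<and> Y \<subseteq> medges G \<and> pairwise (series_pair G) Y \<longrightarrow> Y = X)}"

text \<open>
  \<open>is_co G H\<close> says that \<open>H\<close> is a cosimplification of \<open>G\<close> for some choice \<open>d\<close> of distinguished
  elements. The series classes are those of the graph \<open>K\<close> obtained by contracting the cut-edges;
  they are the series classes of \<open>G\<close> apart from the set of cut-edges.
\<close>

definition is_co :: "('v, 'e) mgraph \<Rightarrow> ('v set set, 'e) mgraph \<Rightarrow> bool" where
  "is_co G H \<longleftrightarrow>
     (let K = mcontract G (cut_edges G) in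
      \<exists>d. (\<forall>X\<in>series_classes K. d X \<in> X) \<and>
          H = mcontract K (\<Union>X\<in>series_classes K. X - {d X}))"


section \<open>Blocks and 2-isomorphism\<close>

text \<open>
  A graph is nonseparable if it is connected and is not the union of two subgraphs, each with an
  edge, that share exactly one vertex and no edge. In particular, a loop
  is a block by itself, even if other edges are incident with its vertex.
\<close>

definition nonseparable :: "('v, 'e) mgraph \<Rightarrow> bool" where
  "nonseparable H \<longleftrightarrow>
     connected_mgraph H \<and>
     \<not> (\<exists>X1 X2 v. X1 \<noteq> {} \<and> X2 \<noteq> {} \<and> X1 \<union> X2 = medges H \<and> X1 \<inter> X2 = {} \<and>
          mverts (edge_restrict H X1) \<inter> mverts (edge_restrict H X2) = {v})"

definition mblocks :: "('v, 'e) mgraph \<Rightarrow> ('v, 'e) mgraph set" where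
  "mblocks G =
     {H. msubgraph H G \<and> nonseparable H \<and>
         (\<forall>K. msubgraph K G \<and> nonseparable K \<and> msubgraph H K \<longrightarrow> K = H)}"

definition whitney_switching :: "('v, 'e) mgraph \<Rightarrow> ('v, 'e) mgraph \<Rightarrow> bool" where
  "whitney_switching G G' \<longleftrightarrow>
     (\<exists>X1 X2 u1 u2.
        X1 \<union> X2 = medges G \<and> X1 \<inter> X2 = {} \<and> u1 \<noteq> u2 \<and>
        mverts (edge_restrict G X1) \<inter> mverts (edge_restrict G X2) = {u1, u2} \<and>
        G' = make_mgraph
               (mverts (edge_restrict G X1) \<union> mverts (edge_restrict G X2))
               (medges G)
               (\<lambda>e. if e \<in> X1 then mends G e else id(u1 := u2, u2 := u1) ` mends G e))"

definition vertex_identification :: "('v, 'e) mgraph \<Rightarrow> ('v, 'e) mgraph \<Rightarrow> bool" where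
  "vertex_identification G G' \<longleftrightarrow>
     (\<exists>C D u v.
        C \<in> mcomponents G \<and> D \<in> mcomponents G \<and> C \<noteq> D \<and> u \<in> mverts C \<and> v \<in> mverts D \<and>
        G' = make_mgraph (mverts G - {v}) (medges G) (\<lambda>e. id(v := u) ` mends G e))"

definition block_partition :: "('v, 'e) mgraph \<Rightarrow> ('v, 'e) mgraph \<Rightarrow> bool" where
  "block_partition G G' \<longleftrightarrow>
     multigraph G' \<and>
     (\<exists>b. bij_betw b (mcomponents G') (mblocks G) \<and> (\<forall>C\<in>mcomponents G'. mgraph_iso C (b C)))"

inductive whitney_step :: "('v, 'e) mgraph \<Rightarrow> ('v, 'e) mgraph \<Rightarrow> bool" where
  switching: "whitney_switching G G' \<Longrightarrow> whitney_step G G'"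
| identification: "vertex_identification G G' \<Longrightarrow> whitney_step G G'"
| partition: "block_partition G G' \<Longrightarrow> whitney_step G G'"

text \<open>
  Graphs are considered up to renaming of vertices. The sequence of operations is carried out on
  copies with vertices in \<open>nat\<close>: the vertex types of \<open>G\<close> and \<open>G'\<close> may differ, and a finite
  vertex type could lack the new vertices that partitioning into blocks needs.
\<close>

definition two_isomorphic :: "('v, 'e) mgraph \<Rightarrow> ('w, 'e) mgraph \<Rightarrow> bool" where
  "two_isomorphic G G' \<longleftrightarrow>
     (\<exists>H H' :: (nat, 'e) mgraph.
        multigraph H \<and> mgraph_iso G H \<and> whitney_step\<^sup>*\<^sup>* H H' \<and> mgraph_iso H' G')"

end

theory Submission
  imports Defs
begin

text \<open>
  Let \<open>Z(G)\<close> be the set of edge sets with even degree at every vertex; its minimal nonempty members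
  are the cycles. A set is dependent in \<open>L(G)\<close> iff it contains two nonempty members of \<open>Z(G)\<close>.
  This suffices to transfer from \<open>G1\<close> to \<open>G2\<close> every \<open>B\<close> that is orthogonal to \<open>Z(G1)\<close> and
  whose complement is dependent: a minimal such \<open>B\<close> is detected by adding one or two of its elements
  to a basis of its complement. In \<open>co(G1)\<close> every vertex star has at least three edges, so double
  counting shows that, if there are at least five vertices, all stars but at most one have a dependent
  complement. Together with the cut-edges and series pairs of \<open>G1\<close> they generate the orthogonal
  complement of \<open>Z(G1)\<close>, whence \<open>Z(G2) \<subseteq> Z(G1)\<close>, and equality follows from \<open>L(G1) = L(G2)\<close>.

  It remains to prove Whitney's theorem. A graph is nonseparable iff \<open>Z(G)\<close> is not a direct sum, so
  the two graphs have the same blocks. Nonseparable graphs are treated by induction on the number of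
  edges. If \<open>G\<close> has no 2-separation, then deleting a vertex star leaves a nonseparable graph, which
  forces the star to be a star of \<open>G'\<close> as well. Otherwise a switching makes two series edges
  adjacent, or, without series pairs, a smallest side of a 2-separation is itself nonseparable and
  hence is a side of a 2-separation of \<open>G'\<close>; then both graphs are split into two smaller ones.
  Finally, a graph is recovered from the disjoint union of its blocks by identifying vertices.
\<close>

section \<open>Subsets of a finite set as vectors over the two-element field; transfer of
  orthogonality\<close>

section \<open>Symmetric differences and binary spaces\<close>

text \<open>Cycles are not closed under addition, so the argument uses the space of even sets and
  returns to cycles only where the matroid is unfolded. A maximal independent subset
  \<open>J\<close> of a dependent set contains exactly one nonempty even set. So if the complement
  of \<open>B\<close> is dependent with basis \<open>J\<close>, adding elements of \<open>B\<close>
  to \<open>J\<close> gives a dependent set exactly when a new even set arises, one that meets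
  \<open>B\<close>; in this way L(G) shows how Z(G) meets \<open>B\<close>. If the complement of
  \<open>B\<close> is independent, the first even set so created goes unnoticed and the test fails.
  This is the obstacle: a star with independent complement cannot be transferred. One such star does
  no harm, because every boundary has even size, so a boundary inside one vertex is empty. Two
  would, and the bound 5 is what excludes them. The transfer starts from knowledge of the stars of
  co(G1), and nothing of the kind is known about \<open>G2\<close>; it therefore gives one inclusion
  only, and the other comes from comparing bases of L(G1) and L(G2).\<close>

definition symd :: "'a set \<Rightarrow> 'a set \<Rightarrow> 'a set" (infixl "\<oplus>" 65) where
  "A \<oplus> B = {x. (x \<in> A) \<noteq> (x \<in> B)}"

lemma symd_iff [simp]: "x \<in> A \<oplus> B \<longleftrightarrow> (x \<in> A) \<noteq> (x \<in> B)"
  by (simp add: symd_def)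

lemma symd_empty [simp]: "A \<oplus> {} = A" "{} \<oplus> A = A" "A \<oplus> A = {}"
  by auto

lemma symd_eq_empty_iff [simp]: "A \<oplus> B = {} \<longleftrightarrow> A = B" "{} = A \<oplus> B \<longleftrightarrow> A = B"
  by auto

lemma symd_commute: "A \<oplus> B = B \<oplus> A"
  by auto

lemma symd_assoc: "A \<oplus> B \<oplus> C = A \<oplus> (B \<oplus> C)"
  by auto

lemma symd_cancel [simp]: "A \<oplus> (A \<oplus> B) = B"
  by auto

lemma symd_subset: "A \<subseteq> C \<Longrightarrow> B \<subseteq> C \<Longrightarrow> A \<oplus> B \<subseteq> C"
  by auto

lemma symd_singles: "a \<noteq> b \<Longrightarrow> {a} \<oplus> {b} = {a, b}"
  by (rule set_eqI) (simp, blast)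

lemma symd_disjoint: "A \<inter> B = {} \<Longrightarrow> A \<oplus> B = A \<union> B"
  by auto

lemma symd_Int_distrib: "(A \<oplus> B) \<inter> C = (A \<inter> C) \<oplus> (B \<inter> C)"
  by auto

lemma even_card_symd:
  assumes "finite A" "finite B"
  shows "even (card (A \<oplus> B)) \<longleftrightarrow> (even (card A) \<longleftrightarrow> even (card B))"
proof -
  have 0: "A \<oplus> B = (A - B) \<union> (B - A)" "(A - B) \<inter> (B - A) = {}" by auto
  have 1: "card (A \<oplus> B) = card (A - B) + card (B - A)"
    unfolding 0(1) by (rule card_Un_disjoint) (use assms 0(2) in auto)
  have 2: "card X = card (X - Y) + card (X \<inter> Y)" if "finite X" for X Y :: "'a set"
    using card_Int_Diff[OF that, of Y] by simp
  show ?thesis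
    using 1 2[OF assms(1), of B] 2[OF assms(2), of A] by (simp only: Int_commute even_add) argo
qed

lemma even_card_Int_symd:
  assumes "finite A" "finite B"
  shows "even (card ((A \<oplus> B) \<inter> C)) \<longleftrightarrow> (even (card (A \<inter> C)) \<longleftrightarrow> even (card (B \<inter> C)))"
  unfolding symd_Int_distrib using assms by (simp add: even_card_symd)

text \<open>The linear subspaces of the power set of \<open>E\<close> over the two-element
  field.\<close>

definition binary_space :: "'e set \<Rightarrow> 'e set set \<Rightarrow> bool" where
  "binary_space E Z \<longleftrightarrow> finite E \<and> {} \<in> Z \<and> Z \<subseteq> Pow E \<and> (\<forall>A\<in>Z. \<forall>B\<in>Z. A \<oplus> B \<in> Z)"

lemma binary_spaceD:
  assumes "binary_space E Z"
  shows "finite E" "{} \<in> Z" "A \<in> Z \<Longrightarrow> A \<subseteq> E" "A \<in> Z \<Longrightarrow> B \<in> Z \<Longrightarrow> A \<oplus> B \<in> Z"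
    "A \<in> Z \<Longrightarrow> finite A"
  using assms finite_subset unfolding binary_space_def by blast+

definition orthogonal :: "'e set set \<Rightarrow> 'e set \<Rightarrow> bool" where
  "orthogonal Z B \<longleftrightarrow> (\<forall>X\<in>Z. even (card (X \<inter> B)))"

text \<open>With \<open>Z = evens G\<close> this is dependence in L(G), by
  \<open>two_iff_circuit\<close>. Two distinct nonempty members suffice, with no minimality
  required, since a nonempty even set that is not a cycle already contains two cycles.\<close>

definition two :: "'e set set \<Rightarrow> 'e set \<Rightarrow> bool" where
  "two Z X \<longleftrightarrow> (\<exists>A\<in>Z. \<exists>B\<in>Z. A \<subseteq> X \<and> B \<subseteq> X \<and> A \<noteq> {} \<and> B \<noteq> {} \<and> A \<noteq> B)"

lemma two_mono: "two Z X \<Longrightarrow> X \<subseteq> Y \<Longrightarrow> two Z Y"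
  unfolding two_def by (meson order_trans)

lemma finite_maximal_set:
  "finite \<S> \<Longrightarrow> A \<in> \<S> \<Longrightarrow> \<exists>M\<in>\<S>. \<forall>K\<in>\<S>. M \<subseteq> K \<longrightarrow> M = K"
  using finite_has_maximal[of \<S>] by auto

text \<open>The double orthogonal complement of a space is the space itself. No dimensions are
  needed: a maximal space that contains \<open>Z\<close> and avoids \<open>t\<close> is a
  hyperplane, and \<open>y\<close> is its normal vector.\<close>

lemma orthogonal_separates:
  assumes Z: "binary_space E Z" and t: "t \<subseteq> E" "t \<notin> Z"
  obtains y where "y \<subseteq> E" "orthogonal Z y" "odd (card (t \<inter> y))"
proof -
  have fE: "finite E" using Z binary_spaceD by blast
  define \<S> where "\<S> = {S. binary_space E S \<and> Z \<subseteq> S \<and> t \<notin> S}"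
  have "\<S> \<subseteq> Pow (Pow E)" unfolding \<S>_def binary_space_def by auto
  then have "finite \<S>" using fE finite_subset[of \<S> "Pow (Pow E)"] by auto
  moreover have "Z \<in> \<S>" using Z t unfolding \<S>_def by auto
  ultimately obtain S where S: "S \<in> \<S>" and max: "\<forall>T\<in>\<S>. S \<subseteq> T \<longrightarrow> S = T"
    using finite_maximal_set by blast
  have bS: "binary_space E S" and ZS: "Z \<subseteq> S" and tS: "t \<notin> S" using S unfolding \<S>_def by auto
  note D = binary_spaceD[OF bS]
  \<comment> \<open>If neither \<open>x\<close> nor \<open>x \<oplus> t\<close> were in
    \<open>S\<close>, then \<open>S\<close> together with its coset by \<open>x\<close> would be a
    larger space avoiding \<open>t\<close>.\<close>
  have codim1: "x \<oplus> t \<in> S" if x: "x \<subseteq> E" "x \<notin> S" for x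
  proof (rule ccontr)
    assume n: "x \<oplus> t \<notin> S"
    define T where "T = S \<union> {x \<oplus> s | s. s \<in> S}"
    have "binary_space E T" unfolding binary_space_def
    proof (intro conjI ballI)
      show "finite E" "{} \<in> T" using D(1,2) unfolding T_def by auto
      show "T \<subseteq> Pow E" using D(3) symd_subset[OF x(1)] unfolding T_def by blast
      fix A B assume AB: "A \<in> T" "B \<in> T"
      have 1: "(x \<oplus> s) \<oplus> (x \<oplus> s') = s \<oplus> s'" for s s' by auto
      have 2: "s \<oplus> (x \<oplus> s') = x \<oplus> (s \<oplus> s')" for s s' by auto
      show "A \<oplus> B \<in> T" using AB D(4) unfolding T_def
        by (auto simp: 1 2 symd_assoc) blast+
    qed
    moreover have "t \<notin> T"
    proof
      assume "t \<in> T"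
      then obtain s where s: "s \<in> S" "t = x \<oplus> s" using tS unfolding T_def by auto
      then have "x \<oplus> t = s" by auto
      then show False using n s by simp
    qed
    ultimately have "S = T" using max[rule_format, of T] ZS unfolding \<S>_def T_def by auto
    moreover have "x \<in> T" unfolding T_def using D(2) by (auto intro!: exI[of _ "{}"])
    ultimately show False using x by simp
  qed
  \<comment> \<open>The normal vector: membership in the hyperplane \<open>S\<close> flips with
    every element whose singleton is outside \<open>S\<close>.\<close>
  define y where "y = {g \<in> E. {g} \<notin> S}"
  have key: "x \<in> S \<longleftrightarrow> even (card (x \<inter> y))" if "x \<subseteq> E" for x
  proof -
    have "finite x" using that fE finite_subset by blast
    then show ?thesis using that
    proof (induction x rule: finite_induct)
      case empty
      then show ?case using D(2) by simp
    next
      case (insert g x)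
      have eq: "insert g x = {g} \<oplus> x" using insert.hyps by auto
      have gE: "{g} \<subseteq> E" "x \<subseteq> E" using insert.prems by auto
      show ?case
      proof (cases "{g} \<in> S")
        case True
        then have "insert g x \<in> S \<longleftrightarrow> x \<in> S" using D(4)[of "{g}"] unfolding eq
          by (metis symd_cancel)
        moreover have "insert g x \<inter> y = x \<inter> y" using True unfolding y_def by auto
        ultimately show ?thesis using insert by auto
      next
        case False
        then have gt: "{g} \<oplus> t \<in> S" using codim1 gE by blast
        have "insert g x \<in> S \<longleftrightarrow> x \<notin> S"
        proof
          assume "insert g x \<in> S"
          then show "x \<notin> S" using False D(4)[of "insert g x" x] unfolding eq by (metis symd_cancel symd_commute)
        next
          assume "x \<notin> S"
          then have "x \<oplus> t \<in> S" using codim1 gE by blast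
          then have "({g} \<oplus> t) \<oplus> (x \<oplus> t) \<in> S" using gt D(4) by blast
          moreover have "({g} \<oplus> t) \<oplus> (x \<oplus> t) = insert g x" using insert.hyps by auto
          ultimately show "insert g x \<in> S" by simp
        qed
        moreover have "insert g x \<inter> y = insert g (x \<inter> y)" using False gE unfolding y_def by auto
        ultimately show ?thesis using insert by auto
      qed
    qed
  qed
  show ?thesis
  proof
    show "y \<subseteq> E" unfolding y_def by auto
    show "orthogonal Z y" using key ZS D(3) unfolding orthogonal_def by blast
    show "odd (card (t \<inter> y))" using key t tS by blast
  qed
qed

text \<open>Here \<open>J\<close> is a basis of \<open>A\<close> in the sense of L(G). It contains a
  nonempty member of \<open>Z\<close>: otherwise a further element \<open>g\<close> would lie in two
  distinct members inside \<open>insert g J\<close>, and their sum would be a nonempty member inside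
  \<open>J\<close>.\<close>

lemma two_maximal:
  assumes Z: "binary_space E Z" and A: "A \<subseteq> E" "two Z A"
    and J: "J \<subseteq> A" "\<not> two Z J" and max: "\<And>g. g \<in> A - J \<Longrightarrow> two Z (insert g J)"
  shows "\<exists>C\<in>Z. C \<noteq> {} \<and> C \<subseteq> J"
    and "\<And>g. g \<in> A - J \<Longrightarrow> \<exists>C\<in>Z. g \<in> C \<and> C \<subseteq> insert g J"
proof -
  note D = binary_spaceD[OF Z]
  show 1: "\<exists>C\<in>Z. g \<in> C \<and> C \<subseteq> insert g J" if "g \<in> A - J" for g
  proof -
    have "two Z (insert g J)" using max that by blast
    then show ?thesis using J unfolding two_def by (metis subset_insert)
  qed
  show "\<exists>C\<in>Z. C \<noteq> {} \<and> C \<subseteq> J"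
  proof (rule ccontr)
    assume n: "\<not> ?thesis"
    have "A \<noteq> J" using A J by metis
    then obtain g where g: "g \<in> A - J" using J by blast
    obtain C D where CD: "C \<in> Z" "D \<in> Z" "C \<subseteq> insert g J" "D \<subseteq> insert g J" "C \<noteq> {}" "D \<noteq> {}" "C \<noteq> D"
      using max[OF g] unfolding two_def by blast
    have "g \<in> C" "g \<in> D" using n CD by blast+
    then have "C \<oplus> D \<subseteq> J" "C \<oplus> D \<noteq> {}" using CD by auto
    moreover have "C \<oplus> D \<in> Z" using D(4) CD(1,2) .
    ultimately show False using n by metis
  qed
qed

lemma two_maximal_exists:
  assumes "finite A" "I \<subseteq> A" "\<not> two Z I"
  obtains J where "I \<subseteq> J" "J \<subseteq> A" "\<not> two Z J" "\<And>g. g \<in> A - J \<Longrightarrow> two Z (insert g J)"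
proof -
  let ?S = "{J. I \<subseteq> J \<and> J \<subseteq> A \<and> \<not> two Z J}"
  have "finite ?S" using assms by simp
  moreover have "I \<in> ?S" using assms by auto
  ultimately have "\<exists>M\<in>?S. \<forall>K\<in>?S. M \<subseteq> K \<longrightarrow> M = K"
    by (rule finite_maximal_set)
  then obtain J where J: "J \<in> ?S" and max: "\<forall>K\<in>?S. J \<subseteq> K \<longrightarrow> J = K" by (rule bexE)
  show ?thesis
  proof
    show "I \<subseteq> J" "J \<subseteq> A" "\<not> two Z J" using J by auto
    fix g assume g: "g \<in> A - J"
    show "two Z (insert g J)"
    proof (rule ccontr)
      assume "\<not> two Z (insert g J)"
      then have "insert g J \<in> ?S" using J g by auto
      then have "J = insert g J" using max[rule_format, of "insert g J"] by blast
      then show False using g by blast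
    qed
  qed
qed

text \<open>Elimination: an element \<open>g\<close> of \<open>X\<close> in \<open>A - J\<close> is
  cleared by adding the set \<open>C\<close> that \<open>g\<close> closes with \<open>J\<close>. As
  \<open>C\<close> lies in \<open>A\<close>, the part of \<open>X\<close> in \<open>F\<close> is
  untouched.\<close>

lemma reduce_modulo:
  assumes Z: "binary_space E Z" and span: "\<forall>g\<in>A - J. \<exists>C\<in>Z. g \<in> C \<and> C \<subseteq> insert g J"
    and X: "X \<in> Z" "X \<subseteq> A \<union> F" and JF: "F \<inter> A = {}" "J \<subseteq> A"
  obtains Y where "Y \<in> Z" "Y \<subseteq> J \<union> F" "Y \<inter> F = X \<inter> F"
proof -
  note D = binary_spaceD[OF Z]
  have "finite (X - J - F)" using D(5) X by blast
  then have "\<exists>Y\<in>Z. Y \<subseteq> J \<union> F \<and> Y \<inter> F = X \<inter> F" using X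
  proof (induction "X - J - F" arbitrary: X rule: finite_induct)
    case empty
    then show ?case by blast
  next
    case (insert g T)
    have "g \<in> X - J - F" using insert.hyps(4) by blast
    then have g: "g \<in> X" "g \<in> A - J" "g \<notin> F" using insert.prems(2) by blast+
    obtain C where C: "C \<in> Z" "g \<in> C" "C \<subseteq> insert g J" using span g by blast
    have "T = X - J - F - {g}" using insert.hyps(2,4) by blast
    moreover have "(X \<oplus> C) - J - F = X - J - F - {g}" using C g by auto
    ultimately have "T = (X \<oplus> C) - J - F" by simp
    moreover have "X \<oplus> C \<in> Z" using D(4) insert.prems C by blast
    moreover have "X \<oplus> C \<subseteq> A \<union> F" using insert.prems(2) C(3) JF(2) g(1) by (intro symd_subset) blast+
    ultimately obtain Y where "Y\<in>Z" "Y \<subseteq> J \<union> F" "Y \<inter> F = (X \<oplus> C) \<inter> F"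
      using insert.hyps(3) by blast
    moreover have "C \<inter> F = {}" using C(3) JF g(3) by blast
    then have "(X \<oplus> C) \<inter> F = X \<inter> F" by auto
    ultimately show ?case by auto
  qed
  then show ?thesis using that by blast
qed

text \<open>The hypothesis \<open>pair\<close> holds for minimal orthogonal \<open>B\<close>. A
  basis \<open>J\<close> of the complement contains a member of either space, so \<open>J\<close>
  plus elements of \<open>B\<close> is dependent as soon as there is a further member meeting
  \<open>B\<close>. Hence dependence of \<open>insert e J\<close> and of
  \<open>J \<union> {e, f}\<close> decides which singletons and pairs occur as traces of
  \<open>Z2\<close> on \<open>B\<close>.\<close>

lemma two_pair_transfer:
  assumes Z1: "binary_space E Z1" and Z2: "binary_space E Z2"
    and two: "\<And>X. X \<subseteq> E \<Longrightarrow> two Z1 X \<longleftrightarrow> two Z2 X"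
    and B: "B \<subseteq> E" "orthogonal Z1 B" "two Z1 (E - B)"
    and pair: "\<And>e f. e \<in> B \<Longrightarrow> f \<in> B \<Longrightarrow> e \<noteq> f \<Longrightarrow> \<exists>C\<in>Z1. C \<inter> B = {e, f}"
  shows "orthogonal Z2 B"
proof -
  note D1 = binary_spaceD[OF Z1] and D2 = binary_spaceD[OF Z2]
  let ?A = "E - B"
  have t2: "two Z2 ?A" using two B by blast
  have "\<not> two Z1 {}" unfolding two_def by auto
  then obtain J where J: "J \<subseteq> ?A" "\<not> two Z1 J" and max: "\<And>g. g \<in> ?A - J \<Longrightarrow> two Z1 (insert g J)"
    using two_maximal_exists[of ?A "{}" Z1] D1(1) by auto
  have J2: "\<not> two Z2 J" and max2: "\<And>g. g \<in> ?A - J \<Longrightarrow> two Z2 (insert g J)"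
    using J(1,2) max two B(1) by (blast, metis Diff_iff Diff_subset insert_subset order_trans)
  note m1 = two_maximal[OF Z1 Diff_subset B(3) J max] and m2 = two_maximal[OF Z2 Diff_subset t2 J(1) J2 max2]
  obtain C1 where C1: "C1 \<in> Z1" "C1 \<noteq> {}" "C1 \<subseteq> J" using m1(1) by blast
  obtain C2 where C2: "C2 \<in> Z2" "C2 \<noteq> {}" "C2 \<subseteq> J" using m2(1) by blast
  have span1: "\<forall>g\<in>?A - J. \<exists>C\<in>Z1. g \<in> C \<and> C \<subseteq> insert g J" using m1(2) by blast
  have span2: "\<forall>g\<in>?A - J. \<exists>C\<in>Z2. g \<in> C \<and> C \<subseteq> insert g J" using m2(2) by blast
  \<comment> \<open>A trace \<open>{e}\<close> in \<open>Z2\<close> would make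
    \<open>insert e J\<close> dependent and so produce the trace \<open>{e}\<close> in
    \<open>Z1\<close> as well, against orthogonality.\<close>
  have single: "X \<inter> B \<noteq> {e}" if X: "X \<in> Z2" for X e
  proof
    assume e: "X \<inter> B = {e}"
    have "e \<in> B" using e by auto
    obtain Y where Y: "Y \<in> Z2" "Y \<subseteq> J \<union> B" "Y \<inter> B = X \<inter> B"
      using reduce_modulo[OF Z2 span2 X, of B] D2(3)[OF X] J(1) by blast
    then have Y': "Y \<subseteq> insert e J" "e \<in> Y" using e by auto
    have "two Z2 (insert e J)" unfolding two_def
      using Y Y' C2 J \<open>e \<in> B\<close> by (intro bexI[of _ Y] bexI[of _ C2]) auto
    moreover have "insert e J \<subseteq> E" using J(1) \<open>e \<in> B\<close> B(1) by blast
    ultimately have "two Z1 (insert e J)" using two by blast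
    then obtain K where K: "K \<in> Z1" "K \<subseteq> insert e J" "e \<in> K"
      using J(2) unfolding two_def by (metis subset_insert)
    then have "K \<inter> B = {e}" using J \<open>e \<in> B\<close> by auto
    then show False using B(2) K(1) unfolding orthogonal_def by fastforce
  qed
  have pair2: "\<exists>C\<in>Z2. C \<inter> B = {e, f}" if ef: "e \<in> B" "f \<in> B" "e \<noteq> f" for e f
  proof -
    obtain X where X: "X \<in> Z1" "X \<inter> B = {e, f}" using pair ef by blast
    obtain Y where Y: "Y \<in> Z1" "Y \<subseteq> J \<union> B" "Y \<inter> B = X \<inter> B"
      using reduce_modulo[OF Z1 span1 X(1), of B] D1(3)[OF X(1)] J(1) by blast
    then have Y': "Y \<subseteq> J \<union> {e, f}" "e \<in> Y" using X by auto
    have "two Z1 (J \<union> {e, f})" unfolding two_def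
      using Y Y' C1 J ef by (intro bexI[of _ Y] bexI[of _ C1]) auto
    moreover have "J \<union> {e, f} \<subseteq> E" using J(1) ef B(1) by blast
    ultimately have "two Z2 (J \<union> {e, f})" using two by blast
    then obtain P Q where PQ: "P \<in> Z2" "Q \<in> Z2" "P \<subseteq> J \<union> {e, f}" "Q \<subseteq> J \<union> {e, f}"
        "P \<noteq> {}" "Q \<noteq> {}" "P \<noteq> Q"
      unfolding two_def by blast
    then have "\<not> (P \<subseteq> J \<and> Q \<subseteq> J)" using J2 unfolding two_def by metis
    then obtain K where K: "K \<in> Z2" "K \<subseteq> J \<union> {e, f}" "\<not> K \<subseteq> J" using PQ by metis
    have "K \<inter> B \<subseteq> {e, f}" "K \<inter> B \<noteq> {}" using K(2,3) J(1) ef(1,2) by blast+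
    moreover have "K \<inter> B \<noteq> {e}" "K \<inter> B \<noteq> {f}" using single K by auto
    ultimately have "K \<inter> B = {e, f}" by auto
    then show ?thesis using K by blast
  qed
  \<comment> \<open>All pairs are traces and no singleton is, so a nonempty trace loses two elements
    when a pair is added.\<close>
  have "even (card (X \<inter> B))" if "X \<in> Z2" for X using that
  proof (induction "card (X \<inter> B)" arbitrary: X rule: less_induct)
    case less
    have fX: "finite (X \<inter> B)" using D2(5) less.prems by auto
    show ?case
    proof (cases "X \<inter> B = {}")
      case False
      then obtain e where e: "e \<in> X \<inter> B" by blast
      then obtain f where f: "f \<in> X \<inter> B" "f \<noteq> e" using single[OF less.prems, of e] by blast
      obtain C where C: "C \<in> Z2" "C \<inter> B = {e, f}" using pair2 e f by blast
      have eq: "(X \<oplus> C) \<inter> B = (X \<inter> B) - {e, f}"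
        unfolding symd_Int_distrib C(2) using e f(1) by auto
      have "card ((X \<oplus> C) \<inter> B) < card (X \<inter> B)" unfolding eq
        using fX e by (intro psubset_card_mono) auto
      then have "even (card ((X \<oplus> C) \<inter> B))" using less C D2(4) by blast
      then show ?thesis using even_card_Int_symd[of X C B] D2(5) less.prems C f by auto
    qed simp
  qed
  then show ?thesis unfolding orthogonal_def by blast
qed

text \<open>If \<open>B\<close> is not minimal, it splits into two orthogonal sets, whose
  complements are larger and hence still dependent.\<close>

theorem orthogonal_transfer:
  assumes Z1: "binary_space E Z1" and Z2: "binary_space E Z2"
    and two: "\<And>X. X \<subseteq> E \<Longrightarrow> two Z1 X \<longleftrightarrow> two Z2 X"
    and B: "B \<subseteq> E" "orthogonal Z1 B" "two Z1 (E - B)"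
  shows "orthogonal Z2 B"
  using B
proof (induction "card B" arbitrary: B rule: less_induct)
  case less
  note D1 = binary_spaceD[OF Z1] and D2 = binary_spaceD[OF Z2]
  have fB: "finite B" using less.prems D1(1) finite_subset by blast
  show ?case
  proof (cases "\<exists>y. y \<subset> B \<and> y \<noteq> {} \<and> orthogonal Z1 y")
    case True
    then obtain y where y: "y \<subset> B" "y \<noteq> {}" "orthogonal Z1 y" by blast
    have spl: "card (X \<inter> B) = card (X \<inter> y) + card (X \<inter> (B - y))" if "finite X" for X
    proof -
      have "X \<inter> B = (X \<inter> y) \<union> (X \<inter> (B - y))" using y by auto
      then show ?thesis
        using that card_Un_disjoint[of "X \<inter> y" "X \<inter> (B - y)"] by (simp add: disjoint_iff)
    qed
    have o: "orthogonal Z1 (B - y)"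
      unfolding orthogonal_def
    proof
      fix X assume X: "X \<in> Z1"
      then show "even (card (X \<inter> (B - y)))"
        using spl[of X] y(3) less.prems(2) D1(5)[OF X] unfolding orthogonal_def by (metis even_add)
    qed
    have "card y < card B" "card (B - y) < card B"
      using y fB by (auto intro!: psubset_card_mono)
    moreover have "two Z1 (E - y)" "two Z1 (E - (B - y))"
      using less.prems(3) y by (auto elim!: two_mono)
    ultimately have "orthogonal Z2 y" "orthogonal Z2 (B - y)"
      using less.hyps[of y] less.hyps[of "B - y"] less.prems(1) y o by auto
    then show ?thesis using spl D2(5) unfolding orthogonal_def by (metis even_add)
  next
    case False
    show ?thesis
    proof (rule two_pair_transfer[OF Z1 Z2 two less.prems])
      fix e f assume ef: "e \<in> B" "f \<in> B" "e \<noteq> f"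
      define S where "S = (\<lambda>X. X \<inter> B) ` Z1"
      have bS: "binary_space B S" unfolding binary_space_def S_def
      proof (intro conjI ballI)
        show "finite B" by fact
        show "{} \<in> (\<lambda>X. X \<inter> B) ` Z1" using D1(2) by force
        show "(\<lambda>X. X \<inter> B) ` Z1 \<subseteq> Pow B" by auto
        fix X Y assume "X \<in> (\<lambda>X. X \<inter> B) ` Z1" "Y \<in> (\<lambda>X. X \<inter> B) ` Z1"
        then obtain X' Y' where "X' \<in> Z1" "Y' \<in> Z1" "X = X' \<inter> B" "Y = Y' \<inter> B" by auto
        then show "X \<oplus> Y \<in> (\<lambda>X. X \<inter> B) ` Z1"
          using D1(4)[of X' Y'] symd_Int_distrib[of X' Y' B] by (metis imageI)
      qed
      \<comment> \<open>A vector separating the pair from the traces of \<open>Z1\<close> on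
        \<open>B\<close> would be a proper nonempty orthogonal subset of \<open>B\<close>.\<close>
      have "{e, f} \<in> S"
      proof (rule ccontr)
        assume "{e, f} \<notin> S"
        then obtain y where y: "y \<subseteq> B" "orthogonal S y" "odd (card ({e, f} \<inter> y))"
          using orthogonal_separates[OF bS, of "{e, f}"] ef by blast
        have "X \<inter> y = (X \<inter> B) \<inter> y" for X using y(1) by auto
        then have "orthogonal Z1 y" using y(2) unfolding orthogonal_def S_def by (metis imageI)
        moreover have "y \<noteq> {}" "y \<noteq> B" using y(3) ef by (auto simp: insert_absorb)
        ultimately show False using False y(1) by blast
      qed
      then show "\<exists>C\<in>Z1. C \<inter> B = {e, f}" unfolding S_def by force
    qed auto
  qed
qed

text \<open>A member of \<open>Z1\<close> that contains two members splits into smaller ones. Any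
  other nonempty \<open>X\<close> in \<open>Z1\<close> extends to a basis of \<open>E\<close>. This
  basis contains a nonempty member of \<open>Z2\<close>, which is also in \<open>Z1\<close> and can
  therefore only be \<open>X\<close>.\<close>

lemma binary_space_eqI:
  assumes Z1: "binary_space E Z1" and Z2: "binary_space E Z2"
    and two: "\<And>X. X \<subseteq> E \<Longrightarrow> two Z1 X \<longleftrightarrow> two Z2 X" and E: "two Z1 E" and sub: "Z2 \<subseteq> Z1"
  shows "Z1 = Z2"
proof -
  note D1 = binary_spaceD[OF Z1] and D2 = binary_spaceD[OF Z2]
  have E2: "two Z2 E" using E two by blast
  have "X \<in> Z2" if "X \<in> Z1" for X using that
  proof (induction "card X" arbitrary: X rule: less_induct)
    case less
    have fX: "finite X" using D1(5) less.prems by blast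
    show ?case
    proof (cases "two Z1 X")
      case True
      then obtain A where A: "A \<in> Z1" "A \<subset> X" "A \<noteq> {}" unfolding two_def by blast
      have eq: "X - A = X \<oplus> A" using A by auto
      have "card A < card X" "card (X - A) < card X"
        using A fX by (auto intro!: psubset_card_mono)
      moreover have "X - A \<in> Z1" using eq D1(4) A less.prems by simp
      ultimately have "A \<in> Z2" "X - A \<in> Z2" using less.hyps A by auto
      moreover have "A \<oplus> (X - A) = X" using A by auto
      ultimately show ?thesis using D2(4) by metis
    next
      case False
      obtain J where J: "X \<subseteq> J" "J \<subseteq> E" "\<not> two Z1 J"
          "\<And>g. g \<in> E - J \<Longrightarrow> two Z1 (insert g J)"
        using two_maximal_exists[OF D1(1) D1(3)[OF less.prems] False] by blast
      then obtain C where C: "C \<in> Z2" "C \<noteq> {}" "C \<subseteq> J"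
        using two_maximal(1)[OF Z2 order.refl E2, of J] two by (metis Diff_iff insert_subset)
      show ?thesis
      proof (cases "X = {}")
        case True
        then show ?thesis using D2(2) by simp
      next
        case X: False
        have "C \<in> Z1" using C(1) sub by blast
        moreover have "\<not> (C \<noteq> X \<and> C \<in> Z1)"
          using J(1,3) C(2,3) less.prems X unfolding two_def by metis
        ultimately have "C = X" by blast
        then show ?thesis using C by simp
      qed
    qed
  qed
  then show ?thesis using sub by blast
qed

section \<open>Degrees, cuts and connectivity expressed by boundaries modulo two\<close>

section \<open>Boundaries of edge sets\<close>

lemma multigraphD:
  assumes "multigraph G"
  shows "finite (mverts G)" "finite (medges G)"
    "e \<in> medges G \<Longrightarrow> mends G e \<subseteq> mverts G"
    "e \<in> medges G \<Longrightarrow> card (mends G e) = 1 \<or> card (mends G e) = 2"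
    "e \<notin> medges G \<Longrightarrow> mends G e = {}"
  using assms unfolding multigraph_def by auto

lemma multigraph_ends:
  assumes "multigraph G" "e \<in> medges G"
  obtains a b where "mends G e = {a, b}" "a \<in> mverts G" "b \<in> mverts G" "card (mends G e) = 2 \<longleftrightarrow> a \<noteq> b"
proof -
  consider "card (mends G e) = 1" | "card (mends G e) = 2" using multigraphD(4)[OF assms] by blast
  then show ?thesis
  proof cases
    case 1
    then obtain a where "mends G e = {a}" by (auto simp: card_1_singleton_iff)
    then show ?thesis using that[of a a] multigraphD(3)[OF assms] by auto
  next
    case 2
    then obtain a b where "mends G e = {a, b}" "a \<noteq> b" by (auto simp: card_2_iff)
    then show ?thesis using that[of a b] multigraphD(3)[OF assms] by auto
  qed
qed

lemma ends_pair:
  assumes "multigraph G" "X \<subseteq> medges G" "e \<in> X"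
  shows "\<exists>a b. mends G e = {a, b} \<and> (card (mends G e) = 2 \<longleftrightarrow> a \<noteq> b)"
proof -
  have "e \<in> medges G" using assms by blast
  then show ?thesis by (rule multigraph_ends[OF assms(1)]) blast
qed

lemma single_vertex_end:
  assumes "multigraph G" "X \<subseteq> medges G" "e \<in> X" "v \<in> mends G e" "card (mends G e) \<noteq> 2"
  shows "mends G e = {v}"
  using ends_pair[OF assms(1-3)] assms(4,5) by auto

definition edge_verts :: "('v, 'e) mgraph \<Rightarrow> 'e set \<Rightarrow> 'v set" where
  "edge_verts G X = (\<Union>e\<in>X. mends G e)"

lemma edge_vertsI: "e \<in> X \<Longrightarrow> v \<in> mends G e \<Longrightarrow> v \<in> edge_verts G X"
  unfolding edge_verts_def by blast

lemma edge_vertsE: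
  assumes "v \<in> edge_verts G X" obtains e where "e \<in> X" "v \<in> mends G e"
  using assms unfolding edge_verts_def by blast

lemma edge_verts_mono: "X \<subseteq> Y \<Longrightarrow> edge_verts G X \<subseteq> edge_verts G Y"
  unfolding edge_verts_def by blast

lemma edge_verts_Un: "edge_verts G (X \<union> Y) = edge_verts G X \<union> edge_verts G Y"
  unfolding edge_verts_def by blast

lemma edge_verts_insert: "edge_verts G (insert e X) = mends G e \<union> edge_verts G X"
  unfolding edge_verts_def by blast

lemma edge_verts_empty [simp]: "edge_verts G {} = {}"
  unfolding edge_verts_def by blast

lemma edge_verts_subset: "multigraph G \<Longrightarrow> edge_verts G X \<subseteq> mverts G"
  unfolding edge_verts_def using multigraphD(3,5) by fastforce

text \<open>The boundary of an edge set modulo two. Loops are left out because they contribute 2 to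
  the degree.\<close>

definition bd :: "('v, 'e) mgraph \<Rightarrow> 'e set \<Rightarrow> 'v set" where
  "bd G X = {v. odd (card {e \<in> X. v \<in> mends G e \<and> card (mends G e) = 2})}"

lemma bd_empty [simp]: "bd G {} = {}"
  by (simp add: bd_def)

lemma bd_single: "bd G {e} = (if card (mends G e) = 2 then mends G e else {})"
proof -
  have "{f \<in> {e}. v \<in> mends G f \<and> card (mends G f) = 2} =
      (if v \<in> mends G e \<and> card (mends G e) = 2 then {e} else {})" for v by auto
  then show ?thesis unfolding bd_def by auto
qed

text \<open>In the form \<open>{a} \<oplus> {b}\<close> the boundary of an edge is right for loops
  too, and the boundaries of consecutive edges telescope.\<close>

lemma bd_single_pair:
  assumes "mends G e = {a, b}" shows "bd G {e} = {a} \<oplus> {b}"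
proof (cases "a = b")
  case False
  then show ?thesis unfolding bd_single assms symd_singles[OF False] by simp
qed (simp add: bd_single assms)

lemma bd_symd:
  assumes "finite X" "finite Y"
  shows "bd G (X \<oplus> Y) = bd G X \<oplus> bd G Y"
proof -
  have "{e \<in> X \<oplus> Y. v \<in> mends G e \<and> card (mends G e) = 2} =
     {e \<in> X. v \<in> mends G e \<and> card (mends G e) = 2} \<oplus> {e \<in> Y. v \<in> mends G e \<and> card (mends G e) = 2}"
    for v by auto
  then show ?thesis unfolding bd_def using assms by (auto simp: even_card_symd)
qed

lemma bd_Un:
  assumes "finite X" "finite Y" "X \<inter> Y = {}"
  shows "bd G (X \<union> Y) = bd G X \<oplus> bd G Y"
  using bd_symd[OF assms(1,2)] symd_disjoint[OF assms(3)] by metis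

lemma bd_insert:
  assumes "finite X" "e \<notin> X"
  shows "bd G (insert e X) = bd G X \<oplus> bd G {e}"
proof -
  have "insert e X = X \<oplus> {e}" using assms by auto
  then show ?thesis using bd_symd[of X "{e}"] assms by simp
qed

lemma bd_subset: "bd G X \<subseteq> edge_verts G X"
proof
  fix v assume "v \<in> bd G X"
  then have "{e \<in> X. v \<in> mends G e \<and> card (mends G e) = 2} \<noteq> {}"
    unfolding bd_def by (metis (no_types, lifting) card.empty even_zero mem_Collect_eq)
  then show "v \<in> edge_verts G X" unfolding edge_verts_def by blast
qed

lemma bd_cong:
  assumes "\<And>e. e \<in> X \<Longrightarrow> mends G e = mends H e"
  shows "bd G X = bd H X"
proof -
  have "{e \<in> X. v \<in> mends G e \<and> card (mends G e) = 2} = {e \<in> X. v \<in> mends H e \<and> card (mends H e) = 2}"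
    for v using assms by auto
  then show ?thesis unfolding bd_def by simp
qed

lemma edge_verts_cong:
  assumes "\<And>e. e \<in> X \<Longrightarrow> mends G e = mends H e"
  shows "edge_verts G X = edge_verts H X"
  unfolding edge_verts_def using assms by simp

definition cut :: "('v, 'e) mgraph \<Rightarrow> 'v set \<Rightarrow> 'e set" where
  "cut G U = {e \<in> medges G. mends G e \<inter> U \<noteq> {} \<and> \<not> mends G e \<subseteq> U}"

text \<open>By additivity of \<open>bd\<close> it suffices to consider one edge, whose boundary
  meets \<open>U\<close> in an odd number of vertices exactly if it crosses between \<open>U\<close>
  and the outside. Orthogonality of cuts and \<open>reach_closed\<close> are instances.\<close>

lemma handshake:
  assumes G: "multigraph G" and X: "X \<subseteq> medges G"
  shows "even (card (bd G X \<inter> U)) \<longleftrightarrow> even (card (X \<inter> cut G U))"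
proof -
  have "finite X" using X multigraphD(2)[OF G] finite_subset by blast
  then show ?thesis using X
  proof (induction X rule: finite_induct)
    case (insert e X)
    obtain a b where ab: "mends G e = {a, b}" "card (mends G e) = 2 \<longleftrightarrow> a \<noteq> b"
      using ends_pair[OF G insert.prems insertI1] by blast
    have fin: "finite (bd G X)" 
      using bd_subset[of G X] edge_verts_subset[OF G, of X] multigraphD(1)[OF G] by (meson finite_subset)
    have fin2: "finite (bd G {e})" unfolding bd_single ab by auto
    have 1: "even (card (bd G {e} \<inter> U)) \<longleftrightarrow> e \<notin> cut G U"
      unfolding bd_single cut_def using ab insert.prems by (auto simp: Int_insert_left)
    have 2: "insert e X = X \<oplus> {e}" using insert.hyps by auto
    have 3: "even (card ({e} \<inter> cut G U)) \<longleftrightarrow> e \<notin> cut G U" by auto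
    have "even (card (bd G (insert e X) \<inter> U)) \<longleftrightarrow> (even (card (bd G X \<inter> U)) \<longleftrightarrow> even (card (bd G {e} \<inter> U)))"
      unfolding bd_insert[OF insert.hyps] using even_card_Int_symd[OF fin fin2] .
    also have "\<dots> \<longleftrightarrow> even (card (insert e X \<inter> cut G U))"
      unfolding 2 using even_card_Int_symd[of X "{e}" "cut G U"] insert 1 3 by auto
    finally show ?case .
  qed simp
qed

lemma bd_subset_verts: "multigraph G \<Longrightarrow> bd G X \<subseteq> mverts G"
  by (meson bd_subset edge_verts_subset order_trans)

lemma even_card_bd:
  assumes "multigraph G" "X \<subseteq> medges G"
  shows "even (card (bd G X))"
proof -
  have "cut G (mverts G) = {}" unfolding cut_def using multigraphD(3)[OF assms(1)] by blast
  then show ?thesis using handshake[OF assms, of "mverts G"] bd_subset_verts[OF assms(1), of X]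
    by (simp add: Int_absorb2)
qed

definition evens :: "('v, 'e) mgraph \<Rightarrow> 'e set set" where
  "evens G = {X. X \<subseteq> medges G \<and> bd G X = {}}"

lemma evensD: "X \<in> evens G \<Longrightarrow> X \<subseteq> medges G" "X \<in> evens G \<Longrightarrow> bd G X = {}"
  unfolding evens_def by auto

lemma binary_space_evens:
  assumes "multigraph G" shows "binary_space (medges G) (evens G)"
  unfolding binary_space_def
proof (intro conjI ballI)
  have f: "finite (medges G)" using multigraphD(2)[OF assms] .
  show "finite (medges G)" by fact
  show "{} \<in> evens G" "evens G \<subseteq> Pow (medges G)" unfolding evens_def by auto
  fix A B assume "A \<in> evens G" "B \<in> evens G"
  then show "A \<oplus> B \<in> evens G"
    unfolding evens_def using bd_symd[of A B G] finite_subset[OF _ f] by auto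
qed

lemmas evens_symd = binary_spaceD(4)[OF binary_space_evens]
lemmas evens_finite = binary_spaceD(5)[OF binary_space_evens]

lemma evens_Diff:
  assumes "multigraph G" "A \<in> evens G" "B \<in> evens G" "B \<subseteq> A"
  shows "A - B \<in> evens G"
proof -
  have "A - B = A \<oplus> B" using assms by auto
  then show ?thesis using evens_symd assms by metis
qed

lemma orthogonal_cut:
  assumes "multigraph G" shows "orthogonal (evens G) (cut G U)"
  unfolding orthogonal_def
proof
  fix X assume "X \<in> evens G"
  then show "even (card (X \<inter> cut G U))" using handshake[OF assms, of X U] evensD by fastforce
qed

text \<open>Connection by an edge set with the right boundary instead of a walk: transitivity
  becomes addition of boundaries. The empty set serves for \<open>a = b\<close>, even if
  \<open>a\<close> is not a vertex of \<open>G\<close>.\<close>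

definition reach :: "('v, 'e) mgraph \<Rightarrow> 'e set \<Rightarrow> 'v \<Rightarrow> 'v \<Rightarrow> bool" where
  "reach G X a b \<longleftrightarrow> (\<exists>Q\<subseteq>X. bd G Q = {a} \<oplus> {b})"

lemma reach_refl [simp]: "reach G X a a"
  unfolding reach_def by (auto intro!: exI[of _ "{}"])

lemma reach_sym: "reach G X a b \<Longrightarrow> reach G X b a"
  unfolding reach_def by (simp add: symd_commute)

lemma reach_mono: "reach G X a b \<Longrightarrow> X \<subseteq> Y \<Longrightarrow> reach G Y a b"
  unfolding reach_def by blast

lemma reach_trans:
  assumes "finite X" "reach G X a b" "reach G X b c"
  shows "reach G X a c"
proof -
  obtain P Q where PQ: "P \<subseteq> X" "Q \<subseteq> X" "bd G P = {a} \<oplus> {b}" "bd G Q = {b} \<oplus> {c}"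
    using assms unfolding reach_def by blast
  then have "bd G (P \<oplus> Q) = ({a} \<oplus> {b}) \<oplus> ({b} \<oplus> {c})"
    using bd_symd[of P Q G] assms(1) finite_subset by metis
  also have "\<dots> = {a} \<oplus> {c}" by auto
  finally show ?thesis unfolding reach_def using symd_subset[OF PQ(1,2)] by blast
qed

lemma reach_edge:
  assumes "e \<in> X" "mends G e = {a, b}"
  shows "reach G X a b"
  unfolding reach_def using bd_single_pair[OF assms(2)] assms(1) by blast

lemma reach_edge':
  assumes "multigraph G" "X \<subseteq> medges G" "e \<in> X" "a \<in> mends G e" "b \<in> mends G e"
  shows "reach G X a b"
proof -
  obtain c d where cd: "mends G e = {c, d}" using ends_pair[OF assms(1-3)] by blast
  have "reach G X c d" "reach G X d c" using reach_edge[OF assms(3) cd] reach_sym by metis+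
  then show ?thesis using assms(4,5) unfolding cd by auto
qed

text \<open>If no edge of \<open>X\<close> leaves \<open>U\<close>, a boundary
  \<open>{a} \<oplus> {b}\<close> inside \<open>X\<close> has evenly many vertices in
  \<open>U\<close>. This replaces induction along a walk.\<close>

lemma reach_closed:
  assumes G: "multigraph G" and X: "X \<subseteq> medges G" and r: "reach G X a b" and a: "a \<in> U"
    and cl: "\<And>e. e \<in> X \<Longrightarrow> mends G e \<inter> U \<noteq> {} \<Longrightarrow> mends G e \<subseteq> U"
  shows "b \<in> U"
proof (rule ccontr)
  assume b: "b \<notin> U"
  obtain Q where Q: "Q \<subseteq> X" "bd G Q = {a} \<oplus> {b}" using r unfolding reach_def by blast
  have "Q \<inter> cut G U = {}" using Q(1) cl unfolding cut_def by blast
  then have "even (card (bd G Q \<inter> U))" using handshake[OF G, of Q U] Q X by simp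
  moreover have "bd G Q \<inter> U = {a}" unfolding Q(2) using a b by auto
  ultimately show False by simp
qed

lemma reach_cong:
  assumes "\<And>e. e \<in> X \<Longrightarrow> mends G e = mends H e"
  shows "reach G X a b \<longleftrightarrow> reach H X a b"
  unfolding reach_def using bd_cong assms by (metis subsetD)

lemma madjacent_reach:
  assumes G: "multigraph G"
  shows "(a, b) \<in> (madjacent G)\<^sup>* \<longleftrightarrow> reach G (medges G) a b"
proof
  assume "(a, b) \<in> (madjacent G)\<^sup>*"
  then show "reach G (medges G) a b"
  proof (induction rule: rtrancl_induct)
    case (step y z)
    then obtain e where "e \<in> medges G" "mends G e = {y, z}" unfolding madjacent_def by blast
    then have "reach G (medges G) y z" using reach_edge by metis
    then show ?case using step.IH reach_trans multigraphD(2)[OF G] by metis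
  qed simp
next
  assume r: "reach G (medges G) a b"
  let ?U = "{x. (a, x) \<in> (madjacent G)\<^sup>*}"
  have "b \<in> ?U"
  proof (rule reach_closed[OF G order.refl r])
    show "a \<in> ?U" by simp
    fix e assume e: "e \<in> medges G" "mends G e \<inter> ?U \<noteq> {}"
    obtain c d where cd: "mends G e = {c, d}" using multigraph_ends[OF G e(1)] by blast
    then have "(c, d) \<in> madjacent G" "(d, c) \<in> madjacent G"
      unfolding madjacent_def using e(1) by (auto simp: insert_commute)
    then show "mends G e \<subseteq> ?U" using e(2) unfolding cd by (auto intro: rtrancl.rtrancl_into_rtrancl)
  qed
  then show "(a, b) \<in> (madjacent G)\<^sup>*" by simp
qed

lemma connected_mgraph_reach:
  assumes "multigraph G"
  shows "connected_mgraph G \<longleftrightarrow>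
    mverts G \<noteq> {} \<and> (\<forall>u\<in>mverts G. \<forall>v\<in>mverts G. reach G (medges G) u v)"
  unfolding connected_mgraph_def madjacent_reach[OF assms] ..

lemma make_mgraph_sel [simp]:
  "mverts (make_mgraph V E f) = V" "medges (make_mgraph V E f) = E"
  "mends (make_mgraph V E f) e = (if e \<in> E then f e else {})"
  unfolding make_mgraph_def by auto

lemma edge_restrict_sel [simp]:
  "mverts (edge_restrict G X) = edge_verts G X" "medges (edge_restrict G X) = X"
  "mends (edge_restrict G X) e = (if e \<in> X then mends G e else {})"
  unfolding edge_restrict_def edge_verts_def by auto

lemma multigraph_edge_restrict:
  assumes "multigraph G" "X \<subseteq> medges G"
  shows "multigraph (edge_restrict G X)"
  unfolding multigraph_def
  using assms multigraphD[OF assms(1)] edge_verts_subset[OF assms(1), of X]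
  by (auto intro: finite_subset edge_vertsI)

lemma bd_edge_restrict: "Y \<subseteq> X \<Longrightarrow> bd (edge_restrict G X) Y = bd G Y"
  by (rule bd_cong) auto

lemma edge_verts_edge_restrict: "Y \<subseteq> X \<Longrightarrow> edge_verts (edge_restrict G X) Y = edge_verts G Y"
  by (rule edge_verts_cong) auto

lemma evens_edge_restrict: "X \<subseteq> medges G \<Longrightarrow> evens (edge_restrict G X) = {Y \<in> evens G. Y \<subseteq> X}"
  unfolding evens_def by (auto simp: bd_edge_restrict)

lemma reach_edge_restrict: "Y \<subseteq> X \<Longrightarrow> reach (edge_restrict G X) Y a b \<longleftrightarrow> reach G Y a b"
  by (rule reach_cong) auto

section \<open>Cycles\<close>

lemma connected_edge_restrict:
  assumes "multigraph G" "X \<subseteq> medges G"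
  shows "connected_mgraph (edge_restrict G X) \<longleftrightarrow>
    edge_verts G X \<noteq> {} \<and> (\<forall>u\<in>edge_verts G X. \<forall>v\<in>edge_verts G X. reach G X u v)"
  unfolding connected_mgraph_reach[OF multigraph_edge_restrict[OF assms]]
  by (simp add: reach_edge_restrict)

lemma mdegree_edge_restrict:
  assumes G: "multigraph G" and X: "X \<subseteq> medges G"
  shows "mdegree (edge_restrict G X) v =
    card {e \<in> X. v \<in> mends G e \<and> card (mends G e) = 2} + 2 * card {e \<in> X. mends G e = {v}}"
proof -
  have fX: "finite X" using X multigraphD(2)[OF G] finite_subset by blast
  have 1: "{e \<in> medges (edge_restrict G X). v \<in> mends (edge_restrict G X) e} =
     {e \<in> X. v \<in> mends G e \<and> card (mends G e) = 2} \<union> {e \<in> X. mends G e = {v}}"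
  proof -
    show ?thesis using single_vertex_end[OF G X] by auto
  qed
  have 2: "{e \<in> medges (edge_restrict G X). mends (edge_restrict G X) e = {v}} = {e \<in> X. mends G e = {v}}"
    by auto
  have "card ({e \<in> X. v \<in> mends G e \<and> card (mends G e) = 2} \<union> {e \<in> X. mends G e = {v}}) =
     card {e \<in> X. v \<in> mends G e \<and> card (mends G e) = 2} + card {e \<in> X. mends G e = {v}}"
    by (rule card_Un_disjoint) (use fX in auto)
  then show ?thesis unfolding mdegree_def 1 2 by simp
qed

lemma mcycle_even:
  assumes G: "multigraph G" and C: "is_mcycle G C"
  shows "C \<in> evens G" "C \<noteq> {}"
proof -
  have CE: "C \<subseteq> medges G" using C unfolding is_mcycle_def by blast
  have "v \<notin> bd G C" for v
  proof
    assume v: "v \<in> bd G C"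
    then have "v \<in> edge_verts G C" using bd_subset by fastforce
    then have "mdegree (edge_restrict G C) v = 2" using C unfolding is_mcycle_def by simp
    then have "even (card {e \<in> C. v \<in> mends G e \<and> card (mends G e) = 2})"
      unfolding mdegree_edge_restrict[OF G CE] by presburger
    then show False using v unfolding bd_def by blast
  qed
  then show "C \<in> evens G" using CE unfolding evens_def by blast
  show "C \<noteq> {}" using C unfolding is_mcycle_def connected_mgraph_def by auto
qed

lemma even_card_other: "even (card S) \<Longrightarrow> e \<in> S \<Longrightarrow> \<exists>f\<in>S. f \<noteq> e"
proof (rule ccontr)
  assume "even (card S)" "e \<in> S" "\<not> (\<exists>f\<in>S. f \<noteq> e)"
  moreover from this have "S = {e}" by blast
  ultimately show False by simp
qed

lemma other_end:
  assumes "multigraph G" "X \<subseteq> medges G" "e \<in> X" "v \<in> mends G e"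
  shows "\<exists>w. mends G e = {v, w}"
  using ends_pair[OF assms(1-3)] assms(4) by auto

text \<open>
  For a non-loop edge \<open>{v, w}\<close> of a minimal even set, parity at the set of vertices reachable
  from \<open>w\<close> without using \<open>v\<close> gives a second edge by which to return to \<open>v\<close>.
\<close>

lemma minimal_even_mcycle:
  assumes G: "multigraph G" and X: "X \<in> evens G" "X \<noteq> {}"
    and min: "\<And>Y. Y \<in> evens G \<Longrightarrow> Y \<noteq> {} \<Longrightarrow> Y \<subseteq> X \<Longrightarrow> Y = X"
  shows "is_mcycle G X"
proof -
  have XE: "X \<subseteq> medges G" using X evensD by blast
  have fX: "finite X" using XE multigraphD(2)[OF G] finite_subset by blast
  let ?N = "\<lambda>Z v. {e \<in> Z. v \<in> mends G e \<and> card (mends G e) = 2}"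
  let ?L = "\<lambda>Z v. {e \<in> Z. mends G e = {v}}"
  have conn: "reach G X a b" if ab: "a \<in> edge_verts G X" "b \<in> edge_verts G X" for a b
  proof -
    let ?U = "{x. reach G X a x}"
    \<comment> \<open>The component of \<open>X\<close> at \<open>a\<close>. It shares no vertex
      with the rest of \<open>X\<close>, so it is even and by minimality equals
      \<open>X\<close>.\<close>
    let ?Y = "{e \<in> X. mends G e \<subseteq> ?U}"
    have dich: "mends G e \<subseteq> ?U \<or> mends G e \<inter> ?U = {}" if "e \<in> X" for e
      using reach_edge'[OF G XE that] reach_trans[OF fX, of G a] by blast
    have "bd G ?Y = {}"
    proof -
      have eq: "X = ?Y \<union> (X - ?Y)" by blast
      have "bd G X = bd G ?Y \<oplus> bd G (X - ?Y)" by (subst eq, rule bd_Un) (use fX in auto)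
      then have "bd G ?Y = bd G (X - ?Y)" using evensD(2)[OF X(1)] by simp
      moreover have "bd G ?Y \<subseteq> ?U" using bd_subset[of G ?Y] unfolding edge_verts_def by blast
      moreover have "edge_verts G (X - ?Y) \<inter> ?U = {}" unfolding edge_verts_def using dich by blast
      then have "bd G (X - ?Y) \<inter> ?U = {}" using bd_subset[of G "X - ?Y"] by blast
      ultimately show ?thesis by blast
    qed
    moreover obtain e where e: "e \<in> X" "a \<in> mends G e" using ab edge_vertsE by metis
    then have "e \<in> ?Y" using dich[OF e(1)] by auto
    ultimately have "?Y = X" using min[of ?Y] XE unfolding evens_def by blast
    moreover obtain f where "f \<in> X" "b \<in> mends G f" using ab edge_vertsE by metis
    ultimately show ?thesis by blast
  qed
  have deg: "mdegree (edge_restrict G X) v = 2" if v: "v \<in> edge_verts G X" for v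
  proof (cases "?L X v = {}")
    case False
    then obtain l where l: "l \<in> X" "mends G l = {v}" by blast
    have "{l} \<in> evens G" using l XE unfolding evens_def by (auto simp: bd_single)
    then have "X = {l}" using min[of "{l}"] l by blast
    then have "?N X v = {}" "?L X v = {l}" using l by auto
    then show ?thesis unfolding mdegree_edge_restrict[OF G XE] by (metis card.empty card_1_singleton_iff One_nat_def mult_1_right plus_nat.add_0)
  next
    case True
    obtain e where e: "e \<in> X" "v \<in> mends G e" using v edge_vertsE by metis
    obtain w where w: "mends G e = {v, w}" "v \<noteq> w" 
    proof -
      obtain w where "mends G e = {v, w}" using other_end[OF G XE e] by blast
      then show ?thesis using that[of w] True e(1) by auto
    qed
    \<comment> \<open>The edges avoiding \<open>v\<close>: the cycle is to leave \<open>v\<close>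
      along \<open>e\<close> and to touch \<open>v\<close> again only at its last edge.\<close>
    define X' where "X' = {f \<in> X. v \<notin> mends G f}"
    have X'X: "X' \<subseteq> X" unfolding X'_def by blast
    let ?U = "{x. reach G X' w x}"
    have fX': "finite X'" using fX X'X finite_subset by blast
    have vU: "v \<notin> ?U"
    proof
      assume "v \<in> ?U"
      then have r: "reach G X' w v" by simp
      have "v \<in> - {v}" by (rule reach_closed[OF G _ r]) (use X'X XE w in \<open>auto simp: X'_def\<close>)
      then show False by simp
    qed
    have cutv: "v \<in> mends G f" if f: "f \<in> X" "f \<in> cut G ?U" for f
    proof (rule ccontr)
      assume "v \<notin> mends G f"
      then have "f \<in> X'" using f unfolding X'_def by blast
      then have "mends G f \<subseteq> ?U \<or> mends G f \<inter> ?U = {}"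
        using reach_edge'[OF G _ \<open>f \<in> X'\<close>] X'X XE reach_trans[OF fX', of G w] by blast
      then show False using f(2) unfolding cut_def by blast
    qed
    have "even (card (X \<inter> cut G ?U))"
      using orthogonal_cut[OF G, of ?U] X unfolding orthogonal_def by blast
    moreover have "e \<in> X \<inter> cut G ?U" using e w vU XE unfolding cut_def by auto
    ultimately have "\<exists>f\<in>X \<inter> cut G ?U. f \<noteq> e" by (rule even_card_other)
    then obtain f where f: "f \<in> X" "f \<in> cut G ?U" "f \<noteq> e" by blast
    obtain x where x: "mends G f = {v, x}" "reach G X' w x"
    proof -
      obtain x where x: "mends G f = {v, x}" using other_end[OF G XE f(1) cutv[OF f(1,2)]] by blast
      then have "x \<in> ?U" using f(2) vU unfolding cut_def by auto
      then show ?thesis using that[of x] x by simp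
    qed
    have vx: "v \<noteq> x" using x vU by auto
    obtain Q where Q: "Q \<subseteq> X'" "bd G Q = {w} \<oplus> {x}" using x(2) unfolding reach_def by blast
    have fQ: "finite Q" "e \<notin> Q" "f \<notin> Q" using Q fX' e w f x finite_subset unfolding X'_def by auto
    \<comment> \<open>The edges \<open>e\<close> and \<open>f\<close> with the connection
      \<open>Q\<close> of their other ends form an even set in which \<open>v\<close> has degree 2;
      by minimality it is \<open>X\<close>.\<close>
    have "bd G (insert e (insert f Q)) = bd G Q \<oplus> bd G {f} \<oplus> bd G {e}"
      using fQ f(3) bd_insert[of "insert f Q" e G] bd_insert[of Q f G] by auto
    also have "\<dots> = {}" unfolding Q(2) bd_single using w x vx by auto
    finally have "insert e (insert f Q) = X"
      using min[of "insert e (insert f Q)"] e f Q(1) X'X XE unfolding evens_def by auto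
    then have NX: "?N X v = {e, f}" using Q(1) w x vx unfolding X'_def by auto
    show ?thesis unfolding mdegree_edge_restrict[OF G XE] NX True using f(3) by simp
  qed
  have "edge_verts G X \<noteq> {}"
  proof -
    obtain e where e: "e \<in> X" using X by blast
    obtain a b where "mends G e = {a, b}" using ends_pair[OF G XE e] by blast
    then show ?thesis using edge_vertsI[OF e, of a G] by auto
  qed
  then show ?thesis unfolding is_mcycle_def
    using XE conn deg connected_edge_restrict[OF G XE] by simp
qed

lemma even_contains_mcycle:
  assumes G: "multigraph G" and X: "X \<in> evens G" "X \<noteq> {}"
  obtains C where "is_mcycle G C" "C \<subseteq> X"
proof -
  have "finite X" using X evens_finite[OF G] by blast
  then have "\<exists>C. is_mcycle G C \<and> C \<subseteq> X" using X
  proof (induction X rule: finite_psubset_induct)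
    case (psubset X)
    show ?case
    proof (cases "\<exists>Y\<in>evens G. Y \<noteq> {} \<and> Y \<subset> X")
      case True
      then obtain Y where Y: "Y \<in> evens G" "Y \<noteq> {}" "Y \<subset> X" by blast
      then obtain C where "is_mcycle G C" "C \<subseteq> Y" using psubset.IH[OF Y(3,1,2)] by blast
      then show ?thesis using Y(3) by blast
    next
      case False
      then have "is_mcycle G X" using minimal_even_mcycle[OF G psubset.prems] by blast
      then show ?thesis by blast
    qed
  qed
  then show ?thesis using that by blast
qed

lemma msubgraphD:
  assumes "msubgraph H G"
  shows "multigraph H" "mverts H \<subseteq> mverts G" "medges H \<subseteq> medges G"
    "e \<in> medges H \<Longrightarrow> mends H e = mends G e"
  using assms unfolding msubgraph_def by auto

lemma evens_msubgraph:
  assumes "msubgraph H G"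
  shows "evens H = {Y \<in> evens G. Y \<subseteq> medges H}"
proof -
  have "bd H Y = bd G Y" if "Y \<subseteq> medges H" for Y
    by (rule bd_cong) (use msubgraphD[OF assms] that in blast)
  then show ?thesis unfolding evens_def using msubgraphD(3)[OF assms] by auto
qed

text \<open>If a nonempty even set \<open>A\<close> is not a cycle, a cycle \<open>C\<close> inside
  it leaves the nonempty even set \<open>A - C\<close>, which contains another cycle.\<close>

lemma has_two_cycles_iff:
  assumes H: "multigraph H"
  shows "has_two_cycles H \<longleftrightarrow> two (evens H) (medges H)"
proof
  assume "has_two_cycles H"
  then show "two (evens H) (medges H)" unfolding has_two_cycles_def two_def
    using mcycle_even[OF H] evensD by metis
next
  assume "two (evens H) (medges H)"
  then obtain A B where AB: "A \<in> evens H" "B \<in> evens H" "A \<noteq> {}" "B \<noteq> {}" "A \<noteq> B"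
    unfolding two_def by blast
  have *: "has_two_cycles H" if A: "A \<in> evens H" "A \<noteq> {}" "\<not> is_mcycle H A" for A
  proof -
    obtain C where C: "is_mcycle H C" "C \<subseteq> A" using even_contains_mcycle[OF H A(1,2)] by blast
    then have "A - C \<in> evens H" "A - C \<noteq> {}" using evens_Diff[OF H A(1)] mcycle_even[OF H] A(3) by auto
    then obtain D where D: "is_mcycle H D" "D \<subseteq> A - C" using even_contains_mcycle[OF H] by blast
    then have "C \<noteq> D" using mcycle_even[OF H C(1)] by blast
    then show ?thesis unfolding has_two_cycles_def using C D by blast
  qed
  show "has_two_cycles H" using *[of A] *[of B] AB unfolding has_two_cycles_def by blast
qed

lemma two_iff_circuit:
  assumes G: "multigraph G" and X: "X \<subseteq> medges G"
  shows "two (evens G) X \<longleftrightarrow> (\<exists>K\<in>circuits (bicircular_lift G). K \<subseteq> X)"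
proof
  assume t: "two (evens G) X"
  let ?P = "\<lambda>H. msubgraph H (edge_restrict G X) \<and> has_two_cycles H"
  \<comment> \<open>A circuit comes from a subgraph that is minimal in the subgraph order, where
    isolated vertices count as well. The measure therefore adds vertices and edges.\<close>
  define m where "m = (\<lambda>H :: ('a, 'b) mgraph. card (mverts H) + card (medges H))"
  have mr: "multigraph (edge_restrict G X)" using multigraph_edge_restrict[OF G X] .
  have sub: "msubgraph (edge_restrict G X) G" unfolding msubgraph_def
    using mr X edge_verts_subset[OF G] by auto
  have "two (evens (edge_restrict G X)) X"
    using t unfolding evens_edge_restrict[OF X] two_def by auto
  then have "has_two_cycles (edge_restrict G X)" using has_two_cycles_iff[OF mr] by simp
  moreover have "msubgraph (edge_restrict G X) (edge_restrict G X)" using mr unfolding msubgraph_def by auto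
  ultimately have "?P (edge_restrict G X)" by blast
  then obtain H where H: "?P H" and min: "\<And>K. ?P K \<Longrightarrow> m H \<le> m K"
    using ex_has_least_nat[of ?P _ m] by blast
  have HG: "msubgraph H G" using H sub unfolding msubgraph_def by auto
  have "K = H" if K: "msubgraph K H" "has_two_cycles K" for K
  proof -
    have "msubgraph K (edge_restrict G X)" using K(1) H unfolding msubgraph_def by auto
    then have le: "m H \<le> m K" using min K(2) by blast
    have fin: "finite (mverts H)" "finite (medges H)" using msubgraphD(1)[OF HG] multigraphD by auto
    have s: "mverts K \<subseteq> mverts H" "medges K \<subseteq> medges H" by (rule msubgraphD[OF K(1)])+
    then have "card (mverts K) \<le> card (mverts H)" "card (medges K) \<le> card (medges H)"
      using fin by (auto intro: card_mono)
    then have "card (mverts K) = card (mverts H)" "card (medges K) = card (medges H)"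
      using le unfolding m_def by auto
    then have e: "mverts K = mverts H" "medges K = medges H"
      using card_subset_eq[OF fin(1) s(1)] card_subset_eq[OF fin(2) s(2)] by blast+
    moreover have "mends K = mends H"
    proof
      fix x show "mends K x = mends H x"
        using K(1) e msubgraphD(1)[OF HG] multigraphD(5) unfolding msubgraph_def by metis
    qed
    ultimately show "K = H" by simp
  qed
  then have "medges H \<in> circuits (bicircular_lift G)"
    unfolding bicircular_lift_def using HG H by auto
  moreover have "medges H \<subseteq> X" using H msubgraphD(3) by fastforce
  ultimately show "\<exists>K\<in>circuits (bicircular_lift G). K \<subseteq> X" by blast
next
  assume "\<exists>K\<in>circuits (bicircular_lift G). K \<subseteq> X"
  then obtain H where H: "msubgraph H G" "has_two_cycles H" "medges H \<subseteq> X"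
    unfolding bicircular_lift_def by auto
  then have "two (evens H) (medges H)" using has_two_cycles_iff msubgraphD(1) by blast
  then obtain A B where AB: "A \<in> evens H" "B \<in> evens H" "A \<noteq> {}" "B \<noteq> {}" "A \<noteq> B"
    unfolding two_def by blast
  then have "A \<in> evens G" "A \<subseteq> X" "B \<in> evens G" "B \<subseteq> X"
    using H(3) unfolding evens_msubgraph[OF H(1)] by auto
  then show "two (evens G) X" using AB unfolding two_def by metis
qed

section \<open>Vertices, cuts and even sets under contraction\<close>

section \<open>Components and contractions\<close>

definition reach_class :: "('v, 'e) mgraph \<Rightarrow> 'e set \<Rightarrow> 'v \<Rightarrow> 'v set" where
  "reach_class G X v = {w \<in> mverts G. reach G X v w}"

definition induced :: "('v, 'e) mgraph \<Rightarrow> 'v set \<Rightarrow> ('v, 'e) mgraph" where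
  "induced G C = make_mgraph C {e \<in> medges G. mends G e \<subseteq> C} (mends G)"

lemma mgraph_eqI:
  assumes "multigraph G" "multigraph H" "mverts G = mverts H" "medges G = medges H"
    "\<And>e. e \<in> medges G \<Longrightarrow> mends G e = mends H e"
  shows "(G :: ('v, 'e) mgraph) = H"
proof -
  have "mends G e = mends H e" for e
    using assms(4,5) multigraphD(5)[OF assms(1), of e] multigraphD(5)[OF assms(2), of e]
    by (cases "e \<in> medges G") auto
  then have "mends G = mends H" by blast
  then show ?thesis using assms(3,4) by simp
qed

lemma reach_class_eq:
  assumes G: "multigraph G" "X \<subseteq> medges G" and v: "v \<in> mverts G" and w: "w \<in> mverts G"
  shows "reach_class G X v = reach_class G X w \<longleftrightarrow> reach G X v w"
proof
  assume "reach_class G X v = reach_class G X w"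
  moreover have "w \<in> reach_class G X w" using w unfolding reach_class_def by simp
  ultimately show "reach G X v w" unfolding reach_class_def by blast
next
  assume r: "reach G X v w"
  have fX: "finite X" using G multigraphD(2) finite_subset by blast
  show "reach_class G X v = reach_class G X w"
    unfolding reach_class_def using reach_trans[OF fX r] reach_trans[OF fX reach_sym[OF r]] by blast
qed

lemma reach_class_self: "v \<in> mverts G \<Longrightarrow> v \<in> reach_class G X v"
  unfolding reach_class_def by simp

text \<open>The subgraph induced on the vertices reachable from \<open>v\<close> is the largest
  connected subgraph through \<open>v\<close>. This turns the maximality in
  \<open>mcomponents\<close> into a statement about \<open>reach_class\<close>.\<close>

lemma induced_component:
  assumes G: "multigraph G" and v: "v \<in> mverts G"
  defines "C \<equiv> reach_class G (medges G) v"
  shows "msubgraph (induced G C) G" "connected_mgraph (induced G C)"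
    "\<And>K. msubgraph K G \<Longrightarrow> connected_mgraph K \<Longrightarrow> v \<in> mverts K \<Longrightarrow> msubgraph K (induced G C)"
proof -
  have fE: "finite (medges G)" using multigraphD(2)[OF G] .
  have CV: "C \<subseteq> mverts G" unfolding C_def reach_class_def by blast
  have m: "multigraph (induced G C)" unfolding induced_def multigraph_def
    using multigraphD[OF G] CV by (auto intro: finite_subset)
  show sub: "msubgraph (induced G C) G" unfolding msubgraph_def
    using m CV by (auto simp: induced_def)
  let ?F = "medges (induced G C)"
  have FE: "?F \<subseteq> medges G" unfolding induced_def by auto
  have ends: "e \<in> ?F \<Longrightarrow> mends (induced G C) e = mends G e" for e by (auto simp: induced_def)
  have reachF: "reach (induced G C) ?F a b \<longleftrightarrow> reach G ?F a b" for a b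
    by (rule reach_cong) (rule ends)
  have "reach G ?F a b" if ab: "a \<in> C" "b \<in> C" for a b
  proof -
    have av: "reach G (medges G) a b"
      using ab reach_trans[OF fE, of G a v b] reach_sym[of G "medges G" v a]
      unfolding C_def reach_class_def by blast
    have "b \<in> {x \<in> C. reach G ?F a x}"
    proof (rule reach_closed[OF G order.refl av])
      show "a \<in> {x \<in> C. reach G ?F a x}" using ab by simp
      fix e assume e: "e \<in> medges G" "mends G e \<inter> {x \<in> C. reach G ?F a x} \<noteq> {}"
      then obtain x where x: "x \<in> mends G e" "x \<in> C" "reach G ?F a x" by blast
      have y: "y \<in> C" if "y \<in> mends G e" for y
        using x(2) reach_trans[OF fE, of G v x y] reach_edge'[OF G order.refl e(1) x(1) that]
          multigraphD(3)[OF G e(1)] that unfolding C_def reach_class_def by blast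
      then have eF: "e \<in> ?F" using e(1) unfolding induced_def by auto
      have "reach G ?F a y" if "y \<in> mends G e" for y
        using reach_trans[OF finite_subset[OF FE fE] x(3) reach_edge'[OF G FE eF x(1) that]] .
      then show "mends G e \<subseteq> {x \<in> C. reach G ?F a x}" using y by blast
    qed
    then show ?thesis by simp
  qed
  moreover have "C \<noteq> {}" using reach_class_self[OF v] unfolding C_def by blast
  moreover have "mverts (induced G C) = C" unfolding induced_def by simp
  ultimately show "connected_mgraph (induced G C)"
    unfolding connected_mgraph_reach[OF m] reachF by metis
  fix K assume K: "msubgraph K G" "connected_mgraph K" "v \<in> mverts K"
  note mK = msubgraphD[OF K(1)]
  have "w \<in> C" if w: "w \<in> mverts K" for w
  proof -
    have "reach K (medges K) v w" using K(2,3) w connected_mgraph_reach[OF mK(1)] by blast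
    then have "reach G (medges K) v w" using reach_cong[of "medges K" K G] mK(4) by blast
    then have "reach G (medges G) v w" using mK(3) by (rule reach_mono)
    then show ?thesis unfolding C_def reach_class_def using w mK(2) by blast
  qed
  then have VK: "mverts K \<subseteq> C" by blast
  show "msubgraph K (induced G C)" unfolding msubgraph_def
  proof (intro conjI ballI)
    show "multigraph K" by fact
    show "mverts K \<subseteq> mverts (induced G C)" using VK unfolding induced_def by simp
    have "e \<in> ?F" if "e \<in> medges K" for e
      using that mK(3) mK(4)[OF that] multigraphD(3)[OF mK(1) that] VK unfolding induced_def by auto
    then show "medges K \<subseteq> ?F" by blast
    then show "mends K e = mends (induced G C) e" if "e \<in> medges K" for e
      using that mK(4)[OF that] ends by auto
  qed
qed

lemma msubgraph_antisym:
  assumes "msubgraph H K" "msubgraph K H" shows "H = K"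
  by (rule mgraph_eqI) (use msubgraphD[OF assms(1)] msubgraphD[OF assms(2)] in auto)

lemma mcomponents_eq:
  assumes G: "multigraph G"
  shows "mcomponents G = induced G ` reach_class G (medges G) ` mverts G"
proof (intro equalityI subsetI)
  fix H assume H: "H \<in> mcomponents G"
  then have 1: "msubgraph H G" "connected_mgraph H" unfolding mcomponents_def by auto
  then obtain v where v: "v \<in> mverts H" unfolding connected_mgraph_def by blast
  then have vG: "v \<in> mverts G" using msubgraphD(2)[OF 1(1)] by blast
  note ic = induced_component[OF G vG]
  have "induced G (reach_class G (medges G) v) = H"
    using H ic(1,2) ic(3)[OF 1 v] unfolding mcomponents_def by auto
  then show "H \<in> induced G ` reach_class G (medges G) ` mverts G" using vG by blast
next
  fix H assume "H \<in> induced G ` reach_class G (medges G) ` mverts G"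
  then obtain v where v: "v \<in> mverts G" "H = induced G (reach_class G (medges G) v)" by blast
  note ic = induced_component[OF G v(1)]
  have "v \<in> mverts H" using reach_class_self[OF v(1)] unfolding v(2) induced_def by simp
  then have "K = H" if "msubgraph K G" "connected_mgraph K" "msubgraph H K" for K
    using msubgraph_antisym[of K H] ic(3)[OF that(1,2)] that msubgraphD(2)[OF that(3)] v(2) by blast
  then show "H \<in> mcomponents G" unfolding mcomponents_def using ic(1,2) v(2) by blast
qed

lemma mverts_mcomponents:
  assumes "multigraph G"
  shows "mverts ` mcomponents G = reach_class G (medges G) ` mverts G"
  unfolding mcomponents_eq[OF assms] image_image induced_def by simp

lemma card_mcomponents:
  assumes "multigraph G"
  shows "card (mcomponents G) = card (reach_class G (medges G) ` mverts G)"
proof -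
  have "inj_on (induced G) (reach_class G (medges G) ` mverts G)"
    by (rule inj_onI) (metis induced_def make_mgraph_sel(1))
  then show ?thesis unfolding mcomponents_eq[OF assms] by (rule card_image)
qed

lemma spanning_restrict_sel [simp]:
  "mverts (spanning_restrict G X) = mverts G" "medges (spanning_restrict G X) = X"
  "mends (spanning_restrict G X) e = (if e \<in> X then mends G e else {})"
  unfolding spanning_restrict_def by auto

lemma multigraph_spanning_restrict:
  assumes "multigraph G" "X \<subseteq> medges G" shows "multigraph (spanning_restrict G X)"
  unfolding multigraph_def using assms multigraphD[OF assms(1)] by (auto intro: finite_subset)

lemma reach_class_spanning_restrict:
  "reach_class (spanning_restrict G X) X v = reach_class G X v"
  unfolding reach_class_def using reach_cong[of X "spanning_restrict G X" G] by auto

lemma mcontract_sel: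
  assumes "multigraph G" "X \<subseteq> medges G"
  shows "mverts (mcontract G X) = reach_class G X ` mverts G"
    "medges (mcontract G X) = medges G - X"
    "e \<in> medges G - X \<Longrightarrow> mends (mcontract G X) e = reach_class G X ` mends G e"
proof -
  have V: "mverts ` mcomponents (spanning_restrict G X) = reach_class G X ` mverts G"
    using mverts_mcomponents[OF multigraph_spanning_restrict[OF assms]]
    by (simp add: reach_class_spanning_restrict)
  show "mverts (mcontract G X) = reach_class G X ` mverts G"
    "medges (mcontract G X) = medges G - X"
    unfolding mcontract_def Let_def V by auto
  assume e: "e \<in> medges G - X"
  have "mends (mcontract G X) e = {U \<in> reach_class G X ` mverts G. U \<inter> mends G e \<noteq> {}}"
    using e unfolding mcontract_def Let_def V by auto
  also have "\<dots> = reach_class G X ` mends G e"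
  proof (intro equalityI subsetI)
    fix U assume "U \<in> {U \<in> reach_class G X ` mverts G. U \<inter> mends G e \<noteq> {}}"
    then obtain v x where v: "v \<in> mverts G" "U = reach_class G X v" "x \<in> U" "x \<in> mends G e" by blast
    then have "U = reach_class G X x" using reach_class_eq[OF assms, of v x] unfolding reach_class_def by blast
    then show "U \<in> reach_class G X ` mends G e" using v by blast
  next
    fix U assume "U \<in> reach_class G X ` mends G e"
    then obtain x where x: "x \<in> mends G e" "U = reach_class G X x" by blast
    then have "x \<in> mverts G" using e multigraphD(3)[OF assms(1), of e] by blast
    then show "U \<in> {U \<in> reach_class G X ` mverts G. U \<inter> mends G e \<noteq> {}}"
      using x reach_class_self[of x G X] by blast
  qed
  finally show "mends (mcontract G X) e = reach_class G X ` mends G e" .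
qed

lemma multigraph_mcontract:
  assumes "multigraph G" "X \<subseteq> medges G"
  shows "multigraph (mcontract G X)"
proof -
  note sel = mcontract_sel[OF assms]
  have "mends (mcontract G X) e = {}" if "e \<notin> medges G - X" for e
    using that unfolding mcontract_def Let_def by auto
  moreover have "card (reach_class G X ` mends G e) \<in> {1, 2}" if "e \<in> medges G - X" for e
  proof -
    have "e \<in> medges G" using that by blast
    then obtain a b where "mends G e = {a, b}" using ends_pair[OF assms(1) order.refl] by blast
    then show ?thesis by (auto simp: card_insert_if)
  qed
  ultimately show ?thesis unfolding multigraph_def sel(1,2)
    using multigraphD[OF assms(1)] sel(3) by (auto simp: image_mono)
qed

text \<open>A vertex of the contraction is a set of vertices of \<open>G\<close>, and no contracted
  edge leaves a union of such sets. So a cut of the contraction is a cut of \<open>G\<close> with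
  the same edges.\<close>

lemma cut_mcontract:
  assumes G: "multigraph G" "X \<subseteq> medges G" and U: "\<U> \<subseteq> reach_class G X ` mverts G"
  shows "cut (mcontract G X) \<U> = cut G (\<Union>\<U>)"
proof -
  note sel = mcontract_sel[OF G]
  have in_iff: "reach_class G X x \<in> \<U> \<longleftrightarrow> x \<in> \<Union>\<U>" if x: "x \<in> mverts G" for x
  proof
    assume "x \<in> \<Union>\<U>"
    then obtain v where v: "v \<in> mverts G" "reach_class G X v \<in> \<U>" "x \<in> reach_class G X v" using U by blast
    then show "reach_class G X x \<in> \<U>" using reach_class_eq[OF G v(1) x] unfolding reach_class_def by auto
  qed (use reach_class_self[OF x] in blast)
  have "e \<in> cut (mcontract G X) \<U> \<longleftrightarrow> e \<in> cut G (\<Union>\<U>)" for e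
  proof (cases "e \<in> medges G")
    case e: True
    have V: "mends G e \<subseteq> mverts G" using multigraphD(3)[OF G(1) e] .
    show ?thesis
    proof (cases "e \<in> X")
      case True
      have "mends G e \<subseteq> \<Union>\<U>" if "x \<in> mends G e" "x \<in> \<Union>\<U>" for x
      proof
        fix y assume y: "y \<in> mends G e"
        have "reach G X x y" using reach_edge'[OF G True that(1) y] .
        then have "reach_class G X x = reach_class G X y" using reach_class_eq[OF G] V that y by blast
        then show "y \<in> \<Union>\<U>" using in_iff[of x] in_iff[of y] that(2) V that(1) y by auto
      qed
      then show ?thesis using True unfolding cut_def sel(2) by blast
    next
      case False
      have 1: "mends (mcontract G X) e = reach_class G X ` mends G e" using sel(3) e False by blast
      have "mends (mcontract G X) e \<inter> \<U> \<noteq> {} \<longleftrightarrow> mends G e \<inter> \<Union>\<U> \<noteq> {}"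
        "mends (mcontract G X) e \<subseteq> \<U> \<longleftrightarrow> mends G e \<subseteq> \<Union>\<U>"
        unfolding 1 using in_iff V by blast+
      then show ?thesis unfolding cut_def sel(2) using e False by auto
    qed
  qed (auto simp: cut_def sel(2))
  then show ?thesis by blast
qed

lemma evens_by_stars:
  assumes G: "multigraph G" and Y: "Y \<subseteq> medges G"
    and ev: "\<And>v. v \<in> mverts G \<Longrightarrow> even (card (Y \<inter> cut G {v}))"
  shows "Y \<in> evens G"
proof -
  have "v \<notin> bd G Y" if "v \<in> mverts G" for v
    using handshake[OF G Y, of "{v}"] ev[OF that] by (cases "v \<in> bd G Y") auto
  then show ?thesis using bd_subset_verts[OF G, of Y] Y unfolding evens_def by blast
qed

text \<open>Existence of T-joins: a nonempty \<open>W\<close> has two vertices in a common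
  component; they are joined by an edge set and removed from \<open>W\<close>.\<close>

lemma boundary_exists:
  assumes G: "multigraph G" "X \<subseteq> medges G" and W: "W \<subseteq> mverts G"
    and ev: "\<And>v. v \<in> mverts G \<Longrightarrow> even (card (W \<inter> reach_class G X v))"
  shows "\<exists>Q\<subseteq>X. bd G Q = W"
proof -
  have "finite W" using W multigraphD(1)[OF G(1)] finite_subset by blast
  then show ?thesis using W ev
  proof (induction W rule: finite_psubset_induct)
    case (psubset W)
    show ?case
    proof (cases "W = {}")
      case False
      then obtain a where a: "a \<in> W" by blast
      then have aV: "a \<in> mverts G" using psubset.prems(1) by blast
      then have "a \<in> W \<inter> reach_class G X a" using a reach_class_self by fast
      moreover have "W \<inter> reach_class G X a \<noteq> {a}" using psubset.prems(2)[OF aV] by auto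
      ultimately obtain b where b: "b \<in> W" "b \<noteq> a" "b \<in> reach_class G X a" by blast
      then have r: "reach G X a b" "b \<in> mverts G" unfolding reach_class_def by auto
      then obtain P where P: "P \<subseteq> X" "bd G P = {a} \<oplus> {b}" unfolding reach_def by blast
      have same: "a \<in> reach_class G X v \<longleftrightarrow> b \<in> reach_class G X v" if "v \<in> mverts G" for v
        using reach_class_eq[OF G that aV] reach_class_eq[OF G that r(2)] reach_class_eq[OF G aV r(2)] r aV
        unfolding reach_class_def by auto
      have ev': "even (card ((W - {a, b}) \<inter> reach_class G X v))" if v: "v \<in> mverts G" for v
      proof (cases "a \<in> reach_class G X v")
        case True
        have "W \<inter> reach_class G X v = insert a (insert b ((W - {a, b}) \<inter> reach_class G X v))"
          using True same[OF v] a b(1) by blast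
        moreover have "finite ((W - {a, b}) \<inter> reach_class G X v)" using psubset.hyps by blast
        ultimately show ?thesis using psubset.prems(2)[OF v] b(2) by simp
      next
        case False
        then have "(W - {a, b}) \<inter> reach_class G X v = W \<inter> reach_class G X v" using same[OF v] by blast
        then show ?thesis using psubset.prems(2)[OF v] by simp
      qed
      have W': "W - {a, b} \<subset> W" "W - {a, b} \<subseteq> mverts G" using a psubset.prems(1) by blast+
      obtain Q where Q: "Q \<subseteq> X" "bd G Q = W - {a, b}" using psubset.IH[OF W' ev'] by blast
      have fX: "finite X" using G multigraphD(2) finite_subset by blast
      have "bd G (Q \<oplus> P) = (W - {a, b}) \<oplus> ({a} \<oplus> {b})"
        using bd_symd[of Q P G] Q P finite_subset[OF _ fX] by simp
      also have "\<dots> = (W - {a, b}) \<oplus> {a, b}" using symd_singles[of a b] b(2) by simp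
      also have "\<dots> = W" using a b(1) by auto
      finally show ?thesis using symd_subset[OF Q(1) P(1)] by blast
    qed (auto intro!: exI[of _ "{}"])
  qed
qed

text \<open>Contraction projects the cycle space. An even set \<open>Y\<close> of the contraction is
  completed inside \<open>X\<close> by a T-join for its boundary, which exists because
  \<open>Y\<close> has even degree at every vertex of the contraction.\<close>

lemma evens_mcontract:
  assumes G: "multigraph G" "X \<subseteq> medges G"
  shows "evens (mcontract G X) = (\<lambda>A. A - X) ` evens G"
proof (intro equalityI subsetI)
  note sel = mcontract_sel[OF G] and mK = multigraph_mcontract[OF G]
  fix Y assume Y: "Y \<in> evens (mcontract G X)"
  have YE: "Y \<subseteq> medges G - X" using evensD(1)[OF Y] sel(2) by simp
  have ev: "even (card (bd G Y \<inter> reach_class G X v))" if v: "v \<in> mverts G" for v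
  proof -
    have "cut (mcontract G X) {reach_class G X v} = cut G (reach_class G X v)"
      using cut_mcontract[OF G, of "{reach_class G X v}"] v by simp
    then have "even (card (Y \<inter> cut G (reach_class G X v)))"
      using orthogonal_cut[OF mK, of "{reach_class G X v}"] Y unfolding orthogonal_def by auto
    then show ?thesis using handshake[OF G(1), of Y] YE by blast
  qed
  obtain Q where Q: "Q \<subseteq> X" "bd G Q = bd G Y"
    using boundary_exists[OF G bd_subset_verts[OF G(1)] ev] by blast
  have fE: "finite (medges G)" using multigraphD(2)[OF G(1)] .
  have "bd G (Y \<union> Q) = {}"
    using bd_Un[of Y Q G] Q YE G(2) finite_subset[OF _ fE] by (metis Diff_disjoint Diff_subset
        disjoint_iff order_trans subsetD symd_empty(3) DiffD2)
  then have "Y \<union> Q \<in> evens G" using YE Q G(2) unfolding evens_def by blast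
  moreover have "(Y \<union> Q) - X = Y" using YE Q by blast
  ultimately show "Y \<in> (\<lambda>A. A - X) ` evens G" by blast
next
  note sel = mcontract_sel[OF G] and mK = multigraph_mcontract[OF G]
  fix Y assume "Y \<in> (\<lambda>A. A - X) ` evens G"
  then obtain A where A: "A \<in> evens G" "Y = A - X" by blast
  have YE: "Y \<subseteq> medges (mcontract G X)" using A evensD(1)[OF A(1)] unfolding sel(2) by blast
  show "Y \<in> evens (mcontract G X)"
  proof (rule evens_by_stars[OF mK YE])
    fix U assume "U \<in> mverts (mcontract G X)"
    then have "{U} \<subseteq> reach_class G X ` mverts G" using sel(1) by simp
    then have c: "cut (mcontract G X) {U} = cut G U" using cut_mcontract[OF G, of "{U}"] by simp
    have "cut (mcontract G X) {U} \<subseteq> medges G - X" using sel(2) unfolding cut_def by auto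
    then have "Y \<inter> cut (mcontract G X) {U} = A \<inter> cut G U" using A(2) c by blast
    then show "even (card (Y \<inter> cut (mcontract G X) {U}))"
      using orthogonal_cut[OF G(1), of U] A(1) unfolding orthogonal_def by auto
  qed
qed

text \<open>Connectedness in terms of cuts. In this form it passes to contractions by
  \<open>cut_mcontract\<close>, without projecting connections.\<close>

definition no_empty_cut :: "('v, 'e) mgraph \<Rightarrow> bool" where
  "no_empty_cut G \<longleftrightarrow> (\<forall>U. U \<subseteq> mverts G \<and> U \<noteq> {} \<and> U \<noteq> mverts G \<longrightarrow> cut G U \<noteq> {})"

lemma connected_no_empty_cut:
  assumes "multigraph G" "connected_mgraph G"
  shows "no_empty_cut G"
  unfolding no_empty_cut_def
proof (intro allI impI notI)
  fix U assume U: "U \<subseteq> mverts G \<and> U \<noteq> {} \<and> U \<noteq> mverts G" and c: "cut G U = {}"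
  then obtain a b where ab: "a \<in> U" "b \<in> mverts G" "b \<notin> U" by blast
  then have r: "reach G (medges G) a b" using assms connected_mgraph_reach U by blast
  have "b \<in> U" by (rule reach_closed[OF assms(1) order.refl r ab(1)]) (use c in \<open>auto simp: cut_def\<close>)
  then show False using ab by blast
qed

lemma mcontract_no_empty_cut:
  assumes G: "multigraph G" "X \<subseteq> medges G" and c: "no_empty_cut G"
  shows "no_empty_cut (mcontract G X)"
  unfolding no_empty_cut_def
proof (intro allI impI)
  note sel = mcontract_sel[OF G]
  fix \<U> assume U: "\<U> \<subseteq> mverts (mcontract G X) \<and> \<U> \<noteq> {} \<and> \<U> \<noteq> mverts (mcontract G X)"
  have 1: "\<U> \<subseteq> reach_class G X ` mverts G" using U sel(1) by simp
  have "\<Union>\<U> \<subseteq> mverts G" using 1 unfolding reach_class_def by auto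
  moreover have "\<Union>\<U> \<noteq> {}"
  proof -
    obtain v where "v \<in> mverts G" "reach_class G X v \<in> \<U>" using U 1 by blast
    then show ?thesis using reach_class_self[of v G X] by blast
  qed
  moreover have "\<Union>\<U> \<noteq> mverts G"
  proof
    assume a: "\<Union>\<U> = mverts G"
    obtain C where C: "C \<in> mverts (mcontract G X)" "C \<notin> \<U>" using U by blast
    then obtain v where v: "v \<in> mverts G" "reach_class G X v \<notin> \<U>" unfolding sel(1) by blast
    then obtain w where w: "w \<in> mverts G" "reach_class G X w \<in> \<U>" "v \<in> reach_class G X w" using a 1 by blast
    then show False using reach_class_eq[OF G w(1) v(1)] v(2) unfolding reach_class_def by auto
  qed
  ultimately have "cut G (\<Union>\<U>) \<noteq> {}" using c unfolding no_empty_cut_def by blast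
  then show "cut (mcontract G X) \<U> \<noteq> {}" using cut_mcontract[OF G 1] by simp
qed

section \<open>Cut-edges and series classes\<close>

text \<open>An even set through \<open>e\<close> can be added to any connection using
  \<open>e\<close> in order to bypass it, so deleting \<open>e\<close> does not change the
  components. If there is no such even set, the deletion separates the ends of \<open>e\<close>,
  while the connected graph \<open>G\<close> has only one component.\<close>

lemma cut_edges_iff:
  assumes G: "multigraph G" and conn: "connected_mgraph G" and e: "e \<in> medges G"
  shows "e \<in> cut_edges G \<longleftrightarrow> (\<forall>X\<in>evens G. e \<notin> X)"
proof -
  let ?E = "medges G"
  have fE: "finite ?E" using multigraphD(2)[OF G] .
  have c1: "card (mcomponents (spanning_restrict G (?E - {e}))) = card (reach_class G (?E - {e}) ` mverts G)"
    using card_mcomponents[OF multigraph_spanning_restrict[OF G, of "?E - {e}"]]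
    by (simp add: reach_class_spanning_restrict Diff_subset)
  note c2 = card_mcomponents[OF G]
  show ?thesis
  proof
    assume c: "e \<in> cut_edges G"
    show "\<forall>X\<in>evens G. e \<notin> X"
    proof (intro ballI notI)
      fix X assume X: "X \<in> evens G" "e \<in> X"
      have "reach G (?E - {e}) a b \<longleftrightarrow> reach G ?E a b" for a b
      proof
        assume "reach G ?E a b"
        then obtain Q where Q: "Q \<subseteq> ?E" "bd G Q = {a} \<oplus> {b}" unfolding reach_def by blast
        show "reach G (?E - {e}) a b"
        proof (cases "e \<in> Q")
          case True
          have "bd G (Q \<oplus> X) = {a} \<oplus> {b}"
            using bd_symd[of Q X G] Q evensD[OF X(1)] finite_subset[OF _ fE] by simp
          moreover have "Q \<oplus> X \<subseteq> ?E - {e}" using Q(1) evensD(1)[OF X(1)] True X(2) by auto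
          ultimately show ?thesis unfolding reach_def by blast
        next
          case False
          then show ?thesis using Q unfolding reach_def by blast
        qed
      qed (erule reach_mono, blast)
      then have "reach_class G (?E - {e}) = reach_class G ?E" unfolding reach_class_def by auto
      then show False using c c1 c2 unfolding cut_edges_def by simp
    qed
  next
    assume n: "\<forall>X\<in>evens G. e \<notin> X"
    obtain a b where ab: "mends G e = {a, b}" "card (mends G e) = 2 \<longleftrightarrow> a \<noteq> b"
      using ends_pair[OF G order.refl e] by blast
    have abV: "a \<in> mverts G" "b \<in> mverts G" using multigraphD(3)[OF G e] ab(1) by auto
    have "\<not> reach G (?E - {e}) a b"
    proof
      assume "reach G (?E - {e}) a b"
      then obtain Q where Q: "Q \<subseteq> ?E - {e}" "bd G Q = {a} \<oplus> {b}" unfolding reach_def by blast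
      have "bd G {e} = {a} \<oplus> {b}" using bd_single_pair[OF ab(1)] .
      then have "bd G (insert e Q) = {}"
        using bd_insert[of Q e G] Q finite_subset[OF Q(1)] fE by auto
      then have "insert e Q \<in> evens G" using Q(1) e unfolding evens_def by auto
      then show False using n by blast
    qed
    then have ne: "reach_class G (?E - {e}) a \<noteq> reach_class G (?E - {e}) b"
      using reach_class_eq[OF G Diff_subset abV] by blast
    have "card {reach_class G (?E - {e}) a, reach_class G (?E - {e}) b} \<le> card (reach_class G (?E - {e}) ` mverts G)"
      by (rule card_mono) (use abV multigraphD(1)[OF G] in auto)
    then have "2 \<le> card (mcomponents (spanning_restrict G (?E - {e})))" using ne unfolding c1 by simp
    moreover have "reach_class G ?E v = mverts G" if "v \<in> mverts G" for v
      using conn that connected_mgraph_reach[OF G] unfolding reach_class_def by blast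
    then have "reach_class G ?E ` mverts G \<subseteq> {mverts G}" by auto
    then have "card (mcomponents G) \<le> 1" unfolding c2 using card_mono[of "{mverts G}"] by fastforce
    ultimately show "e \<in> cut_edges G" using e unfolding cut_edges_def by simp
  qed
qed

text \<open>A reflexive version of series pairs: \<open>series_pair G e e\<close> fails when
  \<open>e\<close> lies on a cycle, whereas this is an equivalence relation for every
  \<open>Z\<close>.\<close>

definition cyclically_equivalent :: "'e set set \<Rightarrow> 'e \<Rightarrow> 'e \<Rightarrow> bool" where
  "cyclically_equivalent Z e f \<longleftrightarrow> (\<forall>X\<in>Z. e \<in> X \<longleftrightarrow> f \<in> X)"

text \<open>Agreement on cycles extends to even sets by removing cycles one at a time.\<close>

lemma series_pair_iff:
  assumes G: "multigraph G" and ef: "e \<noteq> f"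
  shows "series_pair G e f \<longleftrightarrow> cyclically_equivalent (evens G) e f"
proof -
  have 1: "card (C \<inter> {e, f}) = 1 \<longleftrightarrow> (e \<in> C) \<noteq> (f \<in> C)" for C
    using ef by (cases "e \<in> C"; cases "f \<in> C") (auto simp: Int_insert_right)
  show ?thesis
  proof
    assume s: "series_pair G e f"
    have "e \<in> X \<longleftrightarrow> f \<in> X" if "X \<in> evens G" for X
      using evens_finite[OF G that] that
    proof (induction X rule: finite_psubset_induct)
      case (psubset X)
      show ?case
      proof (cases "X = {}")
        case False
        then obtain C where C: "is_mcycle G C" "C \<subseteq> X" using even_contains_mcycle[OF G psubset.prems] by blast
        have "X - C \<in> evens G" using evens_Diff[OF G psubset.prems mcycle_even(1)[OF G C(1)] C(2)] .
        moreover have "X - C \<subset> X" using C(2) mcycle_even(2)[OF G C(1)] by blast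
        ultimately have "e \<in> X - C \<longleftrightarrow> f \<in> X - C" using psubset.IH by blast
        moreover have "e \<in> C \<longleftrightarrow> f \<in> C" using s C(1) 1 unfolding series_pair_def by blast
        ultimately show ?thesis using C(2) by blast
      qed simp
    qed
    then show "cyclically_equivalent (evens G) e f" unfolding cyclically_equivalent_def by blast
  next
    assume "cyclically_equivalent (evens G) e f"
    then show "series_pair G e f" unfolding series_pair_def cyclically_equivalent_def 1
      using mcycle_even(1)[OF G] by blast
  qed
qed

lemma series_classes_eq:
  assumes G: "multigraph G"
  shows "series_classes G = (\<lambda>e. {f \<in> medges G. cyclically_equivalent (evens G) e f}) ` medges G"
proof (intro equalityI subsetI)
  let ?cl = "\<lambda>e. {f \<in> medges G. cyclically_equivalent (evens G) e f}"
  have pw: "pairwise (series_pair G) (?cl e)" for e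
    unfolding pairwise_def using series_pair_iff[OF G] by (auto simp: cyclically_equivalent_def)
  fix S
  {
    assume S: "S \<in> series_classes G"
    then obtain e where e: "e \<in> S" "e \<in> medges G" unfolding series_classes_def by blast
    have "S \<subseteq> ?cl e"
    proof
      fix f assume f: "f \<in> S"
      then have "f \<in> medges G" using S unfolding series_classes_def by blast
      moreover have "cyclically_equivalent (evens G) e f"
      proof (cases "e = f")
        case False
        then have "series_pair G e f" using S e(1) f unfolding series_classes_def pairwise_def by blast
        then show ?thesis using series_pair_iff[OF G False] by blast
      qed (simp add: cyclically_equivalent_def)
      ultimately show "f \<in> ?cl e" by blast
    qed
    then have "?cl e = S" using S pw[of e] unfolding series_classes_def by blast
    then show "S \<in> ?cl ` medges G" using e(2) by blast
  next
    assume "S \<in> ?cl ` medges G"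
    then obtain e where e: "e \<in> medges G" "S = ?cl e" by blast
    have eS: "e \<in> S" using e by (simp add: cyclically_equivalent_def)
    have "Y = S" if Y: "S \<subseteq> Y" "Y \<subseteq> medges G" "pairwise (series_pair G) Y" for Y
    proof -
      have "f \<in> S" if f: "f \<in> Y" for f
      proof (cases "e = f")
        case False
        have "series_pair G e f" using Y(1,3) eS f False unfolding pairwise_def by blast
        then show ?thesis using series_pair_iff[OF G False] f Y(2) e(2) by blast
      qed (use eS in simp)
      then show ?thesis using Y(1) by blast
    qed
    then show "S \<in> series_classes G" unfolding series_classes_def using eS pw[of e] e(2) by blast
  }
qed

section \<open>Counting stars with independent complement\<close>

section \<open>Graphs whose vertices have degree at least three\<close>

text \<open>If \<open>A\<close> contained at most one nonempty even set, one edge could be removed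
  to leave \<open>A'\<close> with none, so that distinct subsets of \<open>A'\<close> have distinct
  boundaries. These avoid \<open>u\<close>, and their even size determines whether \<open>w\<close>
  belongs to them. Hence \<open>A'\<close> has at most \<open>card (mverts H) - 2\<close> edges, and
  \<open>A\<close> has fewer edges than \<open>H\<close> has vertices.\<close>

lemma two_of_many_edges:
  assumes H: "multigraph H" and A: "A \<subseteq> medges H" and uw: "u \<in> mverts H" "w \<in> mverts H" "u \<noteq> w"
    and u: "A \<inter> cut H {u} = {}" and card: "card (mverts H) \<le> card A"
  shows "two (evens H) A"
proof (rule ccontr)
  assume nt: "\<not> two (evens H) A"
  have fA: "finite A" using A multigraphD(2)[OF H] finite_subset by blast
  obtain A' where A': "A' \<subseteq> A" "card A \<le> card A' + 1" "\<And>Y. Y \<in> evens H \<Longrightarrow> Y \<subseteq> A' \<Longrightarrow> Y = {}"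
  proof (cases "\<exists>X\<in>evens H. X \<subseteq> A \<and> X \<noteq> {}")
    case True
    then obtain X e where X: "X \<in> evens H" "X \<subseteq> A" "e \<in> X" by blast
    show ?thesis
    proof (rule that[of "A - {e}"])
      show "card A \<le> card (A - {e}) + 1" using card_Suc_Diff1[OF fA, of e] X by auto
      fix Y assume Y: "Y \<in> evens H" "Y \<subseteq> A - {e}"
      show "Y = {}"
      proof (rule ccontr)
        assume "Y \<noteq> {}"
        moreover have "Y \<noteq> X" "X \<noteq> {}" "Y \<subseteq> A" using X Y by blast+
        ultimately show False using nt X Y(1) unfolding two_def by metis
      qed
    qed blast
  next
    case False
    then show ?thesis using that[of A] by auto
  qed
  define \<phi> where "\<phi> P = bd H P - {w}" for P
  have A'E: "A' \<subseteq> medges H" using A A'(1) by blast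
  have fA': "finite A'" using A'(1) fA finite_subset by blast
  have "inj_on \<phi> (Pow A')"
  proof (rule inj_onI)
    fix P Q assume PQ: "P \<in> Pow A'" "Q \<in> Pow A'" "\<phi> P = \<phi> Q"
    have fin: "finite P" "finite Q" using PQ fA' finite_subset by auto
    have sub: "P \<oplus> Q \<subseteq> A'" using PQ symd_subset by auto
    have eq: "x \<in> bd H P - {w} \<longleftrightarrow> x \<in> bd H Q - {w}" for x using PQ(3) unfolding \<phi>_def by simp
    have "x = w" if "x \<in> bd H P \<oplus> bd H Q" for x using that eq[of x] unfolding symd_iff Diff_iff by blast
    then have "bd H (P \<oplus> Q) \<subseteq> {w}" unfolding bd_symd[OF fin] by blast
    moreover have "even (card (bd H (P \<oplus> Q)))" using even_card_bd[OF H] sub A'E by blast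
    ultimately have "bd H (P \<oplus> Q) = {}" by (metis card_1_singleton_iff odd_one One_nat_def subset_singletonD)
    then have "P \<oplus> Q \<in> evens H" using sub A'E unfolding evens_def by blast
    then show "P = Q" using A'(3)[OF _ sub] by simp
  qed
  moreover have "\<phi> ` Pow A' \<subseteq> Pow (mverts H - {u, w})"
  proof -
    have "u \<notin> bd H P" if "P \<subseteq> A'" for P
    proof -
      have "P \<inter> cut H {u} = {}" using that u A'(1) by blast
      then show ?thesis using handshake[OF H, of P "{u}"] that A'E by (cases "u \<in> bd H P") auto
    qed
    then show ?thesis using bd_subset_verts[OF H] unfolding \<phi>_def by blast
  qed
  moreover have fV: "finite (mverts H)" using multigraphD(1)[OF H] .
  ultimately have "card (Pow A') \<le> card (Pow (mverts H - {u, w}))"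
    by (intro card_inj_on_le) auto
  then have "card A' \<le> card (mverts H - {u, w})"
    using fA' fV by (simp add: card_Pow)
  also have "\<dots> = card (mverts H) - 2" using fV uw by (simp add: card_Diff_subset)
  moreover have "2 \<le> card (mverts H)" using card_mono[OF fV, of "{u, w}"] uw by simp
  ultimately show False using A'(2) card by linarith
qed

text \<open>By double counting, two exceptional vertices would force \<open>card (mverts H) \<le> 4\<close>.\<close>

lemma one_exceptional_vertex:
  assumes H: "multigraph H" and n: "5 \<le> card (mverts H)"
    and deg: "\<And>v. v \<in> mverts H \<Longrightarrow> 3 \<le> card (cut H {v})"
  shows "\<exists>z. \<forall>v\<in>mverts H - {z}. two (evens H) (medges H - cut H {v})"
proof -
  let ?V = "mverts H" and ?E = "medges H"
  have fV: "finite ?V" and fE: "finite ?E" using multigraphD(1,2)[OF H] by auto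
  have cutE: "cut H {v} \<subseteq> ?E" for v unfolding cut_def by blast
  have good: "two (evens H) (?E - cut H {v})" if v: "v \<in> ?V" "card ?V + card (cut H {v}) \<le> card ?E" for v
  proof -
    have "?V \<noteq> {v}" using n by auto
    then obtain w where w: "w \<in> ?V" "v \<noteq> w" using v(1) by blast
    have "card (?E - cut H {v}) = card ?E - card (cut H {v})"
      using card_Diff_subset[OF finite_subset[OF cutE fE] cutE] .
    then show ?thesis using v by (intro two_of_many_edges[OF H _ v(1) w]) auto
  qed
  have sum: "(\<Sum>v\<in>?V. card (cut H {v})) \<le> 2 * card ?E"
  proof -
    let ?R = "\<lambda>v e. mends H e \<inter> {v} \<noteq> {} \<and> \<not> mends H e \<subseteq> {v}"
    have "(\<Sum>v\<in>?V. card {e \<in> ?E. ?R v e}) = (\<Sum>e\<in>?E. card {v \<in> ?V. ?R v e})"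
      using fV fE by (intro sum_multicount_gen) auto
    also have "\<dots> \<le> (\<Sum>e\<in>?E. 2)"
    proof (rule sum_mono)
      fix e assume e: "e \<in> ?E"
      have "card {v \<in> ?V. ?R v e} \<le> card (mends H e)"
        by (rule card_mono) (use multigraphD(3)[OF H e] fV finite_subset in auto)
      also have "\<dots> \<le> 2" using multigraphD(4)[OF H e] by auto
      finally show "card {v \<in> ?V. ?R v e} \<le> 2" .
    qed
    finally show ?thesis unfolding cut_def by simp
  qed
  \<comment> \<open>Two exceptional vertices have stars of more than
    \<open>card ?E - card ?V\<close> edges, the other vertices stars of at least 3. With
    \<open>n\<close> vertices the sum is at least \<open>2 * card ?E + n - 4\<close>, which
    contradicts \<open>sum\<close> once \<open>n\<close> is at least 5.\<close>
  have False if uv: "u \<in> ?V" "v \<in> ?V" "u \<noteq> v" "card ?E < card ?V + card (cut H {u})"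
    "card ?E < card ?V + card (cut H {v})" for u v
  proof -
    have "(\<Sum>x\<in>?V. card (cut H {x})) = card (cut H {u}) + (card (cut H {v}) + (\<Sum>x\<in>?V - {u} - {v}. card (cut H {x})))"
      using fV uv(1-3) by (simp add: sum.remove[of "?V" u] sum.remove[of "?V - {u}" v])
    moreover have "(\<Sum>x\<in>?V - {u} - {v}. 3) \<le> (\<Sum>x\<in>?V - {u} - {v}. card (cut H {x}))"
      by (rule sum_mono) (use deg in auto)
    moreover have "card (?V - {u} - {v}) = card ?V - 2" using fV uv by (simp add: card_Diff_singleton_if)
    ultimately show False using sum uv(4,5) n by simp
  qed
  then have "\<exists>z. \<forall>v\<in>?V - {z}. card ?V + card (cut H {v}) \<le> card ?E"
    by (metis DiffE not_less singletonI)
  then show ?thesis using good by blast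
qed

section \<open>The bicircular lift matroid determines the cycles\<close>

text \<open>This makes the complements of cut-edges and of series pairs dependent. The sets
  \<open>A\<close>, \<open>B\<close>, \<open>C\<close> are linearly independent, as \<open>g\<close>
  lies in \<open>C\<close> only, so the members of their span that avoid \<open>e\<close> form a
  space of dimension at least two. \<open>flip X\<close> clears \<open>e\<close> by adding an
  \<open>X\<close> that contains it.\<close>

lemma two_avoiding:
  assumes Z: "binary_space E Z" and AB: "A \<in> Z" "B \<in> Z" "A \<noteq> {}" "B \<noteq> {}" "A \<noteq> B"
    and g: "g \<notin> A" "g \<notin> B" and C: "C \<in> Z" "g \<in> C"
  shows "\<exists>P\<in>Z. \<exists>Q\<in>Z. P \<noteq> {} \<and> Q \<noteq> {} \<and> P \<noteq> Q \<and> e \<notin> P \<and> e \<notin> Q"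
proof -
  note D = binary_spaceD(4)[OF Z]
  define flip where "flip X Y = (if e \<in> Y then X \<oplus> Y else Y)" for X Y
  have flip: "flip X Y \<in> Z" "e \<notin> flip X Y" if "X \<in> Z" "e \<in> X" "Y \<in> Z" for X Y
    using that D unfolding flip_def by auto
  have gflip: "g \<in> flip X C" if "g \<notin> X" for X using that C(2) unfolding flip_def by auto
  have ng: "g \<notin> flip A B" using g unfolding flip_def by auto
  have ne: "flip A B \<noteq> {}" using AB(4,5) unfolding flip_def by auto
  consider "e \<in> A" | "e \<notin> A" "e \<in> B" | "e \<notin> A" "e \<notin> B" by blast
  then show ?thesis
  proof cases
    case 1
    have "flip A C \<noteq> {}" "flip A C \<noteq> flip A B" using gflip[OF g(1)] ng by auto
    then show ?thesis using flip[OF AB(1) 1 AB(2)] flip[OF AB(1) 1 C(1)] ne by metis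
  next
    case 2
    have "flip B C \<noteq> {}" "flip B C \<noteq> A" using gflip[OF g(2)] g by auto
    then show ?thesis using flip[OF AB(2) 2(2) C(1)] 2(1) AB(1,3) by metis
  next
    case 3
    then show ?thesis using AB by metis
  qed
qed

theorem same_bicircular_lift_same_evens:
  fixes G1 :: "('v, 'e) mgraph" and G2 :: "('w, 'e) mgraph"
  assumes G1: "multigraph G1" and G2: "multigraph G2" and conn: "connected_mgraph G1"
    and L: "bicircular_lift G1 = bicircular_lift G2"
    and co: "is_co G1 H" and n: "5 \<le> card (mverts H)"
  shows "medges G1 = medges G2" "evens G1 = evens G2" "medges G1 \<noteq> {}"
proof -
  let ?E = "medges G1" and ?Z = "evens G1"
  define T where "T = cut_edges G1"
  define K where "K = mcontract G1 T"
  obtain d where d: "\<And>S. S \<in> series_classes K \<Longrightarrow> d S \<in> S"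
    and H: "H = mcontract K (\<Union>S\<in>series_classes K. S - {d S})"
    using co unfolding is_co_def Let_def K_def T_def by blast
  define R where "R = (\<Union>S\<in>series_classes K. S - {d S})"
  have E2: "medges G2 = ?E" using L unfolding bicircular_lift_def by simp
  have T: "T \<subseteq> ?E" unfolding T_def cut_edges_def by blast
  have K: "multigraph K" unfolding K_def by (rule multigraph_mcontract[OF G1 T])
  have EK: "medges K = ?E - T" unfolding K_def by (rule mcontract_sel(2)[OF G1 T])
  have evK: "evens K = (\<lambda>A. A - T) ` ?Z" unfolding K_def by (rule evens_mcontract[OF G1 T])
  have R: "R \<subseteq> medges K" unfolding R_def series_classes_def by blast
  have H': "multigraph H" unfolding H R_def[symmetric] by (rule multigraph_mcontract[OF K R])
  have EH: "medges H = ?E - T - R" unfolding H R_def[symmetric] using mcontract_sel(2)[OF K R] EK by simp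
  have evH: "evens H = (\<lambda>A. A - T - R) ` ?Z"
    unfolding H R_def[symmetric] evens_mcontract[OF K R] evK image_image by simp
  have "no_empty_cut K"
    unfolding K_def by (rule mcontract_no_empty_cut[OF G1 T connected_no_empty_cut[OF G1 conn]])
  then have connH: "no_empty_cut H"
    unfolding H R_def[symmetric] by (rule mcontract_no_empty_cut[OF K R])
  have Z1: "binary_space ?E ?Z" and Z2: "binary_space ?E (evens G2)"
    using binary_space_evens[OF G1] binary_space_evens[OF G2] E2 by auto
  note DZ = binary_spaceD[OF Z1]
  have tw: "two ?Z X \<longleftrightarrow> two (evens G2) X" if "X \<subseteq> ?E" for X
    using two_iff_circuit[OF G1 that] two_iff_circuit[OF G2, of X] that E2 L by simp
  have cute: "e \<in> T \<longleftrightarrow> (\<forall>X\<in>?Z. e \<notin> X)" if "e \<in> ?E" for e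
    unfolding T_def by (rule cut_edges_iff[OF G1 conn that])
  have ceK: "cyclically_equivalent (evens K) e f \<longleftrightarrow> cyclically_equivalent ?Z e f"
    if "e \<notin> T" "f \<notin> T" for e f
    unfolding cyclically_equivalent_def evK using that by auto
  define cl where "cl e = {f \<in> medges K. cyclically_equivalent (evens K) e f}" for e
  have sc: "series_classes K = cl ` medges K" unfolding cl_def by (rule series_classes_eq[OF K])
  have cl_eq: "cl e = cl f" if "f \<in> cl e" for e f
    using that unfolding cl_def cyclically_equivalent_def by auto
  have cl_self: "e \<in> cl e" if "e \<in> medges K" for e
    using that unfolding cl_def cyclically_equivalent_def by auto
  have orth: "orthogonal ?Z B" if B: "B \<subseteq> medges H" "orthogonal (evens H) B" for B
    unfolding orthogonal_def
  proof
    fix X assume "X \<in> ?Z"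
    then have "X - T - R \<in> evens H" unfolding evH by blast
    then have "even (card ((X - T - R) \<inter> B))" using B(2) unfolding orthogonal_def by blast
    moreover have "(X - T - R) \<inter> B = X \<inter> B" using B(1) EH by blast
    ultimately show "even (card (X \<inter> B))" by simp
  qed
  \<comment> \<open>Preimages in \<open>?Z\<close> differ from the given sets only inside
    \<open>T\<close> and \<open>R\<close>, and these miss \<open>B\<close>.\<close>
  have twoH: "two ?Z (?E - B)" if B: "B \<subseteq> medges H" "two (evens H) (medges H - B)" for B
  proof -
    obtain A C where AC: "A \<in> evens H" "C \<in> evens H" "A \<subseteq> medges H - B" "C \<subseteq> medges H - B"
      "A \<noteq> {}" "C \<noteq> {}" "A \<noteq> C" using B(2) unfolding two_def by blast
    obtain A' where A': "A' \<in> ?Z" "A = A' - T - R" using AC(1) unfolding evH by blast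
    obtain C' where C': "C' \<in> ?Z" "C = C' - T - R" using AC(2) unfolding evH by blast
    have "A' \<subseteq> ?E - B" "C' \<subseteq> ?E - B"
      using A' C' AC(3,4) B(1) EH DZ(3) by blast+
    moreover have "A' \<noteq> {}" "C' \<noteq> {}" "A' \<noteq> C'" using A' C' AC by auto
    ultimately show ?thesis unfolding two_def using A'(1) C'(1) by metis
  qed
  have cutH: "cut H U \<subseteq> medges H" for U unfolding cut_def by blast
  \<comment> \<open>A star is nonempty because contraction keeps the graph connected. A single edge
    would be a cut-edge of \<open>G1\<close> and two edges a series pair, but cut-edges are
    contracted and each series class retains only one element.\<close>
  have deg: "3 \<le> card (cut H {v})" if v: "v \<in> mverts H" for v
  proof -
    let ?B = "cut H {v}"
    have o: "orthogonal ?Z ?B" using orth[OF cutH orthogonal_cut[OF H']] .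
    have fin: "finite ?B" using cutH multigraphD(2)[OF H'] finite_subset by blast
    have "mverts H \<noteq> {v}" using n by auto
    then have "?B \<noteq> {}" using connH v unfolding no_empty_cut_def by blast
    then have "card ?B \<noteq> 0" using fin by simp
    moreover have "card ?B \<noteq> 1"
    proof
      assume "card ?B = 1"
      then obtain e where e: "?B = {e}" by (auto simp: card_1_singleton_iff)
      then have "e \<in> medges H" using cutH by blast
      then have "e \<in> ?E" "e \<notin> T" using EH by auto
      then obtain X where "X \<in> ?Z" "e \<in> X" using cute by blast
      moreover from this have "X \<inter> ?B = {e}" using e by blast
      ultimately show False using o unfolding orthogonal_def by fastforce
    qed
    moreover have "card ?B \<noteq> 2"
    proof
      assume "card ?B = 2"
      then obtain e f where ef: "?B = {e, f}" "e \<noteq> f" by (auto simp: card_2_iff)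
      have efH: "e \<in> medges H" "f \<in> medges H" using ef(1) cutH by blast+
      then have efK: "e \<in> medges K" "f \<in> medges K" "e \<notin> T" "f \<notin> T" "e \<notin> R" "f \<notin> R" unfolding EH EK by auto
      have "e \<in> X \<longleftrightarrow> f \<in> X" if "X \<in> ?Z" for X
      proof (rule ccontr)
        assume "(e \<in> X) \<noteq> (f \<in> X)"
        then have "card (X \<inter> ?B) = 1" unfolding ef(1) by (cases "e \<in> X"; cases "f \<in> X") auto
        then show False using o that unfolding orthogonal_def by fastforce
      qed
      then have "cyclically_equivalent ?Z e f" unfolding cyclically_equivalent_def by blast
      then have "f \<in> cl e" unfolding cl_def using ceK efK by blast
      moreover have "cl e \<in> series_classes K" unfolding sc using efK(1) by blast
      moreover have "e \<in> cl e" using cl_self efK(1) by blast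
      ultimately have "e \<in> R \<or> f \<in> R" using ef(2) unfolding R_def by blast
      then show False using efK by blast
    qed
    ultimately show ?thesis by linarith
  qed
  obtain z where z: "\<And>v. v \<in> mverts H - {z} \<Longrightarrow> two (evens H) (medges H - cut H {v})"
    using one_exceptional_vertex[OF H' n deg] by blast
  have "\<not> mverts H \<subseteq> {z}"
  proof
    assume "mverts H \<subseteq> {z}"
    then have "card (mverts H) \<le> 1" using card_mono[of "{z}"] by fastforce
    then show False using n by linarith
  qed
  then obtain v0 where v0: "v0 \<in> mverts H - {z}" by blast
  obtain A B where AB: "A \<in> ?Z" "B \<in> ?Z" "A \<noteq> {}" "B \<noteq> {}" "A \<noteq> B"
      "A \<subseteq> ?E - cut H {v0}" "B \<subseteq> ?E - cut H {v0}"
    using twoH[OF cutH z[OF v0]] unfolding two_def by blast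
  have "cut H {v0} \<noteq> {}" using deg[of v0] v0 by auto
  then obtain g where g: "g \<in> cut H {v0}" by blast
  then have "g \<in> ?E" "g \<notin> T" using cutH EH by blast+
  then obtain C where C: "C \<in> ?Z" "g \<in> C" using cute by blast
  have rich: "\<exists>P\<in>?Z. \<exists>Q\<in>?Z. P \<noteq> {} \<and> Q \<noteq> {} \<and> P \<noteq> Q \<and> e \<notin> P \<and> e \<notin> Q" for e
    by (rule two_avoiding[OF Z1 AB(1-5) _ _ C]) (use AB g in auto)
  have transfer: "even (card (X \<inter> B))" if "X \<in> evens G2" "B \<subseteq> ?E" "orthogonal ?Z B" "two ?Z (?E - B)" for X B
    using orthogonal_transfer[OF Z1 Z2 tw that(2-4)] that(1) unfolding orthogonal_def by blast
  have sub: "X \<in> ?Z" if X: "X \<in> evens G2" for X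
  proof -
    have XE: "X \<subseteq> ?E" using X evensD(1)[OF X] E2 by simp
    let ?Y = "X - T - R"
    have YH: "?Y \<subseteq> medges H" using XE EH by blast
    have notbd: "v \<notin> bd H ?Y" if v: "v \<in> mverts H - {z}" for v
    proof -
      have "cut H {v} \<subseteq> ?E" using cutH EH by blast
      then have "even (card (X \<inter> cut H {v}))"
        using transfer[OF X _ orth[OF cutH orthogonal_cut[OF H']] twoH[OF cutH z[OF v]]] by blast
      moreover have "?Y \<inter> cut H {v} = X \<inter> cut H {v}" using cutH EH by blast
      ultimately have "even (card (bd H ?Y \<inter> {v}))" using handshake[OF H' YH, of "{v}"] by simp
      then show ?thesis by (cases "v \<in> bd H ?Y") auto
    qed
    \<comment> \<open>Only the exceptional vertex can remain, and a boundary has even size.\<close>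
    have "bd H ?Y \<subseteq> {z}" using notbd bd_subset_verts[OF H'] by blast
    moreover have "even (card (bd H ?Y))" using even_card_bd[OF H' YH] .
    ultimately have "bd H ?Y = {}" by (metis card_1_singleton_iff odd_one One_nat_def subset_singletonD)
    then have "?Y \<in> evens H" using YH unfolding evens_def by blast
    then obtain X' where X': "X' \<in> ?Z" "?Y = X' - T - R" unfolding evH by blast
    have fin: "finite X" "finite X'" using XE X' DZ finite_subset by blast+
    have ev: "even (card ((X \<oplus> X') \<inter> B))" if "B \<subseteq> ?E" "orthogonal ?Z B" "two ?Z (?E - B)" for B
      using even_card_Int_symd[OF fin, of B] transfer[OF X that] that(2) X'(1) unfolding orthogonal_def by blast
    have out: "X \<oplus> X' \<subseteq> T \<union> R" using X'(2) by auto
    \<comment> \<open>The difference consists of contracted edges. A cut-edge is excluded by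
      transferring \<open>{e}\<close>, a contracted member of a series class by transferring its
      pair with the distinguished element, which is not contracted.\<close>
    have "e \<notin> X \<oplus> X'" for e
    proof
      assume e: "e \<in> X \<oplus> X'"
      have eE: "e \<in> ?E" using e XE DZ(3)[OF X'(1)] by auto
      obtain P Q where PQ: "P \<in> ?Z" "Q \<in> ?Z" "P \<noteq> {}" "Q \<noteq> {}" "P \<noteq> Q" "e \<notin> P" "e \<notin> Q"
        using rich[of e] by blast
      have PQE: "P \<subseteq> ?E" "Q \<subseteq> ?E" using DZ(3) PQ by auto
      show False
      proof (cases "e \<in> T")
        case True
        have "orthogonal ?Z {e}" using cute[OF eE] True unfolding orthogonal_def by simp
        moreover have "P \<subseteq> ?E - {e}" "Q \<subseteq> ?E - {e}" using PQ(6,7) PQE by blast+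
        then have "two ?Z (?E - {e})" unfolding two_def using PQ(1-5) by metis
        ultimately have "even (card ((X \<oplus> X') \<inter> {e}))" using ev[of "{e}"] eE by blast
        moreover have "(X \<oplus> X') \<inter> {e} = {e}" using e by blast
        ultimately show False by simp
      next
        case False
        then have "e \<in> R" using e out by blast
        then obtain S where S: "S \<in> series_classes K" "e \<in> S" "e \<noteq> d S" unfolding R_def by blast
        have eK: "e \<in> medges K" using S(1,2) unfolding sc cl_def by blast
        have Scl: "S = cl e" using S(1,2) cl_eq unfolding sc by blast
        let ?d = "d S"
        have dS: "?d \<in> cl e" using d[OF S(1)] Scl by simp
        then have dK: "?d \<in> medges K" "?d \<notin> T" unfolding cl_def EK by auto
        have ce: "cyclically_equivalent ?Z e ?d" using dS ceK[OF False dK(2)] unfolding cl_def by blast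
        have "orthogonal ?Z {e, ?d}" unfolding orthogonal_def
        proof
          fix Y assume "Y \<in> ?Z"
          then have "Y \<inter> {e, ?d} = {} \<or> Y \<inter> {e, ?d} = {e, ?d}" using ce unfolding cyclically_equivalent_def by blast
          then show "even (card (Y \<inter> {e, ?d}))" using S(3) by auto
        qed
        moreover have "?d \<notin> P" "?d \<notin> Q" using ce PQ unfolding cyclically_equivalent_def by blast+
        then have "P \<subseteq> ?E - {e, ?d}" "Q \<subseteq> ?E - {e, ?d}" using PQ(6,7) PQE by blast+
        then have "two ?Z (?E - {e, ?d})" unfolding two_def using PQ(1-5) by metis
        moreover have "{e, ?d} \<subseteq> ?E" using eE dK(1) unfolding EK by blast
        ultimately have "even (card ((X \<oplus> X') \<inter> {e, ?d}))" using ev by blast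
        \<comment> \<open>Series classes are disjoint, so the only class in which \<open>?d\<close>
          could be contracted is \<open>S\<close>, where it is the distinguished element.\<close>
        moreover have "?d \<notin> X \<oplus> X'"
        proof
          assume "?d \<in> X \<oplus> X'"
          then have "?d \<in> R" using out dK(2) by blast
          then obtain S' where S': "S' \<in> series_classes K" "?d \<in> S'" "?d \<noteq> d S'" unfolding R_def by blast
          then have S'cl: "S' = cl ?d" using cl_eq unfolding sc by blast
          have "S' = S" by (rule trans[OF S'cl trans[OF cl_eq[OF dS, symmetric] Scl[symmetric]]])
          then show False using S'(3) by simp
        qed
        then have "(X \<oplus> X') \<inter> {e, ?d} = {e}" using e by blast
        ultimately show False by simp
      qed
    qed
    then have "X \<oplus> X' = {}" by blast
    then show ?thesis using X'(1) by simp
  qed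
  show "?E = medges G2" using E2 by simp
  have "A \<subseteq> ?E" "B \<subseteq> ?E" using AB(1,2) DZ(3) by auto
  then have "two ?Z ?E" unfolding two_def using AB(1-5) by metis
  then show "?Z = evens G2" using binary_space_eqI[OF Z1 Z2 tw] sub by blast
  show "?E \<noteq> {}" using \<open>g \<in> ?E\<close> by blast
qed

section \<open>Nonseparability as indecomposability of the cycle space\<close>

section \<open>Nonseparable graphs\<close>

text \<open>The condition \<open>\<subseteq> {v}\<close> covers empty intersections too, so
  connectedness is included. A single loop qualifies, and so does the graph without vertices and
  edges.\<close>

definition block_graph :: "('v, 'e) mgraph \<Rightarrow> bool" where
  "block_graph G \<longleftrightarrow> multigraph G \<and> mverts G = edge_verts G (medges G) \<and>
     (\<forall>X v. X \<subseteq> medges G \<and> X \<noteq> {} \<and> X \<noteq> medges G \<longrightarrow>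
        \<not> edge_verts G X \<inter> edge_verts G (medges G - X) \<subseteq> {v})"

text \<open>If \<open>X \<inter> S\<close> is in \<open>Z\<close> for every \<open>X\<close> in
  \<open>Z\<close>, a binary space \<open>Z\<close> is the direct sum of its restrictions to
  \<open>S\<close> and \<open>E - S\<close>. Excluding this is connectedness of the cycle matroid.
  It depends on \<open>Z\<close> alone and so carries nonseparability from one graph to
  another.\<close>

definition connected_space :: "'e set \<Rightarrow> 'e set set \<Rightarrow> bool" where
  "connected_space E Z \<longleftrightarrow> (\<forall>S. S \<subseteq> E \<and> S \<noteq> {} \<and> S \<noteq> E \<longrightarrow> (\<exists>X\<in>Z. X \<inter> S \<notin> Z))"

lemma block_graphD:
  assumes "block_graph G"
  shows "multigraph G" "mverts G = edge_verts G (medges G)"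
  using assms unfolding block_graph_def by auto

lemma block_graph_two_verts:
  assumes "block_graph G" "X \<subseteq> medges G" "X \<noteq> {}" "X \<noteq> medges G"
  shows "\<exists>x y. x \<noteq> y \<and> x \<in> edge_verts G X \<and> x \<in> edge_verts G (medges G - X) \<and>
    y \<in> edge_verts G X \<and> y \<in> edge_verts G (medges G - X)"
proof (rule ccontr)
  assume n: "\<not> ?thesis"
  let ?I = "edge_verts G X \<inter> edge_verts G (medges G - X)"
  have "\<exists>v. ?I \<subseteq> {v}"
  proof (cases "?I = {}")
    case False
    then obtain v where "v \<in> ?I" by blast
    then have "?I \<subseteq> {v}" using n by blast
    then show ?thesis by blast
  qed blast
  then show False using assms unfolding block_graph_def by blast
qed

text \<open>The boundaries of the two parts add up to zero. Their common value therefore lies in the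
  vertices shared by \<open>X\<close> and the remaining edges, which is how even sets detect
  attachments.\<close>

lemma bd_split:
  assumes G: "multigraph G" and Y: "Y \<in> evens G"
  shows "bd G (Y \<inter> X) = bd G (Y - X)"
proof -
  have f: "finite Y" using evens_finite[OF G Y] .
  have "Y = (Y \<inter> X) \<union> (Y - X)" by blast
  then have "{} = bd G (Y \<inter> X) \<oplus> bd G (Y - X)"
    using bd_Un[of "Y \<inter> X" "Y - X" G] f evensD(2)[OF Y] by (metis Diff_disjoint finite_Diff finite_Int
        Int_Diff Int_commute Int_empty_right)
  then show ?thesis by simp
qed

lemma bd_split_subset:
  assumes G: "multigraph G" and Y: "Y \<in> evens G"
  shows "bd G (Y \<inter> X) \<subseteq> edge_verts G X \<inter> edge_verts G (medges G - X)"
proof -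
  have "bd G (Y \<inter> X) \<subseteq> edge_verts G X"
    using bd_subset edge_verts_mono[of "Y \<inter> X" X G] by (metis inf_le2 order_trans)
  moreover have "Y - X \<subseteq> medges G - X" using evensD(1)[OF Y] by blast
  then have "bd G (Y - X) \<subseteq> edge_verts G (medges G - X)"
    using bd_subset edge_verts_mono by (metis order_trans)
  ultimately show ?thesis unfolding bd_split[OF G Y] by blast
qed

lemma even_subset_single:
  assumes "even (card D)" "D \<subseteq> {v}" shows "D = {}"
  using assms by (metis card_1_singleton_iff odd_one One_nat_def subset_singletonD)

text \<open>If two sides share at most one vertex, the part of an even set in one side has a
  boundary of even size inside one vertex, so this part is even.\<close>

lemma connected_space_block_graph:
  assumes G: "multigraph G" "mverts G = edge_verts G (medges G)"
    and c: "connected_space (medges G) (evens G)"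
  shows "block_graph G"
  unfolding block_graph_def
proof (intro conjI allI impI notI)
  fix X v assume X: "X \<subseteq> medges G \<and> X \<noteq> {} \<and> X \<noteq> medges G"
    and v: "edge_verts G X \<inter> edge_verts G (medges G - X) \<subseteq> {v}"
  obtain Y where Y: "Y \<in> evens G" "Y \<inter> X \<notin> evens G" using c X unfolding connected_space_def by blast
  have YX: "Y \<inter> X \<subseteq> medges G" using X by blast
  have "bd G (Y \<inter> X) = {}"
    using even_subset_single[OF even_card_bd[OF G(1) YX]] bd_split_subset[OF G(1) Y(1), of X] v by blast
  then show False using Y(2) YX unfolding evens_def by blast
qed (use G in auto)

definition edge_comp :: "('v, 'e) mgraph \<Rightarrow> 'e set \<Rightarrow> 'v \<Rightarrow> 'e set" where
  "edge_comp G S a = {f \<in> S. mends G f \<subseteq> {x. reach G S a x}}"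

lemma edge_comp:
  fixes G :: "('v, 'e) mgraph" and a :: 'v
  assumes G: "multigraph G" and S: "S \<subseteq> medges G"
  defines "A \<equiv> edge_comp G S a"
  shows "A \<subseteq> S" "edge_verts G A \<inter> edge_verts G (S - A) = {}"
    "\<And>x y. x \<in> edge_verts G A \<Longrightarrow> y \<in> edge_verts G A \<Longrightarrow> reach G A x y"
    "\<And>f. f \<in> S \<Longrightarrow> a \<in> mends G f \<Longrightarrow> f \<in> A"
    "\<And>x. x \<in> edge_verts G A \<Longrightarrow> reach G S a x"
proof -
  let ?U = "{x. reach G S a x}"
  have fS: "finite S" using S multigraphD(2)[OF G] finite_subset by blast
  show AS: "A \<subseteq> S" unfolding A_def edge_comp_def by blast
  have dich: "mends G f \<subseteq> ?U" if "f \<in> S" "x \<in> mends G f" "x \<in> ?U" for f x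
    using reach_edge'[OF G S that(1,2)] reach_trans[OF fS, of G a x] that(3) by blast
  have inU: "edge_verts G A \<subseteq> ?U" unfolding A_def edge_comp_def edge_verts_def by blast
  have outU: "edge_verts G (S - A) \<inter> ?U = {}" using dich unfolding A_def edge_comp_def edge_verts_def by blast
  show disj: "edge_verts G A \<inter> edge_verts G (S - A) = {}" using inU outU by blast
  show "reach G S a x" if "x \<in> edge_verts G A" for x using inU that by blast
  show "f \<in> A" if "f \<in> S" "a \<in> mends G f" for f
    using dich[OF that] that(1) unfolding A_def edge_comp_def by simp
  fix x y assume xy: "x \<in> edge_verts G A" "y \<in> edge_verts G A"
  have "reach G S x y" using inU xy reach_trans[OF fS, of G x a y] reach_sym[of G S a x] by blast
  then obtain Q where Q: "Q \<subseteq> S" "bd G Q = {x} \<oplus> {y}" unfolding reach_def by blast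
  have fQ: "finite Q" using Q(1) fS finite_subset by blast
  have "Q = (Q \<inter> A) \<union> (Q - A)" by blast
  then have eq: "bd G (Q \<inter> A) \<oplus> bd G (Q - A) = {x} \<oplus> {y}"
    using bd_Un[of "Q \<inter> A" "Q - A" G] fQ Q(2) by (metis Diff_disjoint finite_Diff finite_Int
        Int_Diff Int_commute Int_empty_right)
  have 1: "bd G (Q \<inter> A) \<subseteq> edge_verts G A"
    using bd_subset edge_verts_mono[of "Q \<inter> A" A G] by (metis inf_le2 order_trans)
  have "Q - A \<subseteq> S - A" using Q(1) by blast
  then have 2: "bd G (Q - A) \<subseteq> edge_verts G (S - A)" using bd_subset edge_verts_mono by (metis order_trans)
  have "z \<in> bd G (Q \<inter> A) \<longleftrightarrow> z \<in> {x} \<oplus> {y}" for z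
  proof (cases "z \<in> edge_verts G A")
    case True
    then have "z \<notin> bd G (Q - A)" using 2 disj by blast
    then show ?thesis using eq unfolding set_eq_iff symd_iff by metis
  next
    case False
    then have "z \<notin> {x} \<oplus> {y}" using xy by auto
    then show ?thesis using 1 False by blast
  qed
  then have "bd G (Q \<inter> A) = {x} \<oplus> {y}" by blast
  then show "reach G A x y" unfolding reach_def by blast
qed

text \<open>A component of a separator shares no vertex with the rest of it and is therefore a
  separator as well.\<close>

lemma edge_comp_separates:
  assumes G: "multigraph G" and S: "S \<subseteq> medges G"
    and sep: "\<And>X. X \<in> evens G \<Longrightarrow> X \<inter> S \<in> evens G" and X: "X \<in> evens G"
  shows "X \<inter> edge_comp G S a \<in> evens G"
proof -
  let ?A = "edge_comp G S a"
  note c = edge_comp[OF G S, where a = a]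
  have Y: "X \<inter> S \<in> evens G" using sep X by blast
  have "bd G (X \<inter> S \<inter> ?A) \<subseteq> edge_verts G ?A"
    using bd_subset edge_verts_mono[of "X \<inter> S \<inter> ?A" ?A G] by (metis inf_le2 order_trans)
  moreover have "bd G (X \<inter> S - ?A) \<subseteq> edge_verts G (S - ?A)"
    using bd_subset edge_verts_mono[of "X \<inter> S - ?A" "S - ?A" G] by (metis Diff_mono inf_le2 order_refl order_trans)
  ultimately have "bd G (X \<inter> S \<inter> ?A) = {}" using bd_split[OF G Y, of ?A] c(2) by blast
  moreover have "X \<inter> S \<inter> ?A = X \<inter> ?A" using c(1) by blast
  ultimately show ?thesis using evensD(1)[OF X] unfolding evens_def by auto
qed

text \<open>From a separator one passes to a component \<open>A\<close> of it, then to a component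
  \<open>C\<close> of the remaining edges. Nonseparability gives two vertices \<open>x\<close>,
  \<open>y\<close> of \<open>C\<close> that lie on other edges, necessarily edges of
  \<open>A\<close>. Connections of \<open>x\<close> and \<open>y\<close> in \<open>A\<close> and in
  \<open>C\<close> together form an even set whose part in \<open>A\<close> is not even.\<close>

lemma block_graph_connected_space:
  assumes B: "block_graph G"
  shows "connected_space (medges G) (evens G)"
  unfolding connected_space_def
proof (intro allI impI)
  note G = block_graphD(1)[OF B]
  have fE: "finite (medges G)" using multigraphD(2)[OF G] .
  fix S assume S: "S \<subseteq> medges G \<and> S \<noteq> {} \<and> S \<noteq> medges G"
  show "\<exists>X\<in>evens G. X \<inter> S \<notin> evens G"
  proof (rule ccontr)
    assume "\<not> ?thesis"
    then have sep: "\<And>X. X \<in> evens G \<Longrightarrow> X \<inter> S \<in> evens G" by blast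
    obtain e where e: "e \<in> S" using S by blast
    have SE: "S \<subseteq> medges G" using S by blast
    obtain a b where a: "mends G e = {a, b}" using ends_pair[OF G SE e] by blast
    define A where "A = edge_comp G S a"
    note cA = edge_comp[OF G SE, where a = a, folded A_def]
    have eA: "e \<in> A" using cA(4)[OF e] a by simp
    have sepA: "X \<inter> A \<in> evens G" if "X \<in> evens G" for X
      unfolding A_def using edge_comp_separates[OF G SE sep that] .
    have "A \<noteq> medges G" using cA(1) S by blast
    then obtain f where f: "f \<in> medges G - A" using cA(1) SE by blast
    define R where "R = medges G - A"
    have RE: "R \<subseteq> medges G" unfolding R_def by blast
    obtain c d where c: "mends G f = {c, d}" using ends_pair[OF G RE] f unfolding R_def by blast
    define C where "C = edge_comp G R c"
    note cC = edge_comp[OF G RE, where a = c, folded C_def]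
    have fC: "f \<in> C" using cC(4)[of f] c f unfolding R_def by simp
    have "C \<subseteq> medges G" "C \<noteq> {}" "C \<noteq> medges G" using fC cC(1) eA cA(1) SE unfolding R_def by blast+
    then obtain x y where xy: "x \<noteq> y" "x \<in> edge_verts G C" "x \<in> edge_verts G (medges G - C)"
      "y \<in> edge_verts G C" "y \<in> edge_verts G (medges G - C)"
      using block_graph_two_verts[OF B] by blast
    have "medges G - C \<subseteq> A \<union> (R - C)" unfolding R_def by blast
    then have "edge_verts G (medges G - C) \<subseteq> edge_verts G A \<union> edge_verts G (R - C)"
      using edge_verts_mono edge_verts_Un by metis
    then have xyA: "x \<in> edge_verts G A" "y \<in> edge_verts G A" using xy cC(2) by blast+
    obtain P where P: "P \<subseteq> A" "bd G P = {x} \<oplus> {y}" using cA(3)[OF xyA] unfolding reach_def by blast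
    obtain Q where Q: "Q \<subseteq> C" "bd G Q = {x} \<oplus> {y}" using cC(3)[OF xy(2,4)] unfolding reach_def by blast
    have sub: "P \<subseteq> medges G" "Q \<subseteq> medges G" "P \<inter> Q = {}"
      using P(1) Q(1) cA(1) cC(1) SE unfolding R_def by blast+
    have "bd G (P \<union> Q) = {}"
      using bd_Un[OF finite_subset[OF sub(1) fE] finite_subset[OF sub(2) fE] sub(3), of G] P(2) Q(2) by simp
    then have "P \<union> Q \<in> evens G" using sub unfolding evens_def by blast
    then have "(P \<union> Q) \<inter> A \<in> evens G" by (rule sepA)
    moreover have "(P \<union> Q) \<inter> A = P" using P(1) Q(1) cC(1) unfolding R_def by blast
    ultimately have "{x} \<oplus> {y} = {}" using P(2) evensD(2) by metis
    then show False using xy(1) by simp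
  qed
qed

text \<open>Nonseparability is applied to the component of \<open>X\<close> at \<open>x\<close>. It
  has two attachments, one of them different from \<open>x\<close>, and these are attachments of
  \<open>X\<close> as well.\<close>

lemma block_graph_partner:
  assumes B: "block_graph G" and X: "X \<subseteq> medges G" "X \<noteq> medges G" and x: "x \<in> edge_verts G X"
  shows "\<exists>y. y \<noteq> x \<and> y \<in> edge_verts G X \<and> y \<in> edge_verts G (medges G - X) \<and> reach G X x y"
proof -
  note G = block_graphD(1)[OF B]
  define A where "A = edge_comp G X x"
  note c = edge_comp[OF G X(1), where a = x, folded A_def]
  obtain f where "f \<in> X" "x \<in> mends G f" using x edge_vertsE by metis
  then have fA: "f \<in> A" using c(4) by blast
  have "A \<subseteq> medges G" "A \<noteq> {}" "A \<noteq> medges G" using fA c(1) X by blast+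
  then obtain p q where pq: "p \<noteq> q" "p \<in> edge_verts G A" "p \<in> edge_verts G (medges G - A)"
      "q \<in> edge_verts G A" "q \<in> edge_verts G (medges G - A)"
    using block_graph_two_verts[OF B] by blast
  then obtain y where y: "y \<noteq> x" "y \<in> edge_verts G A" "y \<in> edge_verts G (medges G - A)" by metis
  have "medges G - A \<subseteq> (medges G - X) \<union> (X - A)" by blast
  then have "edge_verts G (medges G - A) \<subseteq> edge_verts G (medges G - X) \<union> edge_verts G (X - A)"
    using edge_verts_mono edge_verts_Un by metis
  then have "y \<in> edge_verts G (medges G - X)" using y(2,3) c(2) by blast
  moreover have "y \<in> edge_verts G X" using y(2) edge_verts_mono[OF c(1), of G] by blast
  moreover have "reach G X x y" using c(5)[OF y(2)] .
  ultimately show ?thesis using y(1) by blast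
qed

lemma block_graph_reach:
  assumes B: "block_graph G" and xy: "x \<in> mverts G" "y \<in> mverts G"
  shows "reach G (medges G) x y"
proof -
  note G = block_graphD(1)[OF B]
  define A where "A = edge_comp G (medges G) x"
  note c = edge_comp[OF G order.refl, where a = x, folded A_def]
  obtain f where "f \<in> medges G" "x \<in> mends G f" using xy(1) block_graphD(2)[OF B] edge_vertsE by metis
  then have "A \<noteq> {}" using c(4) by blast
  then have "A = medges G" using block_graph_two_verts[OF B c(1)] c(2) by blast
  then show ?thesis using c(5)[of y] xy(2) block_graphD(2)[OF B] by simp
qed

section \<open>Switchings as an exchange of two vertices on one side\<close>

section \<open>Whitney switchings\<close>

text \<open>\<open>whitney_switching\<close> keeps only the vertices that lie on edges. For graphs
  without isolated vertices the vertex set is thus preserved, and a switching is a change of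
  incidences on a fixed vertex set.\<close>

definition full_mgraph :: "('v, 'e) mgraph \<Rightarrow> bool" where
  "full_mgraph G \<longleftrightarrow> multigraph G \<and> mverts G = edge_verts G (medges G)"

lemma full_mgraphD:
  assumes "full_mgraph G" shows "multigraph G" "mverts G = edge_verts G (medges G)"
  using assms unfolding full_mgraph_def by auto

lemma block_graph_full: "block_graph G \<Longrightarrow> full_mgraph G"
  unfolding block_graph_def full_mgraph_def by blast

definition two_sep :: "('v, 'e) mgraph \<Rightarrow> 'e set \<Rightarrow> 'e set \<Rightarrow> 'v \<Rightarrow> 'v \<Rightarrow> bool" where
  "two_sep G X1 X2 u1 u2 \<longleftrightarrow> X1 \<union> X2 = medges G \<and> X1 \<inter> X2 = {} \<and> u1 \<noteq> u2 \<and>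
     edge_verts G X1 \<inter> edge_verts G X2 = {u1, u2}"

lemma two_sepD:
  assumes "two_sep G X1 X2 u1 u2"
  shows "X1 \<union> X2 = medges G" "X1 \<inter> X2 = {}" "u1 \<noteq> u2"
    "edge_verts G X1 \<inter> edge_verts G X2 = {u1, u2}"
    "u1 \<in> edge_verts G X1" "u1 \<in> edge_verts G X2" "u2 \<in> edge_verts G X1" "u2 \<in> edge_verts G X2"
    "X1 \<subseteq> medges G" "X2 \<subseteq> medges G"
  using assms unfolding two_sep_def by blast+

lemma two_sep_commute: "two_sep G X1 X2 u1 u2 \<Longrightarrow> two_sep G X2 X1 u1 u2"
  unfolding two_sep_def by blast

definition vswap :: "'v \<Rightarrow> 'v \<Rightarrow> 'v \<Rightarrow> 'v" where
  "vswap a b = id(a := b, b := a)"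

lemma vswap_simps [simp]: "vswap a b a = b" "vswap a b b = a" "vswap a b (vswap a b x) = x"
  "x \<noteq> a \<Longrightarrow> x \<noteq> b \<Longrightarrow> vswap a b x = x"
  unfolding vswap_def by auto

lemma inj_vswap: "inj (vswap a b)"
  by (rule inj_on_inverseI[of _ "vswap a b"]) simp

lemma vswap_image_image [simp]: "vswap a b ` vswap a b ` X = X"
  unfolding image_image by simp

lemma vswap_fixes:
  assumes "a \<in> X" "b \<in> X" shows "vswap a b ` X = X"
proof -
  have *: "vswap a b x \<in> X" if "x \<in> X" for x
    using assms that by (cases "x = a"; cases "x = b") auto
  show ?thesis
  proof (intro equalityI subsetI)
    fix x assume "x \<in> X"
    then show "x \<in> vswap a b ` X" using *[of x] by (metis imageI vswap_simps(3))
  qed (use * in auto)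
qed

definition switch :: "('v, 'e) mgraph \<Rightarrow> 'e set \<Rightarrow> 'v \<Rightarrow> 'v \<Rightarrow> ('v, 'e) mgraph" where
  "switch G X a b = make_mgraph (mverts G) (medges G) (\<lambda>e. if e \<in> X then vswap a b ` mends G e else mends G e)"

lemma switch_sel [simp]:
  "mverts (switch G X a b) = mverts G" "medges (switch G X a b) = medges G"
  "e \<in> X \<Longrightarrow> X \<subseteq> medges G \<Longrightarrow> mends (switch G X a b) e = vswap a b ` mends G e"
  unfolding switch_def by auto

lemma switch_ends_other:
  "multigraph G \<Longrightarrow> e \<notin> X \<Longrightarrow> mends (switch G X a b) e = mends G e"
  unfolding switch_def using multigraphD(5) by force

lemma whitney_switching_iff:
  assumes G: "full_mgraph G"
  shows "whitney_switching G G' \<longleftrightarrow> (\<exists>X1 X2 u1 u2. two_sep G X1 X2 u1 u2 \<and> G' = switch G X2 u1 u2)"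
proof -
  have eq: "make_mgraph (mverts (edge_restrict G X1) \<union> mverts (edge_restrict G X2)) (medges G)
      (\<lambda>e. if e \<in> X1 then mends G e else id(u1 := u2, u2 := u1) ` mends G e) = switch G X2 u1 u2"
    if "X1 \<union> X2 = medges G" "X1 \<inter> X2 = {}" for X1 X2 u1 u2
  proof -
    have 1: "mverts (edge_restrict G X1) \<union> mverts (edge_restrict G X2) = mverts G"
      using that(1) full_mgraphD(2)[OF G] edge_verts_Un[of G X1 X2] by simp
    have 2: "(\<lambda>e. if e \<in> medges G then if e \<in> X1 then mends G e else id(u1 := u2, u2 := u1) ` mends G e else {})
        = (\<lambda>e. if e \<in> medges G then if e \<in> X2 then vswap u1 u2 ` mends G e else mends G e else {})"
      using that unfolding vswap_def by (intro ext) auto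
    show ?thesis unfolding 1 switch_def make_mgraph_def 2 ..
  qed
  show ?thesis
  proof
    assume "whitney_switching G G'"
    then obtain X1 X2 u1 u2 where *: "X1 \<union> X2 = medges G" "X1 \<inter> X2 = {}" "u1 \<noteq> u2"
        "mverts (edge_restrict G X1) \<inter> mverts (edge_restrict G X2) = {u1, u2}"
      and G': "G' = make_mgraph (mverts (edge_restrict G X1) \<union> mverts (edge_restrict G X2)) (medges G)
        (\<lambda>e. if e \<in> X1 then mends G e else id(u1 := u2, u2 := u1) ` mends G e)"
      unfolding whitney_switching_def by blast
    have "two_sep G X1 X2 u1 u2" using * unfolding two_sep_def by simp
    moreover have "G' = switch G X2 u1 u2" unfolding G' by (rule eq[OF *(1,2)])
    ultimately show "\<exists>X1 X2 u1 u2. two_sep G X1 X2 u1 u2 \<and> G' = switch G X2 u1 u2" by blast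
  next
    assume "\<exists>X1 X2 u1 u2. two_sep G X1 X2 u1 u2 \<and> G' = switch G X2 u1 u2"
    then obtain X1 X2 u1 u2 where s: "two_sep G X1 X2 u1 u2" and G': "G' = switch G X2 u1 u2" by blast
    note D = s[unfolded two_sep_def]
    show "whitney_switching G G'" unfolding whitney_switching_def
      by (rule exI[of _ X1], rule exI[of _ X2], rule exI[of _ u1], rule exI[of _ u2])
        (use D G' eq[of X1 X2 u1 u2] in simp)
  qed
qed

lemma edge_verts_switch:
  assumes "multigraph G" "X2 \<subseteq> medges G"
  shows "Y \<inter> X2 = {} \<Longrightarrow> edge_verts (switch G X2 a b) Y = edge_verts G Y"
    "Y \<subseteq> X2 \<Longrightarrow> edge_verts (switch G X2 a b) Y = vswap a b ` edge_verts G Y"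
proof -
  show "edge_verts (switch G X2 a b) Y = edge_verts G Y" if "Y \<inter> X2 = {}"
    by (rule edge_verts_cong) (use that switch_ends_other[OF assms(1)] in blast)
  show "edge_verts (switch G X2 a b) Y = vswap a b ` edge_verts G Y" if "Y \<subseteq> X2"
    unfolding edge_verts_def image_UN
    by (rule SUP_cong) (use that assms(2) in auto)
qed

lemma bd_switch:
  assumes "multigraph G" "X2 \<subseteq> medges G"
  shows "Y \<inter> X2 = {} \<Longrightarrow> bd (switch G X2 a b) Y = bd G Y"
    "Y \<subseteq> X2 \<Longrightarrow> bd (switch G X2 a b) Y = vswap a b ` bd G Y"
proof -
  show "bd (switch G X2 a b) Y = bd G Y" if "Y \<inter> X2 = {}"
    by (rule bd_cong) (use that switch_ends_other[OF assms(1)] in blast)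
  assume Y: "Y \<subseteq> X2"
  have inv: "v \<in> vswap a b ` S \<longleftrightarrow> vswap a b v \<in> S" for v S by (metis image_iff vswap_simps(3))
  have ends: "mends (switch G X2 a b) e = vswap a b ` mends G e" if "e \<in> Y" for e
    using that Y assms(2) by (intro switch_sel(3)) auto
  have card: "card (vswap a b ` S) = card S" for S by (simp add: card_image inj_on_subset[OF inj_vswap])
  have "{e \<in> Y. v \<in> mends (switch G X2 a b) e \<and> card (mends (switch G X2 a b) e) = 2}
      = {e \<in> Y. vswap a b v \<in> mends G e \<and> card (mends G e) = 2}" for v
    by (rule Collect_cong) (use ends inv card in metis)
  then have "v \<in> bd (switch G X2 a b) Y \<longleftrightarrow> vswap a b v \<in> bd G Y" for v
    unfolding bd_def by simp
  then show "bd (switch G X2 a b) Y = vswap a b ` bd G Y" unfolding set_eq_iff inv by blast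
qed

text \<open>A switching is undone by repeating it, so one inclusion between the even sets is enough,
  applied to \<open>G\<close> and to \<open>K\<close>. The boundary of the part of an even set in
  \<open>X2\<close> is \<open>{}\<close> or \<open>{u1, u2}\<close>, and exchanging
  \<open>u1\<close> and \<open>u2\<close> fixes both.\<close>

lemma switch_facts:
  assumes F: "full_mgraph G" and s: "two_sep G X1 X2 u1 u2"
  defines "K \<equiv> switch G X2 u1 u2"
  shows "edge_verts K X1 = edge_verts G X1" "edge_verts K X2 = edge_verts G X2"
    "full_mgraph K" "two_sep K X1 X2 u1 u2" "switch K X2 u1 u2 = G" "evens K = evens G"
proof -
  note G = full_mgraphD(1)[OF F] and D = two_sepD[OF s]
  \<comment> \<open>Stated for an arbitrary graph because it is needed for \<open>G\<close> and
    again for \<open>K\<close>.\<close>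
  have m: "multigraph (switch G X2 u1 u2)" if F: "full_mgraph G" and s: "two_sep G X1 X2 u1 u2"
    for G :: "('a, 'b) mgraph"
  proof -
    note G = full_mgraphD(1)[OF F] and D = two_sepD[OF s]
    have V: "u1 \<in> mverts G" "u2 \<in> mverts G" using D(5,7) edge_verts_subset[OF G, of X1] by blast+
    have V': "vswap u1 u2 ` mverts G = mverts G" using vswap_fixes[OF V] .
    show ?thesis unfolding multigraph_def
    proof (intro conjI ballI allI impI)
      show "finite (mverts (switch G X2 u1 u2))" "finite (medges (switch G X2 u1 u2))"
        using multigraphD[OF G] by auto
    next
      fix e assume e: "e \<in> medges (switch G X2 u1 u2)"
      then have eG: "e \<in> medges G" by simp
      show "mends (switch G X2 u1 u2) e \<subseteq> mverts (switch G X2 u1 u2)"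
        using multigraphD(3)[OF G eG] V' D(10) switch_ends_other[OF G, of e X2] by (cases "e \<in> X2") auto
      have "card (vswap u1 u2 ` mends G e) = card (mends G e)"
        by (simp add: card_image inj_on_subset[OF inj_vswap])
      then show "card (mends (switch G X2 u1 u2) e) \<in> {1, 2}"
        using multigraphD(4)[OF G eG] D(10) switch_ends_other[OF G, of e X2] by (cases "e \<in> X2") auto
    next
      fix e assume "e \<notin> medges (switch G X2 u1 u2)"
      then show "mends (switch G X2 u1 u2) e = {}" unfolding switch_def by simp
    qed
  qed
  have mK: "multigraph K" unfolding K_def using m[OF F s] .
  show 1: "edge_verts K X1 = edge_verts G X1" unfolding K_def using edge_verts_switch(1)[OF G D(10,2)] .
  show 2: "edge_verts K X2 = edge_verts G X2" unfolding K_def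
    using edge_verts_switch(2)[OF G D(10) order.refl, of u1 u2] vswap_fixes[OF D(6,8)] by simp
  have E: "medges K = medges G" unfolding K_def by simp
  have "edge_verts K (medges G) = edge_verts G (medges G)"
    unfolding D(1)[symmetric] edge_verts_Un 1 2 ..
  then show FK: "full_mgraph K" unfolding full_mgraph_def using mK full_mgraphD(2)[OF F] unfolding E
    by (simp add: K_def)
  show sK: "two_sep K X1 X2 u1 u2" using s unfolding two_sep_def 1 2 E .
  show sw: "switch K X2 u1 u2 = G"
  proof (rule mgraph_eqI)
    show "multigraph (switch K X2 u1 u2)" using m[OF FK sK] .
    show "multigraph G" by fact
    show "mverts (switch K X2 u1 u2) = mverts G" "medges (switch K X2 u1 u2) = medges G"
      unfolding K_def by auto
    fix e
    show "mends (switch K X2 u1 u2) e = mends G e"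
    proof (cases "e \<in> X2")
      case True
      then show ?thesis using D(10) E unfolding K_def by simp
    next
      case False
      then show ?thesis using switch_ends_other[OF mK False] switch_ends_other[OF G False] unfolding K_def by simp
    qed
  qed
  have sub: "evens G \<subseteq> evens (switch G X2 u1 u2)" if F: "full_mgraph G" and s: "two_sep G X1 X2 u1 u2"
    for G :: "('a, 'b) mgraph"
  proof
    note G = full_mgraphD(1)[OF F] and D = two_sepD[OF s]
    fix Y assume Y: "Y \<in> evens G"
    have YE: "Y \<subseteq> medges G" using evensD(1)[OF Y] .
    have "medges G - X2 = X1" using D(1,2) by blast
    then have sub: "bd G (Y \<inter> X2) \<subseteq> {u1, u2}" using bd_split_subset[OF G Y, of X2] D(4) by auto
    have even: "even (card (bd G (Y \<inter> X2)))" by (rule even_card_bd[OF G]) (use YE in blast)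
    have "bd G (Y \<inter> X2) = {} \<or> bd G (Y \<inter> X2) = {u1, u2}"
    proof (cases "u1 \<in> bd G (Y \<inter> X2) \<and> u2 \<in> bd G (Y \<inter> X2)")
      case False
      then have "bd G (Y \<inter> X2) \<subseteq> {u1} \<or> bd G (Y \<inter> X2) \<subseteq> {u2}" using sub by blast
      then show ?thesis using even_subset_single[OF even] by blast
    qed (use sub in blast)
    then have fixed: "vswap u1 u2 ` bd G (Y \<inter> X2) = bd G (Y \<inter> X2)"
      using vswap_fixes[of u1 "{u1, u2}" u2] by (elim disjE) simp_all
    let ?S = "switch G X2 u1 u2"
    have Diff_disjoint': "(Y - X2) \<inter> X2 = {}" for Y by blast
    have f: "finite Y" using evens_finite[OF G Y] .
    have "bd ?S Y = bd ?S (Y - X2) \<oplus> bd ?S (Y \<inter> X2)"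
      using bd_Un[of "Y - X2" "Y \<inter> X2" ?S] f by (metis Diff_disjoint Un_Diff_Int finite_Diff finite_Int
          Int_Diff Int_commute Int_empty_right)
    also have "\<dots> = bd G (Y - X2) \<oplus> bd G (Y \<inter> X2)"
      using bd_switch(1)[OF G D(10) Diff_disjoint', where a = u1 and b = u2]
        bd_switch(2)[OF G D(10) Int_lower2, where a = u1 and b = u2] fixed
      by simp
    also have "\<dots> = {}" using bd_split[OF G Y, of X2] by simp
    finally show "Y \<in> evens ?S" using YE unfolding evens_def by simp
  qed
  show "evens K = evens G" using sub[OF F s] sub[OF FK sK] unfolding sw K_def[symmetric] by blast
qed

lemma whitney_switching_facts:
  assumes "full_mgraph G" "whitney_switching G K"
  shows "full_mgraph K" "evens K = evens G" "whitney_switching K G" "medges K = medges G" "mverts K = mverts G"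
proof -
  obtain X1 X2 u1 u2 where s: "two_sep G X1 X2 u1 u2" "K = switch G X2 u1 u2"
    using assms whitney_switching_iff by blast
  note f = switch_facts[OF assms(1) s(1), folded s(2)]
  show "full_mgraph K" "evens K = evens G" using f by auto
  show "whitney_switching K G" using whitney_switching_iff[OF f(3)] f(4,5) by blast
  show "medges K = medges G" "mverts K = mverts G" unfolding s(2) by auto
qed

lemma switchings_facts:
  assumes "whitney_switching\<^sup>*\<^sup>* G K" "full_mgraph G"
  shows "full_mgraph K \<and> evens K = evens G \<and> whitney_switching\<^sup>*\<^sup>* K G \<and> medges K = medges G \<and> mverts K = mverts G"
  using assms
proof (induction rule: rtranclp_induct)
  case (step K L)
  then show ?case using whitney_switching_facts[of K L] by (metis converse_rtranclp_into_rtranclp)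
qed simp

lemma mgraph_iso_refl: "mgraph_iso G G"
  unfolding mgraph_iso_def by (auto intro!: exI[of _ id])

lemma mgraph_iso_trans:
  assumes "mgraph_iso G H" "mgraph_iso H K"
  shows "mgraph_iso G K"
proof -
  obtain f where f: "bij_betw f (mverts G) (mverts H)" "\<And>e. e \<in> medges G \<Longrightarrow> mends H e = f ` mends G e"
    "medges H = medges G" using assms(1) unfolding mgraph_iso_def by blast
  obtain g where g: "bij_betw g (mverts H) (mverts K)" "\<And>e. e \<in> medges H \<Longrightarrow> mends K e = g ` mends H e"
    "medges K = medges H" using assms(2) unfolding mgraph_iso_def by blast
  have "bij_betw (g \<circ> f) (mverts G) (mverts K)" using bij_betw_trans[OF f(1) g(1)] .
  moreover have "mends K e = (g \<circ> f) ` mends G e" if "e \<in> medges G" for e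
    using f(2,3) g(2) that by (simp add: image_comp)
  ultimately show ?thesis unfolding mgraph_iso_def using f(3) g(3) by auto
qed

lemma mgraph_iso_sym:
  assumes "multigraph G" "mgraph_iso G H"
  shows "mgraph_iso H G"
proof -
  obtain f where f: "bij_betw f (mverts G) (mverts H)" "\<And>e. e \<in> medges G \<Longrightarrow> mends H e = f ` mends G e"
    "medges H = medges G" using assms(2) unfolding mgraph_iso_def by blast
  let ?g = "inv_into (mverts G) f"
  have "bij_betw ?g (mverts H) (mverts G)" using bij_betw_inv_into[OF f(1)] .
  moreover have "mends G e = ?g ` mends H e" if "e \<in> medges H" for e
  proof -
    have "e \<in> medges G" using that f(3) by simp
    then have "mends G e \<subseteq> mverts G" "mends H e = f ` mends G e" using multigraphD(3)[OF assms(1)] f(2) by auto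
    then show ?thesis using inv_into_image_cancel[OF bij_betw_imp_inj_on[OF f(1)]] by simp
  qed
  ultimately show ?thesis unfolding mgraph_iso_def using f(3) by auto
qed

lemma edge_verts_iso:
  assumes "\<And>e. e \<in> X \<Longrightarrow> mends H e = f ` mends G e"
  shows "edge_verts H X = f ` edge_verts G X"
  unfolding edge_verts_def image_UN using assms by simp

lemma whitney_switching_transport:
  assumes G: "full_mgraph G" and H: "full_mgraph H" and iso: "mgraph_iso G H" and w: "whitney_switching G G'"
  shows "\<exists>H'. whitney_switching H H' \<and> mgraph_iso G' H'"
proof -
  obtain X1 X2 u1 u2 where s: "two_sep G X1 X2 u1 u2" and G': "G' = switch G X2 u1 u2"
    using w whitney_switching_iff[OF G] by blast
  note D = two_sepD[OF s] and mG = full_mgraphD(1)[OF G] and mH = full_mgraphD(1)[OF H]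
  obtain f where f: "bij_betw f (mverts G) (mverts H)" "\<And>e. e \<in> medges G \<Longrightarrow> mends H e = f ` mends G e"
    and E: "medges H = medges G" using iso unfolding mgraph_iso_def by blast
  have inj: "inj_on f (mverts G)" using bij_betw_imp_inj_on[OF f(1)] .
  have ev: "edge_verts H X = f ` edge_verts G X" if "X \<subseteq> medges G" for X
    by (rule edge_verts_iso) (use f(2) that in blast)
  have V: "edge_verts G X \<subseteq> mverts G" for X using edge_verts_subset[OF mG] .
  have "edge_verts H X1 \<inter> edge_verts H X2 = {f u1, f u2}"
    unfolding ev[OF D(9)] ev[OF D(10)] inj_on_image_Int[OF inj V V, symmetric] D(4) by simp
  moreover have uV: "u1 \<in> mverts G" "u2 \<in> mverts G" using D(5,7) V by blast+
  then have "f u1 \<noteq> f u2" using inj D(3) by (meson inj_onD)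
  ultimately have sH: "two_sep H X1 X2 (f u1) (f u2)" using D(1,2) unfolding two_sep_def E by simp
  let ?H' = "switch H X2 (f u1) (f u2)"
  have comm: "f (vswap u1 u2 x) = vswap (f u1) (f u2) (f x)" if "x \<in> mverts G" for x
    using inj uV that by (cases "x = u1"; cases "x = u2") (auto simp: inj_on_eq_iff)
  have "mends ?H' e = f ` mends G' e" if e: "e \<in> medges G" for e
  proof (cases "e \<in> X2")
    case True
    have "mends ?H' e = vswap (f u1) (f u2) ` f ` mends G e" using True D(10) E f(2)[OF e] by simp
    also have "\<dots> = f ` vswap u1 u2 ` mends G e"
      unfolding image_image using comm multigraphD(3)[OF mG e] by (intro image_cong) auto
    finally show ?thesis unfolding G' using True D(10) by simp
  next
    case False
    then show ?thesis unfolding G' using switch_ends_other[OF mG False] switch_ends_other[OF mH False] f(2)[OF e] by simp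
  qed
  then have "mgraph_iso G' ?H'" unfolding mgraph_iso_def using f(1) E unfolding G' by auto
  then show ?thesis using whitney_switching_iff[OF H] sH by blast
qed

lemma switchings_transport:
  assumes "whitney_switching\<^sup>*\<^sup>* G G'" "full_mgraph G" "full_mgraph H" "mgraph_iso G H"
  shows "\<exists>H'. whitney_switching\<^sup>*\<^sup>* H H' \<and> mgraph_iso G' H'"
  using assms
proof (induction rule: rtranclp_induct)
  case base
  then show ?case by blast
next
  case (step K L)
  then obtain H' where H': "whitney_switching\<^sup>*\<^sup>* H H'" "mgraph_iso K H'" by blast
  have "full_mgraph K" "full_mgraph H'" using switchings_facts step.hyps(1) step.prems H'(1) by blast+
  then obtain L' where "whitney_switching H' L'" "mgraph_iso L L'"
    using whitney_switching_transport[OF _ _ H'(2) step.hyps(2)] by blast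
  then show ?case using H'(1) by (meson rtranclp.rtrancl_into_rtrancl)
qed

section \<open>Splitting a graph at a 2-separation\<close>

definition part :: "('v, 'e) mgraph \<Rightarrow> 'e set \<Rightarrow> 'e \<Rightarrow> 'v \<Rightarrow> 'v \<Rightarrow> ('v, 'e) mgraph" where
  \<comment> \<open>The edge \<open>m\<close> stands for the other side of a 2-separation with attachments \<open>a\<close> and \<open>b\<close>.\<close>
  "part G X m a b = make_mgraph (edge_verts G X) (insert m X) ((mends G)(m := {a, b}))"

lemma part_sel [simp]:
  "mverts (part G X m a b) = edge_verts G X" "medges (part G X m a b) = insert m X"
  "mends (part G X m a b) m = {a, b}"
  "e \<in> X \<Longrightarrow> m \<notin> X \<Longrightarrow> mends (part G X m a b) e = mends G e"
  unfolding part_def by auto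

lemma multigraph_part:
  assumes "multigraph G" "X \<subseteq> medges G" "a \<in> edge_verts G X" "b \<in> edge_verts G X" "m \<notin> X"
  shows "multigraph (part G X m a b)"
  unfolding multigraph_def
proof (intro conjI ballI allI impI)
  show "finite (mverts (part G X m a b))"
    using edge_verts_subset[OF assms(1)] multigraphD(1)[OF assms(1)] finite_subset by fastforce
  show "finite (medges (part G X m a b))"
    using finite_subset[OF assms(2) multigraphD(2)[OF assms(1)]] by simp
  fix e assume e: "e \<in> medges (part G X m a b)"
  show "mends (part G X m a b) e \<subseteq> mverts (part G X m a b)"
  proof (cases "e = m")
    case False
    then have "e \<in> X" using e by simp
    then show ?thesis using assms(5) by (auto intro: edge_vertsI)
  qed (use assms(3,4) in simp)
  show "card (mends (part G X m a b) e) \<in> {1, 2}"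
  proof (cases "e = m")
    case False
    then have "e \<in> X" using e by simp
    then show ?thesis using assms(2,5) multigraphD(4)[OF assms(1), of e] by auto
  qed (auto simp: card_insert_if)
next
  fix e assume "e \<notin> medges (part G X m a b)"
  then show "mends (part G X m a b) e = {}" unfolding part_def by simp
qed

lemma edge_verts_part:
  assumes "m \<notin> X" "Y \<subseteq> X"
  shows "edge_verts (part G X m a b) Y = edge_verts G Y"
    "edge_verts (part G X m a b) (insert m Y) = {a, b} \<union> edge_verts G Y"
proof -
  show *: "edge_verts (part G X m a b) Y = edge_verts G Y"
    by (rule edge_verts_cong) (use assms in \<open>auto simp: subset_iff\<close>)
  show "edge_verts (part G X m a b) (insert m Y) = {a, b} \<union> edge_verts G Y"
    unfolding edge_verts_insert * by simp
qed

lemma bd_part: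
  assumes "m \<notin> X" "Y \<subseteq> X" "finite X"
  shows "bd (part G X m a b) Y = bd G Y"
    "bd (part G X m a b) (insert m Y) = bd G Y \<oplus> ({a} \<oplus> {b})"
proof -
  show *: "bd (part G X m a b) Y = bd G Y"
    by (rule bd_cong) (use assms in \<open>auto simp: subset_iff\<close>)
  have 1: "finite Y" "m \<notin> Y" using assms finite_subset by auto
  have 2: "mends (part G X m a b) m = {a, b}" by simp
  show "bd (part G X m a b) (insert m Y) = bd G Y \<oplus> ({a} \<oplus> {b})"
    unfolding bd_insert[OF 1] * bd_single_pair[where G = "part G X m a b", OF 2] ..
qed

lemma full_part:
  assumes "full_mgraph G" "two_sep G X1 X2 u1 u2" "m \<in> X2"
  shows "full_mgraph (part G X1 m u1 u2)"
proof -
  note D = two_sepD[OF assms(2)]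
  have m: "m \<notin> X1" using D(2) assms(3) by blast
  have "multigraph (part G X1 m u1 u2)"
    by (rule multigraph_part[OF full_mgraphD(1)[OF assms(1)] D(9,5,7) m])
  then show ?thesis unfolding full_mgraph_def using edge_verts_part(2)[OF m order.refl, of G u1 u2] D(5,7) by auto
qed

text \<open>A switching of one part is a switching of the whole graph in which the other part
  moves along with the edge standing for it.\<close>

lemma lift_switching:
  assumes F: "full_mgraph G" and s: "two_sep G X1 X2 u1 u2" and m: "m \<in> X2"
    and w: "whitney_switching (part G X1 m u1 u2) H1"
  shows "\<exists>K k1 k2. whitney_switching G K \<and> two_sep K X1 X2 k1 k2 \<and> part K X1 m k1 k2 = H1 \<and>
    (\<forall>m1\<in>X1. mgraph_iso (part G X2 m1 u1 u2) (part K X2 m1 k1 k2))"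
proof -
  note G = full_mgraphD(1)[OF F] and D = two_sepD[OF s]
  let ?P = "part G X1 m u1 u2"
  have FP: "full_mgraph ?P" using full_part[OF F s m] .
  have mX1: "m \<notin> X1" using D(2) m by blast
  obtain Y1 Y2 y1 y2 where t: "two_sep ?P Y1 Y2 y1 y2" and H1: "H1 = switch ?P Y2 y1 y2"
    using w whitney_switching_iff[OF FP] by blast
  note T = two_sepD[OF t]
  have YE: "Y1 \<union> Y2 = insert m X1" using T(1) by simp
  \<comment> \<open>The edge \<open>m\<close> is expanded to the side \<open>X2\<close> that it
    stands for.\<close>
  define Z1 Z2 where "Z1 = (if m \<in> Y1 then Y1 - {m} \<union> X2 else Y1)"
    and "Z2 = (if m \<in> Y2 then Y2 - {m} \<union> X2 else Y2)"
  let ?\<tau> = "vswap y1 y2"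
  have ZE: "Z1 \<union> Z2 = medges G" "Z1 \<inter> Z2 = {}"
    unfolding Z1_def Z2_def using YE T(2) D(1,2) mX1 m by auto
  have VP: "edge_verts ?P Y = edge_verts G (Y - {m}) \<union> (if m \<in> Y then {u1, u2} else {})" if "Y \<subseteq> insert m X1" for Y
  proof (cases "m \<in> Y")
    case True
    then have "Y = insert m (Y - {m})" by blast
    then show ?thesis using edge_verts_part(2)[OF mX1, of "Y - {m}" G u1 u2] that True by auto
  next
    case False
    then show ?thesis using edge_verts_part(1)[OF mX1, of Y G u1 u2] that by auto
  qed
  have VX: "edge_verts G (Y - {m}) \<inter> edge_verts G X2 \<subseteq> {u1, u2}" if "Y \<subseteq> insert m X1" for Y
    using edge_verts_mono[of "Y - {m}" X1 G] that D(4) by blast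
  have Ysub: "Y1 \<subseteq> insert m X1" "Y2 \<subseteq> insert m X1" using YE by blast+
  have m12: "m \<in> Y1 \<and> m \<notin> Y2 \<or> m \<in> Y2 \<and> m \<notin> Y1" using YE T(2) by blast
  have interV: "edge_verts G Z1 \<inter> edge_verts G Z2 = {y1, y2}"
  proof -
    have "edge_verts G Z1 \<inter> edge_verts G Z2 = edge_verts ?P Y1 \<inter> edge_verts ?P Y2"
      using m12
    proof
      assume c: "m \<in> Y1 \<and> m \<notin> Y2"
      then have "Y2 - {m} = Y2" by blast
      then show ?thesis unfolding VP[OF Ysub(1)] VP[OF Ysub(2)] Z1_def Z2_def
        using c VX[OF Ysub(2)] D(6,8) by (auto simp: edge_verts_Un)
    next
      assume c: "m \<in> Y2 \<and> m \<notin> Y1"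
      then have "Y1 - {m} = Y1" by blast
      then show ?thesis unfolding VP[OF Ysub(1)] VP[OF Ysub(2)] Z1_def Z2_def
        using c VX[OF Ysub(1)] D(6,8) by (auto simp: edge_verts_Un)
    qed
    then show ?thesis using T(4) by simp
  qed
  have tG: "two_sep G Z1 Z2 y1 y2" unfolding two_sep_def using ZE T(3) interV by blast
  define K where "K = switch G Z2 y1 y2"
  have wK: "whitney_switching G K" unfolding whitney_switching_iff[OF F] K_def using tG by blast
  note TG = two_sepD[OF tG]
  have yV: "y1 \<in> edge_verts G X1" "y2 \<in> edge_verts G X1"
    using T(5,7) edge_verts_subset[OF full_mgraphD(1)[OF FP], of Y1] by auto
  have KendsX1: "mends K e = mends H1 e" if e: "e \<in> X1" for e
  proof -
    have em: "e \<noteq> m" using e mX1 by blast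
    show ?thesis
    proof (cases "e \<in> Y2")
      case True
      then have "e \<in> Z2" unfolding Z2_def using em by simp
      then have "mends K e = ?\<tau> ` mends G e" unfolding K_def using TG(10) by simp
      moreover have "mends H1 e = ?\<tau> ` mends G e" unfolding H1 using True T(10) e mX1 by simp
      ultimately show ?thesis by simp
    next
      case False
      then have "e \<notin> Z2" unfolding Z2_def using e D(2) by auto
      then show ?thesis unfolding K_def H1 using switch_ends_other[OF G]
          switch_ends_other[OF full_mgraphD(1)[OF FP] False] e mX1 by simp
    qed
  qed
  note fH1 = whitney_switching_facts[OF FP w]
  have VH1: "mverts H1 = edge_verts G X1" "medges H1 = insert m X1" using fH1(4,5) by auto
  \<comment> \<open>The side \<open>X2\<close> moves exactly if \<open>m\<close> does, and it moves
    as a whole; \<open>\<sigma>\<close> is the isomorphism between its old and new position.\<close>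
  define \<sigma> where "\<sigma> = (if m \<in> Y2 then ?\<tau> else id)"
  have \<sigma>inj: "inj \<sigma>" unfolding \<sigma>_def using inj_vswap by auto
  have KendsX2: "mends K e = \<sigma> ` mends G e" if e: "e \<in> X2" for e
  proof (cases "m \<in> Y2")
    case True
    then have "e \<in> Z2" unfolding Z2_def using e by simp
    then show ?thesis unfolding K_def \<sigma>_def using TG(10) True by simp
  next
    case False
    then have "e \<notin> Z2" unfolding Z2_def using e D(2) m YE by auto
    then show ?thesis unfolding K_def \<sigma>_def using switch_ends_other[OF G] False by simp
  qed
  have VKX2: "edge_verts K X2 = \<sigma> ` edge_verts G X2" by (rule edge_verts_iso) (rule KendsX2)
  have mH1: "mends H1 m = \<sigma> ` {u1, u2}"
  proof (cases "m \<in> Y2")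
    case True
    then show ?thesis unfolding H1 \<sigma>_def using T(10) by simp
  next
    case False
    then show ?thesis unfolding H1 \<sigma>_def using switch_ends_other[OF full_mgraphD(1)[OF FP] False] by simp
  qed
  have VKX1: "edge_verts K X1 = edge_verts G X1"
  proof -
    have split: "edge_verts G X1 = edge_verts G (X1 \<inter> Z1) \<union> edge_verts G (X1 \<inter> Z2)"
      using D(9) ZE(1) edge_verts_Un[of G "X1 \<inter> Z1" "X1 \<inter> Z2"] by (metis Int_Un_distrib Int_absorb2)
    have splitK: "edge_verts K X1 = edge_verts K (X1 \<inter> Z1) \<union> edge_verts K (X1 \<inter> Z2)"
      using D(9) ZE(1) edge_verts_Un[of K "X1 \<inter> Z1" "X1 \<inter> Z2"] by (metis Int_Un_distrib Int_absorb2)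
    have 1: "edge_verts K (X1 \<inter> Z1) = edge_verts G (X1 \<inter> Z1)"
      unfolding K_def by (rule edge_verts_switch(1)[OF G TG(10)]) (use ZE(2) in blast)
    have 2: "edge_verts K (X1 \<inter> Z2) = ?\<tau> ` edge_verts G (X1 \<inter> Z2)"
      unfolding K_def by (rule edge_verts_switch(2)[OF G TG(10)]) blast
    have \<tau>V: "?\<tau> ` edge_verts G X1 = edge_verts G X1" by (rule vswap_fixes[OF yV])
    show ?thesis
    proof (cases "m \<in> Y2")
      case False
      then have "X1 \<inter> Z2 = Y2" unfolding Z2_def using Ysub by auto
      moreover have "edge_verts ?P Y2 = edge_verts G Y2" using VP[OF Ysub(2)] False by simp
      ultimately have "?\<tau> ` edge_verts G (X1 \<inter> Z2) = edge_verts G (X1 \<inter> Z2)"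
        using T(6,8) by (metis vswap_fixes)
      then show ?thesis using split splitK 1 2 by simp
    next
      case True
      then have "X1 \<inter> Z1 = Y1" unfolding Z1_def using Ysub m12 by auto
      moreover have "edge_verts ?P Y1 = edge_verts G Y1" using VP[OF Ysub(1)] True m12 by simp
      ultimately have "?\<tau> ` edge_verts G (X1 \<inter> Z1) = edge_verts G (X1 \<inter> Z1)"
        using T(5,7) by (metis vswap_fixes)
      then have "edge_verts K X1 = ?\<tau> ` edge_verts G X1" using split splitK 1 2 by (simp add: image_Un)
      then show ?thesis using \<tau>V by simp
    qed
  qed
  have \<sigma>V: "\<sigma> ` edge_verts G X1 = edge_verts G X1" unfolding \<sigma>_def using vswap_fixes[OF yV] by simp
  have "edge_verts K X1 \<inter> edge_verts K X2 = \<sigma> ` (edge_verts G X1 \<inter> edge_verts G X2)"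
    unfolding VKX1 VKX2 image_Int[OF \<sigma>inj] \<sigma>V ..
  then have "edge_verts K X1 \<inter> edge_verts K X2 = {\<sigma> u1, \<sigma> u2}" unfolding D(4) by simp
  moreover have "\<sigma> u1 \<noteq> \<sigma> u2" using \<sigma>inj D(3) by (meson injD)
  ultimately have sK: "two_sep K X1 X2 (\<sigma> u1) (\<sigma> u2)"
    using D(1,2) unfolding two_sep_def K_def by simp
  have FK: "full_mgraph K" using whitney_switching_facts(1)[OF F wK] .
  have "part K X1 m (\<sigma> u1) (\<sigma> u2) = H1"
  proof (rule mgraph_eqI)
    show "multigraph (part K X1 m (\<sigma> u1) (\<sigma> u2))" using full_part[OF FK sK m] full_mgraphD(1) by blast
    show "multigraph H1" using fH1(1) full_mgraphD(1) by blast
    show "mverts (part K X1 m (\<sigma> u1) (\<sigma> u2)) = mverts H1" using VH1 VKX1 by simp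
    show "medges (part K X1 m (\<sigma> u1) (\<sigma> u2)) = medges H1" using VH1 by simp
    fix e assume "e \<in> medges (part K X1 m (\<sigma> u1) (\<sigma> u2))"
    then consider "e = m" | "e \<in> X1" by auto
    then show "mends (part K X1 m (\<sigma> u1) (\<sigma> u2)) e = mends H1 e"
      by cases (use mH1 KendsX1 mX1 in auto)
  qed
  moreover have "mgraph_iso (part G X2 m1 u1 u2) (part K X2 m1 (\<sigma> u1) (\<sigma> u2))" if "m1 \<in> X1" for m1
  proof -
    have m1: "m1 \<notin> X2" using that D(2) by blast
    have "bij_betw \<sigma> (edge_verts G X2) (edge_verts K X2)"
      unfolding VKX2 bij_betw_def using inj_on_subset[OF \<sigma>inj] by blast
    moreover have "mends (part K X2 m1 (\<sigma> u1) (\<sigma> u2)) e = \<sigma> ` mends (part G X2 m1 u1 u2) e"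
      if "e \<in> insert m1 X2" for e
      using that KendsX2 m1 by auto
    ultimately show ?thesis unfolding mgraph_iso_def by auto
  qed
  ultimately show ?thesis using wK sK by blast
qed

text \<open>Switching one part changes the other only by an isomorphism. Carrying this along allows
  the second part to be treated afterwards.\<close>

lemma lift_switchings:
  assumes w: "whitney_switching\<^sup>*\<^sup>* (part G X1 m u1 u2) H1"
    and F: "full_mgraph G" and s: "two_sep G X1 X2 u1 u2" and m: "m \<in> X2"
  shows "\<exists>K k1 k2. whitney_switching\<^sup>*\<^sup>* G K \<and> two_sep K X1 X2 k1 k2 \<and> part K X1 m k1 k2 = H1 \<and>
    (\<forall>m1\<in>X1. mgraph_iso (part G X2 m1 u1 u2) (part K X2 m1 k1 k2))"
  using w
proof (induction rule: rtranclp_induct)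
  case base
  then show ?case using s mgraph_iso_refl by blast
next
  case (step H H')
  then obtain K k1 k2 where K: "whitney_switching\<^sup>*\<^sup>* G K" "two_sep K X1 X2 k1 k2" "part K X1 m k1 k2 = H"
    "\<forall>m1\<in>X1. mgraph_iso (part G X2 m1 u1 u2) (part K X2 m1 k1 k2)" by blast
  have FK: "full_mgraph K" using switchings_facts[OF K(1) F] by blast
  have "whitney_switching (part K X1 m k1 k2) H'" using step.hyps(2) K(3) by simp
  then obtain L l1 l2 where L: "whitney_switching K L" "two_sep L X1 X2 l1 l2" "part L X1 m l1 l2 = H'"
    "\<forall>m1\<in>X1. mgraph_iso (part K X2 m1 k1 k2) (part L X2 m1 l1 l2)"
    using lift_switching[OF FK K(2) m] by blast
  have "whitney_switching\<^sup>*\<^sup>* G L" using K(1) L(1) by (rule rtranclp.rtrancl_into_rtrancl)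
  moreover have "\<forall>m1\<in>X1. mgraph_iso (part G X2 m1 u1 u2) (part L X2 m1 l1 l2)"
    using K(4) L(4) mgraph_iso_trans by blast
  ultimately show ?case using L(2,3) by blast
qed

text \<open>Isomorphisms of the sides that agree on the attachments have a common extension. It is
  injective across the sides because a common image is an attachment of \<open>H\<close>, hence the
  image of \<open>k1\<close> or \<open>k2\<close>.\<close>

lemma glue_parts:
  assumes K: "full_mgraph K" and H: "full_mgraph H"
    and sK: "two_sep K X1 X2 k1 k2" and sH: "two_sep H X1 X2 w1 w2"
    and f1: "bij_betw f1 (edge_verts K X1) (edge_verts H X1)" "\<And>e. e \<in> X1 \<Longrightarrow> mends H e = f1 ` mends K e"
    and f2: "bij_betw f2 (edge_verts K X2) (edge_verts H X2)" "\<And>e. e \<in> X2 \<Longrightarrow> mends H e = f2 ` mends K e"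
    and im: "f1 ` {k1, k2} = {w1, w2}" and agree: "f1 k1 = f2 k1" "f1 k2 = f2 k2"
  shows "mgraph_iso K H"
proof -
  note DK = two_sepD[OF sK] and DH = two_sepD[OF sH]
  define f where "f x = (if x \<in> edge_verts K X1 then f1 x else f2 x)" for x
  have fX1: "f x = f1 x" if "x \<in> edge_verts K X1" for x using that unfolding f_def by simp
  have fX2: "f x = f2 x" if "x \<in> edge_verts K X2" for x
  proof (cases "x \<in> edge_verts K X1")
    case True
    then have "x = k1 \<or> x = k2" using that DK(4) by blast
    then show ?thesis using agree fX1[OF True] by auto
  qed (simp add: f_def)
  have VK: "mverts K = edge_verts K X1 \<union> edge_verts K X2"
    using full_mgraphD(2)[OF K] DK(1) edge_verts_Un by metis
  have VH: "mverts H = edge_verts H X1 \<union> edge_verts H X2"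
    using full_mgraphD(2)[OF H] DH(1) edge_verts_Un by metis
  have im1: "f ` edge_verts K X1 = edge_verts H X1"
    using bij_betw_imp_surj_on[OF f1(1)] fX1 by (metis image_cong)
  have im2: "f ` edge_verts K X2 = edge_verts H X2"
    using bij_betw_imp_surj_on[OF f2(1)] fX2 by (metis image_cong)
  have inj1: "inj_on f (edge_verts K X1)"
    using bij_betw_imp_inj_on[OF f1(1)] fX1 by (metis inj_on_cong)
  have inj2: "inj_on f (edge_verts K X2)"
    using bij_betw_imp_inj_on[OF f2(1)] fX2 by (metis inj_on_cong)
  have cross: "x = y" if x: "x \<in> edge_verts K X1" and y: "y \<in> edge_verts K X2" and eq: "f x = f y" for x y
  proof -
    have "f x \<in> edge_verts H X1 \<inter> edge_verts H X2" using im1 im2 x y eq by blast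
    then have "f x \<in> f1 ` {k1, k2}" using DH(4) im by simp
    then obtain k where k: "k = k1 \<or> k = k2" "f x = f1 k" by blast
    have kV: "k \<in> edge_verts K X1" "k \<in> edge_verts K X2" using k(1) DK(5-8) by blast+
    have "f x = f k" using k(2) fX1[OF kV(1)] by simp
    then have "x = k" "y = k" using inj_onD[OF inj1 _ x kV(1)] inj_onD[OF inj2 _ y kV(2)] eq by auto
    then show ?thesis by simp
  qed
  have "inj_on f (mverts K)" unfolding VK
  proof (rule inj_onI)
    fix x y assume "x \<in> edge_verts K X1 \<union> edge_verts K X2" "y \<in> edge_verts K X1 \<union> edge_verts K X2" "f x = f y"
    then show "x = y" using inj_onD[OF inj1] inj_onD[OF inj2] cross[of x y] cross[of y x] by (elim UnE) auto
  qed
  then have "bij_betw f (mverts K) (mverts H)"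
    unfolding bij_betw_def VK VH image_Un im1 im2 by simp
  moreover have "mends H e = f ` mends K e" if e: "e \<in> medges K" for e
  proof -
    have "e \<in> X1 \<or> e \<in> X2" using e DK(1) by blast
    then show ?thesis
    proof
      assume e1: "e \<in> X1"
      have "f1 ` mends K e = f ` mends K e"
        by (rule image_cong) (use fX1 edge_vertsI[OF e1, where G = K] in auto)
      then show ?thesis using f1(2)[OF e1] by simp
    next
      assume e2: "e \<in> X2"
      have "f2 ` mends K e = f ` mends K e"
        by (rule image_cong) (use fX2 edge_vertsI[OF e2, where G = K] in auto)
      then show ?thesis using f2(2)[OF e2] by simp
    qed
  qed
  ultimately show ?thesis unfolding mgraph_iso_def using DK(1) DH(1) by auto
qed

lemma part_isoE:
  assumes "mgraph_iso (part K X m k1 k2) (part H X m w1 w2)" "m \<notin> X"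
  obtains f where "bij_betw f (edge_verts K X) (edge_verts H X)" "\<And>e. e \<in> X \<Longrightarrow> mends H e = f ` mends K e"
    "f ` {k1, k2} = {w1, w2}"
proof -
  obtain f where f: "bij_betw f (edge_verts K X) (edge_verts H X)"
    "\<forall>e\<in>insert m X. mends (part H X m w1 w2) e = f ` mends (part K X m k1 k2) e"
    using assms(1) unfolding mgraph_iso_def by auto
  have "mends H e = f ` mends K e" if "e \<in> X" for e using f(2)[rule_format, of e] that assms(2) by auto
  moreover have "f ` {k1, k2} = {w1, w2}" using f(2)[rule_format, of m] by auto
  ultimately show ?thesis using that f(1) by blast
qed

text \<open>The parts are switched one after the other. The resulting isomorphisms of the parts may
  match the attachments in opposite orders; one more switching, along the 2-separation itself,
  repairs this.\<close>

theorem switchings_from_parts: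
  assumes F: "full_mgraph G" and F': "full_mgraph G'"
    and s: "two_sep G X1 X2 u1 u2" and s': "two_sep G' X1 X2 w1 w2"
    and m1: "m1 \<in> X1" and m2: "m2 \<in> X2"
    and w1: "\<exists>H. whitney_switching\<^sup>*\<^sup>* (part G X1 m2 u1 u2) H \<and> mgraph_iso H (part G' X1 m2 w1 w2)"
    and w2: "\<exists>H. whitney_switching\<^sup>*\<^sup>* (part G X2 m1 u1 u2) H \<and> mgraph_iso H (part G' X2 m1 w1 w2)"
  shows "\<exists>K. whitney_switching\<^sup>*\<^sup>* G K \<and> mgraph_iso K G'"
proof -
  note D = two_sepD[OF s]
  have m: "m1 \<notin> X2" "m2 \<notin> X1" using D(2) m1 m2 by blast+
  obtain H1 where H1: "whitney_switching\<^sup>*\<^sup>* (part G X1 m2 u1 u2) H1" "mgraph_iso H1 (part G' X1 m2 w1 w2)"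
    using w1 by blast
  obtain H2 where H2: "whitney_switching\<^sup>*\<^sup>* (part G X2 m1 u1 u2) H2" "mgraph_iso H2 (part G' X2 m1 w1 w2)"
    using w2 by blast
  obtain K k1 k2 where K: "whitney_switching\<^sup>*\<^sup>* G K" "two_sep K X1 X2 k1 k2" "part K X1 m2 k1 k2 = H1"
    "\<forall>m1\<in>X1. mgraph_iso (part G X2 m1 u1 u2) (part K X2 m1 k1 k2)"
    using lift_switchings[OF H1(1) F s m2] by blast
  have FK: "full_mgraph K" using switchings_facts[OF K(1) F] by blast
  have i2: "mgraph_iso (part G X2 m1 u1 u2) (part K X2 m1 k1 k2)" using K(4) m1 by blast
  have fp: "full_mgraph (part G X2 m1 u1 u2)" "full_mgraph (part K X2 m1 k1 k2)"
    using full_part[OF F two_sep_commute[OF s] m1] full_part[OF FK two_sep_commute[OF K(2)] m1] by auto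
  obtain H2' where H2': "whitney_switching\<^sup>*\<^sup>* (part K X2 m1 k1 k2) H2'" "mgraph_iso H2 H2'"
    using switchings_transport[OF H2(1) fp i2] by blast
  obtain L l1 l2 where L: "whitney_switching\<^sup>*\<^sup>* K L" "two_sep L X2 X1 l1 l2" "part L X2 m1 l1 l2 = H2'"
    "\<forall>m2\<in>X2. mgraph_iso (part K X1 m2 k1 k2) (part L X1 m2 l1 l2)"
    using lift_switchings[OF H2'(1) FK two_sep_commute[OF K(2)] m1] by blast
  have FL: "full_mgraph L" using switchings_facts[OF L(1) FK] by blast
  have sL: "two_sep L X1 X2 l1 l2" using two_sep_commute[OF L(2)] .
  have GL: "whitney_switching\<^sup>*\<^sup>* G L" using K(1) L(1) by simp
  have mH: "multigraph H1" "multigraph H2"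
    using switchings_facts[OF H1(1) full_part[OF F s m2]] switchings_facts[OF H2(1) fp(1)] full_mgraphD(1) by blast+
  have mp: "multigraph (part L X1 m2 l1 l2)" "multigraph (part K X1 m2 k1 k2)"
    using full_part[OF FL sL m2] full_part[OF FK K(2) m2] full_mgraphD(1) by blast+
  have "mgraph_iso (part K X1 m2 k1 k2) (part L X1 m2 l1 l2)" using L(4) m2 by blast
  then have "mgraph_iso (part L X1 m2 l1 l2) (part K X1 m2 k1 k2)" by (rule mgraph_iso_sym[OF mp(2)])
  then have iso1: "mgraph_iso (part L X1 m2 l1 l2) (part G' X1 m2 w1 w2)"
    using K(3) H1(2) mgraph_iso_trans by metis
  have iso2: "mgraph_iso (part L X2 m1 l1 l2) (part G' X2 m1 w1 w2)"
    using L(3) mgraph_iso_trans[OF mgraph_iso_sym[OF mH(2) H2'(2)] H2(2)] by simp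
  obtain f1 where f1: "bij_betw f1 (edge_verts L X1) (edge_verts G' X1)" "\<And>e. e \<in> X1 \<Longrightarrow> mends G' e = f1 ` mends L e"
    "f1 ` {l1, l2} = {w1, w2}" using part_isoE[OF iso1 m(2)] by blast
  obtain f2 where f2: "bij_betw f2 (edge_verts L X2) (edge_verts G' X2)" "\<And>e. e \<in> X2 \<Longrightarrow> mends G' e = f2 ` mends L e"
    "f2 ` {l1, l2} = {w1, w2}" using part_isoE[OF iso2 m(1)] by blast
  note DL = two_sepD[OF sL]
  consider "f1 l1 = f2 l1" "f1 l2 = f2 l2" | "f1 l1 = f2 l2" "f1 l2 = f2 l1"
    using f1(3) f2(3) two_sepD(3)[OF s'] by (auto simp: doubleton_eq_iff)
  then show ?thesis
  proof cases
    case 1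
    have "mgraph_iso L G'" by (rule glue_parts[OF FL F' sL s' f1(1,2) f2(1,2) f1(3) 1])
    then show ?thesis using GL by blast
  next
    case 2
    define M where "M = switch L X2 l1 l2"
    note fM = switch_facts[OF FL sL, folded M_def] and mL = full_mgraphD(1)[OF FL]
    have "whitney_switching L M" unfolding whitney_switching_iff[OF FL] M_def using sL by blast
    then have GM: "whitney_switching\<^sup>*\<^sup>* G M" using GL by simp
    let ?g = "f2 \<circ> vswap l1 l2"
    have "bij_betw (vswap l1 l2) (edge_verts L X2) (edge_verts L X2)"
      by (simp add: bij_betw_def vswap_fixes[OF DL(6,8)] inj_on_subset[OF inj_vswap])
    then have g1: "bij_betw ?g (edge_verts M X2) (edge_verts G' X2)"
      unfolding fM(2) using f2(1) bij_betw_trans by blast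
    have g2: "mends G' e = ?g ` mends M e" if "e \<in> X2" for e
    proof -
      have "mends M e = vswap l1 l2 ` mends L e" unfolding M_def using that DL(10) by simp
      then have "?g ` mends M e = f2 ` mends L e" by (simp only: image_comp[symmetric] vswap_image_image)
      then show ?thesis using f2(2)[OF that] by simp
    qed
    have "mgraph_iso M G'"
    proof (rule glue_parts[OF fM(3) F' fM(4) s' _ _ g1 g2 f1(3)])
      show "bij_betw f1 (edge_verts M X1) (edge_verts G' X1)" using f1(1) fM(1) by simp
      show "mends G' e = f1 ` mends M e" if "e \<in> X1" for e
      proof -
        have "e \<notin> X2" using that DL(2) by blast
        then show ?thesis unfolding M_def using switch_ends_other[OF mL] f1(2)[OF that] by simp
      qed
      show "f1 l1 = ?g l1" "f1 l2 = ?g l2" using 2 by simp_all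
    qed
    then show ?thesis using GM by blast
  qed
qed

text \<open>A subset \<open>Y\<close> of \<open>X1\<close> meets \<open>X2\<close> only in
  \<open>u1\<close> and \<open>u2\<close>, which are the ends of \<open>m\<close>. So every
  attachment of \<open>Y\<close> in \<open>G\<close> remains one in the part.\<close>

lemma block_graph_part:
  assumes B: "block_graph G" and s: "two_sep G X1 X2 u1 u2" and m: "m \<in> X2"
  shows "block_graph (part G X1 m u1 u2)"
proof -
  note G = block_graphD(1)[OF B] and D = two_sepD[OF s]
  let ?P = "part G X1 m u1 u2"
  have mX1: "m \<notin> X1" using D(2) m by blast
  have FP: "full_mgraph ?P" using full_part[OF block_graph_full[OF B] s m] .
  have main: False if Y: "Y \<subseteq> X1" "Y \<noteq> {}" and v: "edge_verts ?P Y \<inter> edge_verts ?P (insert m X1 - Y) \<subseteq> {v}" for Y v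
  proof -
    have "Y \<subseteq> medges G" "Y \<noteq> medges G" using Y(1) D(9) m mX1 D(10) by blast+
    then obtain x y where xy: "x \<noteq> y" "x \<in> edge_verts G Y" "x \<in> edge_verts G (medges G - Y)"
      "y \<in> edge_verts G Y" "y \<in> edge_verts G (medges G - Y)"
      using block_graph_two_verts[OF B _ Y(2)] by blast
    have "insert m X1 - Y = insert m (X1 - Y)" using mX1 Y(1) by blast
    then have VR: "edge_verts ?P (insert m X1 - Y) = {u1, u2} \<union> edge_verts G (X1 - Y)"
      using edge_verts_part(2)[OF mX1, of "X1 - Y" G u1 u2] by simp
    have VY: "edge_verts ?P Y = edge_verts G Y" using edge_verts_part(1)[OF mX1 Y(1)] .
    have "medges G - Y = X2 \<union> (X1 - Y)" using D(1,2) Y(1) by blast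
    then have V: "edge_verts G (medges G - Y) = edge_verts G X2 \<union> edge_verts G (X1 - Y)" using edge_verts_Un by metis
    have "edge_verts G Y \<inter> edge_verts G X2 \<subseteq> {u1, u2}" using edge_verts_mono[OF Y(1), of G] D(4) by blast
    then have "x \<in> {v}" "y \<in> {v}" using xy v unfolding V VR VY by blast+
    then show False using xy(1) by simp
  qed
  show ?thesis unfolding block_graph_def
  proof (intro conjI allI impI notI)
    show "multigraph ?P" "mverts ?P = edge_verts ?P (medges ?P)" using full_mgraphD[OF FP] by auto
    fix Y v assume Y: "Y \<subseteq> medges ?P \<and> Y \<noteq> {} \<and> Y \<noteq> medges ?P"
      and v: "edge_verts ?P Y \<inter> edge_verts ?P (medges ?P - Y) \<subseteq> {v}"
    have E: "medges ?P = insert m X1" by simp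
    show False
    proof (cases "m \<in> Y")
      case False
      then show False using main[of Y v] Y v unfolding E by blast
    next
      case True
      \<comment> \<open>The condition is symmetric in \<open>Y\<close> and its complement, and the
        complement avoids \<open>m\<close>.\<close>
      have eq: "insert m X1 - (insert m X1 - Y) = Y" using Y unfolding E by blast
      show False by (rule main[of "insert m X1 - Y" v])
        (use True Y v in \<open>unfold E eq, auto simp: Int_commute\<close>)
    qed
  qed
qed

lemma block_graph_two_sep_reach:
  assumes B: "block_graph G" and s: "two_sep G X1 X2 u1 u2"
  shows "reach G X1 u1 u2"
proof -
  note D = two_sepD[OF s]
  have X2: "medges G - X1 = X2" using D(1,2) by blast
  have "X1 \<noteq> medges G" using D(2,6) X2 by (metis Diff_cancel edge_verts_empty empty_iff)
  then obtain y where "y \<noteq> u1" "y \<in> edge_verts G X1" "y \<in> edge_verts G X2" "reach G X1 u1 y"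
    using block_graph_partner[OF B D(9) _ D(5)] unfolding X2 by blast
  then show ?thesis using D(4) by blast
qed

text \<open>In an even set of the part, \<open>m\<close> can be replaced by a fixed \<open>Q\<close>
  in \<open>X2\<close> with boundary \<open>{u1, u2}\<close>. The same \<open>Q\<close> serves
  \<open>G'\<close>: as \<open>P \<union> Q\<close> is even, the boundary of \<open>Q\<close> in
  \<open>G'\<close> lies in \<open>{w1, w2}\<close>, and it is not empty because \<open>Q\<close> is
  not even.\<close>

lemma evens_part_eq:
  assumes B: "block_graph G" and B': "block_graph G'" and E: "medges G = medges G'" and Z: "evens G = evens G'"
    and s: "two_sep G X1 X2 u1 u2" and s': "two_sep G' X1 X2 w1 w2" and m: "m \<in> X2"
  shows "evens (part G X1 m u1 u2) = evens (part G' X1 m w1 w2)"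
proof -
  note G = block_graphD(1)[OF B] and G' = block_graphD(1)[OF B'] and D = two_sepD[OF s] and D' = two_sepD[OF s']
  have mX1: "m \<notin> X1" using D(2) m by blast
  have fin: "finite X" if "X \<subseteq> medges G" for X using that multigraphD(2)[OF G] finite_subset by blast
  have fX: "finite X1" "finite X2" using fin D by auto
  obtain Q where Q: "Q \<subseteq> X2" "bd G Q = {u1} \<oplus> {u2}"
    using block_graph_two_sep_reach[OF B two_sep_commute[OF s]] unfolding reach_def by blast
  obtain P where P: "P \<subseteq> X1" "bd G P = {u1} \<oplus> {u2}"
    using block_graph_two_sep_reach[OF B s] unfolding reach_def by blast
  have QE: "Q \<subseteq> medges G" using Q(1) D(10) by blast
  have PE: "P \<subseteq> medges G" using P(1) D(9) by blast
  have fQ: "finite Q" using fin QE .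
  have jn: "finite Y" "Y \<inter> Q = {}" if "Y \<subseteq> X1" for Y
    using finite_subset[OF that fX(1)] that D(2) Q(1) by blast+
  have joinG: "bd G (Y \<union> Q) = bd G Y \<oplus> bd G Q" if "Y \<subseteq> X1" for Y
    using bd_Un[OF jn(1)[OF that] fQ jn(2)[OF that]] .
  have "P \<union> Q \<in> evens G" using joinG[OF P(1)] P(2) Q(2) PE QE unfolding evens_def by simp
  then have PQ: "P \<union> Q \<in> evens G'" using Z by simp
  have "Q = (P \<union> Q) \<inter> X2" using P(1) Q(1) D(2) by blast
  moreover have "medges G' - X2 = X1" using D'(1,2) by blast
  ultimately have "bd G' Q \<subseteq> {w1, w2}" using bd_split_subset[OF G' PQ, of X2] D'(4) by auto
  moreover have even: "even (card (bd G' Q))" using even_card_bd[OF G'] QE E by simp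
  moreover have "bd G' Q \<noteq> {}"
  proof
    assume "bd G' Q = {}"
    then have "Q \<in> evens G" unfolding Z using QE E unfolding evens_def by simp
    then show False using Q(2) D(3) evensD(2) by fastforce
  qed
  ultimately have "bd G' Q = {w1, w2}"
    using even_subset_single[OF even, of w1] even_subset_single[OF even, of w2] by blast
  then have Q': "bd G' Q = {w1} \<oplus> {w2}" using symd_singles[OF D'(3)] by simp
  have iff: "Y \<in> evens (part H X1 m a b) \<longleftrightarrow> (if m \<in> Y then (Y - {m}) \<union> Q \<in> evens H else Y \<in> evens H)"
    if "Y \<subseteq> insert m X1" "bd H Q = {a} \<oplus> {b}" "medges H = medges G" for H :: "('x, 'b) mgraph" and Y a b
  proof (cases "m \<in> Y")
    case True
    let ?Y = "Y - {m}"
    have Y: "?Y \<subseteq> X1" "Y = insert m ?Y" using that(1) True by blast+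
    have "bd (part H X1 m a b) Y = bd H ?Y \<oplus> bd H Q"
      using bd_part(2)[OF mX1 Y(1) fX(1), of H a b] Y(2) that(2) by metis
    also have "\<dots> = bd H (?Y \<union> Q)" using bd_Un[OF jn(1)[OF Y(1)] fQ jn(2)[OF Y(1)], of H] by simp
    finally have eq: "bd (part H X1 m a b) Y = bd H (?Y \<union> Q)" .
    have "?Y \<union> Q \<subseteq> medges H" using Y(1) D(9) QE that(3) by blast
    then show ?thesis using True that(1) eq unfolding evens_def by simp
  next
    case False
    then have Y: "Y \<subseteq> X1" using that(1) by blast
    have "Y \<subseteq> medges H" using Y D(9) that(3) by blast
    moreover have "bd (part H X1 m a b) Y = bd H Y" by (rule bd_part(1)[OF mX1 Y fX(1)])
    ultimately show ?thesis using False that(1) unfolding evens_def by simp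
  qed
  have eq: "Y \<in> evens (part G X1 m u1 u2) \<longleftrightarrow> Y \<in> evens (part G' X1 m w1 w2)" if Y: "Y \<subseteq> insert m X1" for Y
    using iff[OF Y Q(2) refl] iff[OF Y Q' E[symmetric]] Z by simp
  have sub: "Y \<subseteq> insert m X1" if "Y \<in> evens (part H X1 m a b)" for H :: "('x, 'b) mgraph" and Y a b
    using evensD(1)[OF that] by simp
  show ?thesis
  proof (intro equalityI subsetI)
    show "Y \<in> evens (part G' X1 m w1 w2)" if "Y \<in> evens (part G X1 m u1 u2)" for Y
      using eq[OF sub[OF that]] that by blast
    show "Y \<in> evens (part G X1 m u1 u2)" if "Y \<in> evens (part G' X1 m w1 w2)" for Y
      using eq[OF sub[OF that]] that by blast
  qed
qed

section \<open>Recovering vertices from stars, and induction along 2-separations\<close>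

section \<open>Whitney's theorem for nonseparable graphs\<close>

text \<open>By orthogonality, the parity with which a connection from a base vertex \<open>a\<close>
  meets \<open>B\<close> depends only on its other end. \<open>U\<close> collects the vertices of
  odd parity.\<close>

lemma orthogonal_is_cut:
  assumes G: "multigraph G" and conn: "\<And>x y. x \<in> mverts G \<Longrightarrow> y \<in> mverts G \<Longrightarrow> reach G (medges G) x y"
    and B: "B \<subseteq> medges G" "orthogonal (evens G) B"
  shows "\<exists>U\<subseteq>mverts G. B = cut G U"
proof (cases "mverts G = {}")
  case True
  have "e \<notin> medges G" for e
  proof
    assume e: "e \<in> medges G"
    then show False using multigraphD(3,4)[OF G e] True by auto
  qed
  then show ?thesis using B by (auto simp: cut_def)
next
  case False
  then obtain a where a: "a \<in> mverts G" by blast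
  let ?E = "medges G"
  have fE: "finite ?E" using multigraphD(2)[OF G] .
  define U where "U = {v \<in> mverts G. \<exists>Q\<subseteq>?E. bd G Q = {a} \<oplus> {v} \<and> odd (card (Q \<inter> B))}"
  have U_iff: "v \<in> U \<longleftrightarrow> odd (card (Q \<inter> B))" if v: "v \<in> mverts G" and Q: "Q \<subseteq> ?E" "bd G Q = {a} \<oplus> {v}" for v Q
  proof -
    have "odd (card (Q \<inter> B)) \<longleftrightarrow> odd (card (R \<inter> B))" if R: "R \<subseteq> ?E" "bd G R = {a} \<oplus> {v}" for R
    proof -
      have fin: "finite Q" "finite R" using Q(1) R(1) fE finite_subset by auto
      have "bd G (Q \<oplus> R) = {}" unfolding bd_symd[OF fin] Q(2) R(2) by simp
      then have "Q \<oplus> R \<in> evens G" using symd_subset[OF Q(1) R(1)] unfolding evens_def by blast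
      then have "even (card ((Q \<oplus> R) \<inter> B))" using B(2) unfolding orthogonal_def by blast
      then show ?thesis using even_card_Int_symd[OF fin, of B] by blast
    qed
    then show ?thesis unfolding U_def using v Q by blast
  qed
  have "e \<in> B \<longleftrightarrow> e \<in> cut G U" if e: "e \<in> ?E" for e
  proof -
    obtain x y where xy: "mends G e = {x, y}" using ends_pair[OF G order.refl e] by blast
    have V: "x \<in> mverts G" "y \<in> mverts G" using multigraphD(3)[OF G e] xy by auto
    obtain Q where Q: "Q \<subseteq> ?E" "bd G Q = {a} \<oplus> {x}" using conn[OF a V(1)] unfolding reach_def by blast
    have fQ: "finite Q" using Q(1) fE finite_subset by blast
    have "bd G (Q \<oplus> {e}) = {a} \<oplus> {x} \<oplus> ({x} \<oplus> {y})"
      using bd_symd[OF fQ, of "{e}" G] Q(2) bd_single_pair[OF xy] by simp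
    also have "\<dots> = {a} \<oplus> {y}" by (simp add: symd_assoc)
    finally have 1: "bd G (Q \<oplus> {e}) = {a} \<oplus> {y}" .
    have "Q \<oplus> {e} \<subseteq> ?E" using symd_subset[OF Q(1), of "{e}"] e by blast
    then have "y \<in> U \<longleftrightarrow> odd (card ((Q \<oplus> {e}) \<inter> B))" using U_iff[OF V(2) _ 1] by blast
    also have "\<dots> \<longleftrightarrow> (odd (card (Q \<inter> B)) \<longleftrightarrow> e \<notin> B)"
      using even_card_Int_symd[OF fQ, of "{e}" B] by (cases "e \<in> B") auto
    also have "\<dots> \<longleftrightarrow> (x \<in> U \<longleftrightarrow> e \<notin> B)" using U_iff[OF V(1) Q] by blast
    finally have "e \<in> B \<longleftrightarrow> (x \<in> U) \<noteq> (y \<in> U)" by blast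
    then show ?thesis using e xy unfolding cut_def by auto
  qed
  moreover have "cut G U \<subseteq> ?E" unfolding cut_def by blast
  ultimately have "B = cut G U" using B(1) by blast
  moreover have "U \<subseteq> mverts G" unfolding U_def by auto
  ultimately show ?thesis by (intro exI[of _ U] conjI)
qed

lemma block_graph_loop:
  assumes B: "block_graph G" and e: "e \<in> medges G" "card (mends G e) \<noteq> 2"
  shows "medges G = {e}"
proof (rule ccontr)
  assume n: "medges G \<noteq> {e}"
  have "{e} \<subseteq> medges G" using e by blast
  then obtain x y where "x \<noteq> y" "x \<in> edge_verts G {e}" "y \<in> edge_verts G {e}"
    using block_graph_two_verts[OF B, of "{e}"] n by blast
  then have xy: "x \<noteq> y" "x \<in> mends G e" "y \<in> mends G e" unfolding edge_verts_def by auto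
  have "mends G e = {x}" using single_vertex_end[OF block_graphD(1)[OF B] order.refl e(1) xy(2) e(2)] .
  then show False using xy by simp
qed

lemma two_sep_of_subset:
  assumes B: "block_graph G" and X: "X \<subseteq> medges G" "X \<noteq> {}" "X \<noteq> medges G"
    and s: "edge_verts G X \<inter> edge_verts G (medges G - X) \<subseteq> {p, q}"
  shows "two_sep G X (medges G - X) p q"
proof -
  obtain x y where xy: "x \<noteq> y" "x \<in> edge_verts G X" "x \<in> edge_verts G (medges G - X)"
      "y \<in> edge_verts G X" "y \<in> edge_verts G (medges G - X)"
    using block_graph_two_verts[OF B X] by blast
  have "x \<in> {p, q}" "y \<in> {p, q}" using xy s by blast+
  then have "{x, y} = {p, q}" "p \<noteq> q" using xy(1) by auto
  moreover have "{x, y} \<subseteq> edge_verts G X \<inter> edge_verts G (medges G - X)" using xy by blast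
  ultimately show ?thesis unfolding two_sep_def using X(1) s by blast
qed

lemma block_graph_transfer:
  assumes "block_graph G" "full_mgraph H" "medges H = medges G" "evens H = evens G"
  shows "block_graph H"
  using connected_space_block_graph[OF full_mgraphD[OF assms(2)]]
    block_graph_connected_space[OF assms(1)] assms(3,4) by simp

lemma loop_iff_even: "e \<in> medges G \<Longrightarrow> multigraph G \<Longrightarrow> {e} \<in> evens G \<longleftrightarrow> card (mends G e) \<noteq> 2"
  unfolding evens_def by (auto simp: bd_single)

text \<open>A nonseparable graph with at most two vertices is empty, a single loop or a bundle of
  parallel edges. Even sets with one or two elements distinguish these and force the same shape on
  \<open>G'\<close>.\<close>

lemma iso_at_most_two_verts:
  fixes G :: "('v, 'e) mgraph" and G' :: "('w, 'e) mgraph"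
  assumes B: "block_graph G" and B': "block_graph G'" and E: "medges G' = medges G" and Z: "evens G' = evens G"
    and c: "card (mverts G) \<le> 2"
  shows "mgraph_iso G G'"
proof -
  note G = block_graphD(1)[OF B] and G' = block_graphD(1)[OF B'] and V = block_graphD(2)[OF B] and V' = block_graphD(2)[OF B']
  have loop: "card (mends G' e) = 2 \<longleftrightarrow> card (mends G e) = 2" if "e \<in> medges G" for e
    using loop_iff_even[OF _ G, of e] loop_iff_even[OF _ G', of e] that E Z by auto
  consider "medges G = {}" | e where "e \<in> medges G" "card (mends G e) \<noteq> 2"
    | e where "e \<in> medges G" "\<And>f. f \<in> medges G \<Longrightarrow> card (mends G f) = 2" by blast
  then show ?thesis
  proof cases
    case 1
    then have "mverts G = {}" "mverts G' = {}" using V V' E by auto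
    then show ?thesis unfolding mgraph_iso_def using 1 E by (auto simp: bij_betw_def)
  next
    case (2 e)
    have Ee: "medges G = {e}" using block_graph_loop[OF B 2] .
    obtain v where v: "mends G e = {v}" using multigraphD(4)[OF G 2(1)] 2(2) by (auto simp: card_1_singleton_iff)
    have "card (mends G' e) \<noteq> 2" "e \<in> medges G'" using loop[OF 2(1)] 2 E by auto
    then obtain v' where v': "mends G' e = {v'}" using multigraphD(4)[OF G', of e] by (auto simp: card_1_singleton_iff)
    have "mverts G = {v}" "mverts G' = {v'}" using V V' E Ee v v' unfolding edge_verts_def by auto
    then show ?thesis unfolding mgraph_iso_def using Ee E v v'
      by (intro conjI exI[of _ "\<lambda>_. v'"]) (auto simp: bij_betw_def)
  next
    case (3 e)
    have fV: "finite (mverts G)" using multigraphD(1)[OF G] .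
    obtain a b where ab: "mends G e = {a, b}" "a \<noteq> b" using 3(2)[OF 3(1)] by (auto simp: card_2_iff)
    have ends: "mends G f = {a, b}" if "f \<in> medges G" for f
    proof -
      have s: "{a, b} \<subseteq> mverts G" using multigraphD(3)[OF G 3(1)] ab by simp
      then have "{a, b} = mverts G" using card_seteq[OF fV s] c ab(2) by simp
      moreover have "mends G f = mverts G" using card_seteq[OF fV multigraphD(3)[OF G that]] 3(2)[OF that] c by simp
      ultimately show ?thesis by simp
    qed
    have e': "e \<in> medges G'" using 3(1) E by simp
    obtain c d where cd: "mends G' e = {c, d}" "c \<noteq> d" using loop[OF 3(1)] 3(2)[OF 3(1)] by (auto simp: card_2_iff)
    have ends': "mends G' f = {c, d}" if f: "f \<in> medges G" for f
    proof (cases "f = e")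
      case False
      have "bd G {e, f} = bd G {f} \<oplus> bd G {e}" using bd_insert[of "{f}" e G] False by auto
      also have "\<dots> = {}" unfolding bd_single using ends[OF f] ends[OF 3(1)] by simp
      finally have "{e, f} \<in> evens G'" unfolding Z using f 3(1) unfolding evens_def by auto
      then have "bd G' {f} \<oplus> bd G' {e} = {}" using bd_insert[of "{f}" e G'] False evensD(2) by fastforce
      then have "bd G' {f} = bd G' {e}" by simp
      then show ?thesis unfolding bd_single using loop[OF f] loop[OF 3(1)] 3(2) f 3(1) cd(1) by simp
    qed (use cd in simp)
    have "mverts G = {a, b}" "mverts G' = {c, d}"
      using V V' E ends ends' 3(1) unfolding edge_verts_def by auto
    moreover have "bij_betw (\<lambda>x. if x = a then c else d) {a, b} {c, d}"
      using ab(2) cd(2) by (auto simp: bij_betw_def inj_on_def)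
    moreover have "(\<lambda>x. if x = a then c else d) ` {a, b} = {c, d}" using ab(2) by auto
    ultimately show ?thesis unfolding mgraph_iso_def using E ends ends' by (metis (no_types, lifting))
  qed
qed

lemma block_graph_edge_restrict_iff:
  assumes G: "multigraph G" and X: "X \<subseteq> medges G"
  shows "block_graph (edge_restrict G X) \<longleftrightarrow>
    (\<forall>Y v. Y \<subseteq> X \<and> Y \<noteq> {} \<and> Y \<noteq> X \<longrightarrow> \<not> edge_verts G Y \<inter> edge_verts G (X - Y) \<subseteq> {v})"
proof -
  have 1: "edge_verts (edge_restrict G X) Y = edge_verts G Y" if "Y \<subseteq> X" for Y
    using edge_verts_edge_restrict[OF that] .
  have 2: "edge_verts (edge_restrict G X) (X - Y) = edge_verts G (X - Y)" for Y
    by (rule 1) blast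
  show ?thesis unfolding block_graph_def using multigraph_edge_restrict[OF G X] 1 2 by auto
qed

text \<open>If the graph without the star of \<open>v\<close> were separable at \<open>w\<close>,
  then \<open>v\<close> and \<open>w\<close> would be the attachments of a 2-separation of
  \<open>G\<close>.\<close>

lemma star_complement_connected:
  assumes B: "block_graph G" and loopless: "\<And>e. e \<in> medges G \<Longrightarrow> card (mends G e) = 2"
    and nosep: "\<And>X p q. X \<subseteq> medges G \<Longrightarrow> 2 \<le> card X \<Longrightarrow> 2 \<le> card (medges G - X) \<Longrightarrow>
       \<not> edge_verts G X \<inter> edge_verts G (medges G - X) \<subseteq> {p, q}"
  shows "block_graph (edge_restrict G (medges G - cut G {v}))"
proof -
  note G = block_graphD(1)[OF B]
  let ?E = "medges G"
  define S where "S = ?E - cut G {v}"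
  have SE: "S \<subseteq> ?E" unfolding S_def by blast
  have at_v: "e \<in> S \<longleftrightarrow> v \<notin> mends G e" if "e \<in> ?E" for e
  proof -
    have "\<not> mends G e \<subseteq> {v}" using loopless[OF that] by (metis card.empty card_1_singleton_iff
          One_nat_def numeral_2_eq_2 n_not_Suc_n subset_singletonD zero_neq_numeral)
    then show ?thesis using that unfolding S_def cut_def by auto
  qed
  have fin: "finite X" if "X \<subseteq> ?E" for X using that multigraphD(2)[OF G] finite_subset by blast
  have False if X: "X1 \<subseteq> S" "X1 \<noteq> {}" "X1 \<noteq> S" and w: "edge_verts G X1 \<inter> edge_verts G (S - X1) \<subseteq> {w}" for X1 w
  proof -
    \<comment> \<open>Edges of the star of \<open>v\<close> are assigned to the side of their other
      end: \<open>X1\<close> receives all edges at its vertices other than \<open>w\<close>, which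
      leaves \<open>v\<close> and \<open>w\<close> as the only possible attachments.\<close>
    define Y where "Y = X1 \<union> {e \<in> ?E. mends G e \<inter> (edge_verts G X1 - {w}) \<noteq> {}}"
    have YE: "Y \<subseteq> ?E" unfolding Y_def using X(1) SE by blast
    have X2Y: "S - X1 \<subseteq> ?E - Y"
    proof
      fix e assume e: "e \<in> S - X1"
      have "mends G e \<inter> edge_verts G X1 \<subseteq> {w}" using w e unfolding edge_verts_def by blast
      then show "e \<in> ?E - Y" using e SE unfolding Y_def by blast
    qed
    have inter: "edge_verts G Y \<inter> edge_verts G (?E - Y) \<subseteq> {v, w}"
    proof
      fix x assume x: "x \<in> edge_verts G Y \<inter> edge_verts G (?E - Y)"
      then obtain g where g: "g \<in> ?E" "g \<notin> Y" "x \<in> mends G g" unfolding edge_verts_def by blast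
      obtain e where e: "e \<in> Y" "x \<in> mends G e" using x unfolding edge_verts_def by blast
      show "x \<in> {v, w}"
      proof (rule ccontr)
        assume n: "x \<notin> {v, w}"
        have "x \<in> edge_verts G X1"
        proof (cases "e \<in> X1")
          case True
          then show ?thesis using e(2) edge_vertsI by metis
        next
          case False
          then obtain y where y: "y \<in> mends G e" "y \<in> edge_verts G X1" using e(1) unfolding Y_def by blast
          have eE: "e \<in> ?E" using e(1) YE by blast
          have "e \<notin> S - X1" using X2Y e(1) by blast
          then have "e \<notin> S" using False by blast
          then have "v \<in> mends G e" using at_v[OF eE] by blast
          then obtain z where z: "mends G e = {v, z}" using other_end[OF G YE e(1)] by blast
          have "y \<noteq> v"
          proof
            assume "y = v"
            then obtain h where "h \<in> X1" "v \<in> mends G h" using y(2) unfolding edge_verts_def by blast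
            then show False using at_v[of h] X(1) SE by blast
          qed
          then have "x = y" using y(1) e(2) z n by auto
          then show ?thesis using y(2) by simp
        qed
        then have "g \<in> Y" using g n unfolding Y_def by blast
        then show False using g(2) by blast
      qed
    qed
    \<comment> \<open>Each side contains an edge not incident with \<open>v\<close>. If it had no
      further edge, its attachments would lie in \<open>{w}\<close>.\<close>
    have small: "2 \<le> card T" if T: "T \<subseteq> ?E" "T \<noteq> {}" "T \<noteq> ?E" "\<exists>g\<in>T. g \<in> S"
      "edge_verts G T \<inter> edge_verts G (?E - T) \<subseteq> {v, w}" for T
    proof (rule ccontr)
      assume "\<not> 2 \<le> card T"
      moreover have "card T \<noteq> 0" using fin[OF T(1)] T(2) by simp
      ultimately have "card T = 1" by linarith
      then obtain g where "T = {g}" by (auto simp: card_1_singleton_iff)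
      then have g: "T = {g}" "g \<in> S" using T(4) by auto
      have "v \<notin> edge_verts G T" using g at_v[of g] SE unfolding edge_verts_def by auto
      then have "edge_verts G T \<inter> edge_verts G (?E - T) \<subseteq> {w}" using T(5) by blast
      then show False using B T(1-3) unfolding block_graph_def by blast
    qed
    have gY: "\<exists>g\<in>Y. g \<in> S" using X(1,2) unfolding Y_def by blast
    have gY': "\<exists>g\<in>?E - Y. g \<in> S" using X(1,3) X2Y by blast
    have E': "?E - (?E - Y) = Y" using YE by blast
    have "2 \<le> card Y" by (rule small[OF YE]) (use gY gY' inter in blast)+
    moreover have "2 \<le> card (?E - Y)"
      by (rule small) (use gY gY' inter E' in \<open>auto simp: Int_commute\<close>)
    ultimately show False using nosep[OF YE] inter by blast
  qed
  then show ?thesis unfolding S_def[symmetric] block_graph_edge_restrict_iff[OF G SE] by blast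
qed

text \<open>For \<open>e\<close> in \<open>C\<close> and \<open>f\<close> in the star but not in
  \<open>C\<close>, the other ends of \<open>e\<close> and \<open>f\<close> are connected away from
  \<open>v\<close>, since \<open>v\<close> does not separate \<open>G\<close>. The resulting even
  set meets the star in \<open>e\<close> and \<open>f\<close> only, hence meets \<open>C\<close> in
  \<open>e\<close> alone.\<close>

lemma star_minimal:
  assumes B: "block_graph G" and loopless: "\<And>e. e \<in> medges G \<Longrightarrow> card (mends G e) = 2"
    and C: "C \<subseteq> cut G {v}" "C \<noteq> {}" "orthogonal (evens G) C"
  shows "C = cut G {v}"
proof (rule ccontr)
  assume n: "C \<noteq> cut G {v}"
  note G = block_graphD(1)[OF B]
  let ?E = "medges G" and ?B = "cut G {v}"
  have fE: "finite ?E" using multigraphD(2)[OF G] .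
  have BE: "?B \<subseteq> ?E" unfolding cut_def by blast
  obtain e f where ef: "e \<in> C" "f \<in> ?B" "f \<notin> C" using C n by blast
  have eB: "e \<in> ?B" using ef(1) C(1) by blast
  have other: "\<exists>x. mends G g = {v, x} \<and> x \<noteq> v" if g: "g \<in> ?B" for g
  proof -
    have "v \<in> mends G g" "\<not> mends G g \<subseteq> {v}" using g unfolding cut_def by auto
    then show ?thesis using other_end[OF G BE g] by auto
  qed
  obtain x where x: "mends G e = {v, x}" "x \<noteq> v" using other[OF eB] by blast
  obtain y where y: "mends G f = {v, y}" "y \<noteq> v" using other[OF ef(2)] by blast
  let ?S = "?E - ?B"
  have SE: "?S \<subseteq> ?E" by blast
  have fS: "finite ?S" using fE by blast
  have "reach G ?S x y"
  proof (rule ccontr)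
    assume nr: "\<not> reach G ?S x y"
    let ?U = "{z. reach G ?S x z}"
    have vU: "v \<notin> ?U"
    proof
      assume "v \<in> ?U"
      then have r: "reach G ?S x v" by simp
      have "v \<in> - {v}"
      proof (rule reach_closed[OF G SE r])
        show "x \<in> - {v}" using x by simp
        fix g assume g: "g \<in> ?S" "mends G g \<inter> - {v} \<noteq> {}"
        then have "\<not> mends G g \<subseteq> {v}" by blast
        then show "mends G g \<subseteq> - {v}" using g(1) unfolding cut_def by blast
      qed
      then show False by simp
    qed
    define Y where "Y = {g \<in> ?E. mends G g \<inter> ?U \<noteq> {}}"
    have "e \<in> Y" using eB BE x unfolding Y_def by auto
    moreover have "f \<notin> Y" using y nr vU unfolding Y_def by auto
    moreover have "f \<in> ?E" using ef(2) BE by blast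
    moreover have YE: "Y \<subseteq> ?E" unfolding Y_def by blast
    ultimately have "\<not> edge_verts G Y \<inter> edge_verts G (?E - Y) \<subseteq> {v}"
      using B unfolding block_graph_def by blast
    then obtain z where z: "z \<noteq> v" "z \<in> edge_verts G Y" "z \<in> edge_verts G (?E - Y)" by blast
    obtain g where g: "g \<in> ?E" "g \<notin> Y" "z \<in> mends G g" using z(3) unfolding edge_verts_def by blast
    then have zU: "z \<notin> ?U" unfolding Y_def by blast
    obtain h where h: "h \<in> Y" "z \<in> mends G h" using z(2) unfolding edge_verts_def by blast
    obtain u where u: "u \<in> mends G h" "u \<in> ?U" using h(1) unfolding Y_def by blast
    have "h \<in> ?B"
    proof (rule ccontr)
      assume "h \<notin> ?B"
      then have "h \<in> ?S" using h(1) YE by blast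
      then have "reach G ?S u z" using reach_edge'[OF G SE _ u(1) h(2)] by blast
      then have "reach G ?S x z" using reach_trans[OF fS, of G x u z] u(2) by simp
      then show False using zU by simp
    qed
    then obtain t where "mends G h = {v, t}" using other by blast
    then have "u = z" using u h(2) z(1) vU by auto
    then show False using u(2) zU by simp
  qed
  then obtain Q where Q: "Q \<subseteq> ?S" "bd G Q = {x} \<oplus> {y}" unfolding reach_def by blast
  have Qf: "finite Q" "e \<notin> Q" "f \<notin> Q" "e \<noteq> f" using Q(1) fS finite_subset eB ef by blast+
  have "bd G (insert e (insert f Q)) = bd G Q \<oplus> bd G {f} \<oplus> bd G {e}"
    using bd_insert[of "insert f Q" e G] bd_insert[of Q f G] Qf by simp
  also have "\<dots> = {x} \<oplus> {y} \<oplus> ({v} \<oplus> {y}) \<oplus> ({v} \<oplus> {x})"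
    unfolding Q(2) bd_single_pair[OF x(1)] bd_single_pair[OF y(1)] ..
  also have "\<dots> = {}" unfolding set_eq_iff symd_iff singleton_iff empty_iff by blast
  finally have "insert e (insert f Q) \<in> evens G"
    using Q(1) eB ef(2) BE unfolding evens_def by blast
  then have "even (card (insert e (insert f Q) \<inter> C))" using C(3) unfolding orthogonal_def by blast
  moreover have "insert e (insert f Q) \<inter> C = {e}" using Q(1) C(1) ef by blast
  ultimately show False by simp
qed

text \<open>The star of \<open>v\<close> is a cut of \<open>G'\<close>. The remaining edges form a
  connected space and so lie on one side of it. A vertex \<open>u\<close> on the other side has its
  star inside that of \<open>v\<close>, and minimality gives equality.\<close>

lemma iso_three_connected:
  fixes G :: "('v, 'e) mgraph" and G' :: "('w, 'e) mgraph"
  assumes B: "block_graph G" and B': "block_graph G'" and E: "medges G' = medges G" and Z: "evens G' = evens G"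
    and c: "3 \<le> card (mverts G)"
    and nosep: "\<And>X p q. X \<subseteq> medges G \<Longrightarrow> 2 \<le> card X \<Longrightarrow> 2 \<le> card (medges G - X) \<Longrightarrow>
       \<not> edge_verts G X \<inter> edge_verts G (medges G - X) \<subseteq> {p, q}"
  shows "mgraph_iso G G'"
proof -
  note G = block_graphD(1)[OF B] and G' = block_graphD(1)[OF B'] and V = block_graphD(2)[OF B] and V' = block_graphD(2)[OF B']
  let ?E = "medges G"
  have loopless: "card (mends G e) = 2" if e: "e \<in> ?E" for e
  proof (rule ccontr)
    assume l: "card (mends G e) \<noteq> 2"
    have "mverts G = mends G e" using V block_graph_loop[OF B e l] unfolding edge_verts_def by simp
    then show False using c multigraphD(4)[OF G e] by auto
  qed
  have loopless': "card (mends G' e) = 2" if e: "e \<in> ?E" for e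
    using loop_iff_even[of e G] loop_iff_even[of e G'] loopless[OF e] e E Z G G' by auto
  have nsub: "\<not> mends G e \<subseteq> {x}" if "e \<in> ?E" for e x
    using loopless[OF that] card_mono[of "{x}" "mends G e"] by fastforce
  have nsub': "\<not> mends G' e \<subseteq> {x}" if "e \<in> ?E" for e x
    using loopless'[OF that] card_mono[of "{x}" "mends G' e"] by fastforce
  have star: "e \<in> cut G {x} \<longleftrightarrow> x \<in> mends G e" if "e \<in> ?E" for e x
    using that nsub[OF that] unfolding cut_def by auto
  have star': "e \<in> cut G' {x} \<longleftrightarrow> x \<in> mends G' e" if "e \<in> ?E" for e x
    using that nsub'[OF that] E unfolding cut_def by auto
  have cutE: "cut G {x} \<subseteq> ?E" for x unfolding cut_def by blast
  have cutE': "cut G' U \<subseteq> ?E" for U using E unfolding cut_def by blast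
  have ex: "\<exists>u\<in>mverts G'. cut G' {u} = cut G {v}" if v: "v \<in> mverts G" for v
  proof -
    let ?B = "cut G {v}"
    define S where "S = ?E - ?B"
    have SE: "S \<subseteq> ?E" unfolding S_def by blast
    have "connected_space S {Y \<in> evens G. Y \<subseteq> S}"
      using block_graph_connected_space[OF star_complement_connected[OF B loopless nosep, of v]]
      unfolding S_def[symmetric] evens_edge_restrict[OF SE] by simp
    note conS = this[unfolded connected_space_def]
    have "orthogonal (evens G') ?B" unfolding Z by (rule orthogonal_cut[OF G])
    then obtain U where U: "U \<subseteq> mverts G'" "?B = cut G' U"
      using orthogonal_is_cut[OF G' block_graph_reach[OF B']] cutE E by metis
    have side: "mends G' g \<subseteq> U \<or> mends G' g \<inter> U = {}" if "g \<in> S" for g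
      using that U(2) E unfolding S_def cut_def by blast
    define T where "T = {g \<in> S. mends G' g \<subseteq> U}"
    have sepT: "X \<inter> T \<in> {Y \<in> evens G. Y \<subseteq> S}" if X: "X \<in> {Y \<in> evens G. Y \<subseteq> S}" for X
    proof -
      have XZ: "X \<in> evens G'" using X Z by simp
      have "edge_verts G' (X \<inter> T) \<subseteq> U" unfolding T_def edge_verts_def by blast
      then have "bd G' (X \<inter> T) \<subseteq> U" using bd_subset by fastforce
      moreover have "edge_verts G' (X - T) \<inter> U = {}" using side X unfolding T_def edge_verts_def by blast
      then have "bd G' (X - T) \<inter> U = {}" using bd_subset[of G' "X - T"] by blast
      ultimately have "bd G' (X \<inter> T) = {}" using bd_split[OF G' XZ, of T] by blast
      then have "X \<inter> T \<in> evens G'" using evensD(1)[OF XZ] unfolding evens_def by blast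
      then show ?thesis using X Z by blast
    qed
    have "T \<subseteq> S" unfolding T_def by blast
    then have T: "T = {} \<or> T = S" using conS[THEN spec, of T] sepT by meson
    \<comment> \<open>The side of the cut in \<open>G'\<close> that no edge outside the star
      touches.\<close>
    define W where "W = (if T = {} then U else mverts G' - U)"
    have W: "W \<subseteq> mverts G'" unfolding W_def using U by auto
    have WS: "mends G' g \<inter> W = {}" if "g \<in> S" for g
    proof (cases "T = {}")
      case True
      then show ?thesis using side[OF that] that unfolding W_def T_def by auto
    next
      case False
      then have "mends G' g \<subseteq> U" using T that unfolding T_def by blast
      then show ?thesis using False unfolding W_def by auto
    qed
    have cutW: "cut G' W = ?B"
    proof (cases "T = {}")
      case False
      have "mends G' g \<subseteq> mverts G'" if "g \<in> medges G'" for g using multigraphD(3)[OF G' that] .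
      then have "cut G' (mverts G' - U) = cut G' U" unfolding cut_def by blast
      then show ?thesis using False U(2) unfolding W_def by simp
    qed (use U(2) in \<open>simp add: W_def\<close>)
    obtain g where "g \<in> ?E" "v \<in> mends G g" using v V edge_vertsE by metis
    then have "?B \<noteq> {}" using star by blast
    then obtain u where u: "u \<in> W" using cutW unfolding cut_def by blast
    have "cut G' {u} \<subseteq> ?B"
    proof
      fix h assume h: "h \<in> cut G' {u}"
      then have "h \<in> ?E" "u \<in> mends G' h" using cutE' star' by blast+
      then show "h \<in> ?B" using WS[of h] u unfolding S_def by blast
    qed
    moreover have "cut G' {u} \<noteq> {}"
    proof -
      have "u \<in> mverts G'" using u W by blast
      then obtain h where "h \<in> ?E" "u \<in> mends G' h" using V' E edge_vertsE by metis
      then show ?thesis using star' by blast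
    qed
    moreover have "orthogonal (evens G) (cut G' {u})" using orthogonal_cut[OF G', of "{u}"] unfolding Z .
    ultimately have "cut G' {u} = ?B" by (intro star_minimal[OF B loopless])
    then show ?thesis using u W by blast
  qed
  then obtain \<phi> where \<phi>: "\<And>v. v \<in> mverts G \<Longrightarrow> \<phi> v \<in> mverts G' \<and> cut G' {\<phi> v} = cut G {v}" by metis
  \<comment> \<open>Two vertices with the same star lie on no edges except parallel ones joining
    them, so these edges would share no vertex with the rest.\<close>
  have inj: "inj_on \<phi> (mverts G)"
  proof (rule inj_onI, rule ccontr)
    fix v w assume vw: "v \<in> mverts G" "w \<in> mverts G" "\<phi> v = \<phi> w" "v \<noteq> w"
    have eq: "cut G {v} = cut G {w}" using \<phi> vw by metis
    let ?B = "cut G {v}"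
    have ends: "mends G e = {v, w}" if e: "e \<in> ?B" for e
    proof -
      have "v \<in> mends G e" "w \<in> mends G e" using e eq star cutE by blast+
      then show ?thesis using other_end[OF G cutE e] vw(4) by auto
    qed
    obtain g where "g \<in> ?E" "v \<in> mends G g" using vw(1) V edge_vertsE by metis
    then have ne: "?B \<noteq> {}" using star by blast
    have VB: "edge_verts G ?B \<subseteq> {v, w}" using ends unfolding edge_verts_def by auto
    have "?B \<noteq> ?E"
    proof
      assume "?B = ?E"
      then have "mverts G \<subseteq> {v, w}" using VB V by simp
      then have "card (mverts G) \<le> card {v, w}" by (rule card_mono[rotated]) simp
      then show False using c vw(4) by simp
    qed
    moreover have "edge_verts G ?B \<inter> edge_verts G (?E - ?B) \<subseteq> {v}"
    proof
      fix x assume x: "x \<in> edge_verts G ?B \<inter> edge_verts G (?E - ?B)"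
      then obtain h where h: "h \<in> ?E" "h \<notin> ?B" "x \<in> mends G h" unfolding edge_verts_def by blast
      have "x = v \<or> x = w" using x VB by blast
      then show "x \<in> {v}" using h star[OF h(1)] eq by auto
    qed
    ultimately show False using B ne cutE[of v] unfolding block_graph_def by blast
  qed
  have ends: "mends G' e = \<phi> ` mends G e" if e: "e \<in> ?E" for e
  proof -
    obtain v w where vw: "mends G e = {v, w}" "v \<noteq> w" using loopless[OF e] by (auto simp: card_2_iff)
    have vwV: "v \<in> mverts G" "w \<in> mverts G" using multigraphD(3)[OF G e] vw(1) by auto
    have "e \<in> cut G' {\<phi> v}" "e \<in> cut G' {\<phi> w}" using \<phi> vwV star[OF e] vw(1) by auto
    then have in': "\<phi> v \<in> mends G' e" "\<phi> w \<in> mends G' e" using star'[OF e] by auto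
    have "\<phi> v \<noteq> \<phi> w" using inj vwV vw(2) by (meson inj_onD)
    moreover obtain z where "mends G' e = {\<phi> v, z}" using other_end[OF G' order.refl _ in'(1)] e E by auto
    ultimately show ?thesis using in'(2) vw(1) by auto
  qed
  have "mverts G' = \<phi> ` mverts G"
    using V V' E edge_verts_iso[of ?E G' \<phi> G] ends by simp
  then have "bij_betw \<phi> (mverts G) (mverts G')" using inj unfolding bij_betw_def by simp
  then show ?thesis unfolding mgraph_iso_def using E ends by auto
qed

text \<open>Nonseparability of the side \<open>X\<close> depends on even sets only, so
  \<open>X\<close> is connected in \<open>G'\<close> as well. Hence each attachment \<open>x\<close>
  of \<open>X\<close> in \<open>G'\<close> has a partner \<open>y\<close> such that some even set
  leaves a trace on \<open>X\<close> with boundary \<open>{x, y}\<close>. In \<open>G\<close> every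
  such trace has boundary \<open>{p, q}\<close>, so two of them add up to an even set and have equal
  boundaries in \<open>G'\<close> too. Thus there is only one pair of attachments.\<close>

lemma two_sep_transfer:
  fixes G :: "('v, 'e) mgraph" and G' :: "('w, 'e) mgraph"
  assumes B: "block_graph G" and B': "block_graph G'" and E: "medges G' = medges G" and Z: "evens G' = evens G"
    and X: "X \<subseteq> medges G" "X \<noteq> {}" "X \<noteq> medges G"
    and s: "edge_verts G X \<inter> edge_verts G (medges G - X) \<subseteq> {p, q}"
    and c: "block_graph (edge_restrict G X)"
  shows "\<exists>w1 w2. two_sep G' X (medges G' - X) w1 w2"
proof -
  note G = block_graphD(1)[OF B] and G' = block_graphD(1)[OF B']
  have XE': "X \<subseteq> medges G'" using X(1) E by simp
  have fin: "finite Y" if "Y \<subseteq> medges G" for Y using that multigraphD(2)[OF G] finite_subset by blast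
  have c': "block_graph (edge_restrict G' X)"
  proof (rule block_graph_transfer[OF c])
    show "full_mgraph (edge_restrict G' X)" unfolding full_mgraph_def
      using multigraph_edge_restrict[OF G' XE'] by (simp add: edge_verts_edge_restrict)
    show "medges (edge_restrict G' X) = medges (edge_restrict G X)" by simp
    show "evens (edge_restrict G' X) = evens (edge_restrict G X)"
      unfolding evens_edge_restrict[OF X(1)] evens_edge_restrict[OF XE'] Z ..
  qed
  let ?R = "medges G' - X"
  have R: "?R \<subseteq> medges G'" "medges G' - ?R = X" using XE' by auto
  have Rne: "?R \<noteq> medges G'" using X(2) XE' by blast
  let ?W = "edge_verts G' X \<inter> edge_verts G' ?R"
  have link: "\<exists>y F. y \<noteq> x \<and> y \<in> ?W \<and> F \<in> evens G' \<and> bd G' (F \<inter> X) = {x} \<oplus> {y}" if x: "x \<in> ?W" for x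
  proof -
    obtain y where y: "y \<noteq> x" "y \<in> edge_verts G' ?R" "y \<in> edge_verts G' X" "reach G' ?R x y"
      using block_graph_partner[OF B' R(1) Rne, of x] x unfolding R(2) by blast
    have "reach G' X x y"
      using block_graph_reach[OF c', of x y] x y(3) by (simp add: reach_edge_restrict)
    then obtain P where P: "P \<subseteq> X" "bd G' P = {x} \<oplus> {y}" unfolding reach_def by blast
    obtain Q where Q: "Q \<subseteq> ?R" "bd G' Q = {x} \<oplus> {y}" using y(4) unfolding reach_def by blast
    have sub: "P \<subseteq> medges G" "Q \<subseteq> medges G" "P \<inter> Q = {}" using P(1) Q(1) X(1) E by blast+
    have "bd G' (P \<union> Q) = {}"
      using bd_Un[OF fin[OF sub(1)] fin[OF sub(2)] sub(3), of G'] P(2) Q(2) by simp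
    then have "P \<union> Q \<in> evens G'" using sub E unfolding evens_def by blast
    moreover have "(P \<union> Q) \<inter> X = P" using P(1) Q(1) by blast
    ultimately show ?thesis using P(2) y by (metis IntI)
  qed
  have unique: "bd G' (F1 \<inter> X) = bd G' (F2 \<inter> X)"
    if F: "F1 \<in> evens G'" "F2 \<in> evens G'" "bd G' (F1 \<inter> X) \<noteq> {}" "bd G' (F2 \<inter> X) \<noteq> {}" for F1 F2
  proof -
    have bdG: "bd G (F \<inter> X) = {p, q}" if F: "F \<in> evens G'" "bd G' (F \<inter> X) \<noteq> {}" for F
    proof -
      have FG: "F \<in> evens G" using F(1) Z by simp
      have sub: "bd G (F \<inter> X) \<subseteq> {p, q}" using bd_split_subset[OF G FG, of X] s by blast
      have FE: "F \<inter> X \<subseteq> medges G" using X(1) by blast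
      have even: "even (card (bd G (F \<inter> X)))" using even_card_bd[OF G FE] .
      have "bd G (F \<inter> X) \<noteq> {}"
      proof
        assume "bd G (F \<inter> X) = {}"
        then have "F \<inter> X \<in> evens G'" unfolding Z using FE unfolding evens_def by blast
        then show False using F(2) evensD(2) by blast
      qed
      then show ?thesis using even_subset_single[OF even, of p] even_subset_single[OF even, of q] sub by blast
    qed
    have f: "finite (F1 \<inter> X)" "finite (F2 \<inter> X)" using fin[OF X(1)] by auto
    have "bd G ((F1 \<inter> X) \<oplus> (F2 \<inter> X)) = {}" unfolding bd_symd[OF f] using bdG F by simp
    then have "(F1 \<inter> X) \<oplus> (F2 \<inter> X) \<in> evens G'" unfolding Z using X(1) unfolding evens_def by auto
    then have "bd G' (F1 \<inter> X) \<oplus> bd G' (F2 \<inter> X) = {}" using evensD(2) bd_symd[OF f, of G'] by metis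
    then show ?thesis by simp
  qed
  have "X \<noteq> medges G'" using X(3) E by simp
  then obtain x where x: "x \<in> ?W" using block_graph_two_verts[OF B' XE' X(2)] by blast
  obtain y F where y: "y \<noteq> x" "y \<in> ?W" "F \<in> evens G'" "bd G' (F \<inter> X) = {x} \<oplus> {y}" using link[OF x] by blast
  have "z \<in> {x, y}" if z: "z \<in> ?W" for z
  proof -
    obtain w F' where w: "w \<noteq> z" "F' \<in> evens G'" "bd G' (F' \<inter> X) = {z} \<oplus> {w}" using link[OF z] by blast
    have "{z} \<oplus> {w} = {x} \<oplus> {y}" using unique[OF w(2) y(3)] unfolding w(3) y(4) using w(1) y(1) by simp
    then have "{z, w} = {x, y}" using symd_singles w(1) y(1) by metis
    then show ?thesis by blast
  qed
  then have "?W \<subseteq> {x, y}" by blast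
  then have "two_sep G' X ?R x y" using two_sep_of_subset[OF B' XE' X(2)] X(3) E by simp
  then show ?thesis by blast
qed

text \<open>Otherwise \<open>X\<close> splits at a vertex \<open>v\<close> into two sets. Neither of
  them has both \<open>p\<close> and \<open>q\<close> among its vertices, as the other would then be
  attached at \<open>v\<close> alone. So each has at most two attachments and, by minimality, is a
  single edge; these two edges are in series.\<close>

lemma minimal_two_sep_block:
  assumes B: "block_graph G"
    and noser: "\<And>e f. e \<in> medges G \<Longrightarrow> f \<in> medges G \<Longrightarrow> cyclically_equivalent (evens G) e f \<Longrightarrow> e = f"
    and X: "X \<subseteq> medges G" "2 \<le> card X" "2 \<le> card (medges G - X)"
    and s: "edge_verts G X \<inter> edge_verts G (medges G - X) \<subseteq> {p, q}"
    and min: "\<And>Y r t. Y \<subseteq> medges G \<Longrightarrow> 2 \<le> card Y \<Longrightarrow> 2 \<le> card (medges G - Y) \<Longrightarrow>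
      edge_verts G Y \<inter> edge_verts G (medges G - Y) \<subseteq> {r, t} \<Longrightarrow> card X \<le> card Y"
  shows "block_graph (edge_restrict G X)"
proof (rule ccontr)
  note G = block_graphD(1)[OF B]
  let ?E = "medges G"
  have fin: "finite Y" if "Y \<subseteq> ?E" for Y using that multigraphD(2)[OF G] finite_subset by blast
  assume "\<not> block_graph (edge_restrict G X)"
  then obtain S v where S: "S \<subseteq> X" "S \<noteq> {}" "S \<noteq> X" and v: "edge_verts G S \<inter> edge_verts G (X - S) \<subseteq> {v}"
    unfolding block_graph_edge_restrict_iff[OF G X(1)] by blast
  have single: "card S = 1 \<and> \<not> {p, q} \<subseteq> edge_verts G S"
    if S: "S \<subseteq> X" "S \<noteq> {}" "S \<noteq> X" and v: "edge_verts G S \<inter> edge_verts G (X - S) \<subseteq> {v}" for S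
  proof -
    have SE: "S \<subseteq> ?E" "S \<noteq> ?E" using S X(1) by blast+
    have att: "edge_verts G S \<inter> edge_verts G (?E - S) \<subseteq> {v} \<union> (edge_verts G S \<inter> {p, q})"
      if S: "S \<subseteq> X" and v: "edge_verts G S \<inter> edge_verts G (X - S) \<subseteq> {v}" for S
    proof -
      have "?E - S = (X - S) \<union> (?E - X)" using S X(1) by blast
      then have "edge_verts G (?E - S) = edge_verts G (X - S) \<union> edge_verts G (?E - X)" using edge_verts_Un by metis
      then show ?thesis using v s edge_verts_mono[OF S, of G] by blast
    qed
    have notboth: "\<not> {p, q} \<subseteq> edge_verts G S"
    proof
      assume pq: "{p, q} \<subseteq> edge_verts G S"
      let ?T = "X - S"
      have "X - ?T = S" using S(1) by blast
      then have "edge_verts G ?T \<inter> edge_verts G (?E - ?T) \<subseteq> {v} \<union> (edge_verts G ?T \<inter> {p, q})"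
        using att[of ?T] v by (simp add: Int_commute)
      also have "\<dots> \<subseteq> {v}" using pq v by blast
      finally have "edge_verts G ?T \<inter> edge_verts G (?E - ?T) \<subseteq> {v}" .
      moreover have "?T \<subseteq> ?E" "?T \<noteq> {}" "?T \<noteq> ?E" using S X(1) by blast+
      ultimately show False using B unfolding block_graph_def by blast
    qed
    then obtain r where "edge_verts G S \<inter> {p, q} \<subseteq> {r}" by blast
    then have att': "edge_verts G S \<inter> edge_verts G (?E - S) \<subseteq> {v, r}" using att[OF S(1) v] by blast
    have less: "card S < card X" using S fin[OF X(1)] by (intro psubset_card_mono) auto
    have "card (?E - X) \<le> card (?E - S)" using S(1) fin[of "?E - S"] by (intro card_mono) auto
    then have "2 \<le> card (?E - S)" using X(3) by linarith
    then have "\<not> 2 \<le> card S" using min[OF SE(1) _ _ att'] less by linarith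
    moreover have "card S \<noteq> 0" using fin[OF SE(1)] S(2) by simp
    ultimately show ?thesis using notboth by linarith
  qed
  have S1: "card S = 1" "\<not> {p, q} \<subseteq> edge_verts G S" using single[OF S v] by auto
  have "X - (X - S) = S" using S(1) by blast
  then have T1: "card (X - S) = 1" using single[of "X - S"] S v by (auto simp: Int_commute)
  obtain e where e: "S = {e}" using S1(1) by (auto simp: card_1_singleton_iff)
  obtain f where f: "X - S = {f}" using T1 by (auto simp: card_1_singleton_iff)
  have Xef: "X = {e, f}" "e \<noteq> f" using e f S(1) by auto
  have efE: "e \<in> ?E" "f \<in> ?E" using Xef(1) X(1) by auto
  \<comment> \<open>An even set through \<open>g\<close> but not \<open>h\<close> would give
    \<open>g\<close> a boundary inside \<open>{p, q}\<close> that misses one of the two, hence an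
    empty one; but a nonseparable graph with a further edge has no loop.\<close>
  have key: "g \<in> Y \<Longrightarrow> h \<in> Y"
    if gh: "X = {g, h}" "g \<noteq> h" "\<not> {p, q} \<subseteq> edge_verts G {g}" and Y: "Y \<in> evens G" for g h Y
  proof (rule ccontr)
    assume g: "g \<in> Y" "h \<notin> Y"
    have "Y \<inter> X = {g}" using g gh(1) by blast
    then have sub: "bd G {g} \<subseteq> {p, q}" using bd_split_subset[OF G Y, of X] s by auto
    have gE: "g \<in> ?E" using gh(1) X(1) by blast
    have "bd G {g} \<subseteq> edge_verts G {g}" by (rule bd_subset)
    then obtain r where r: "bd G {g} \<subseteq> {r}" using sub gh(3) by blast
    have "even (card (bd G {g}))" by (rule even_card_bd[OF G]) (use gE in blast)
    then have "bd G {g} = {}" using r by (rule even_subset_single)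
    then have "card (mends G g) \<noteq> 2" unfolding bd_single by (auto split: if_splits)
    then have "?E = {g}" by (rule block_graph_loop[OF B gE])
    moreover have "h \<in> ?E" using gh(1) X(1) by simp
    ultimately show False using gh(2) by simp
  qed
  have T2: "\<not> {p, q} \<subseteq> edge_verts G {f}"
  proof -
    have "X - {f} = S" using Xef e by blast
    then show ?thesis using single[of "X - S"] S v f by (auto simp: Int_commute)
  qed
  have "cyclically_equivalent (evens G) e f" unfolding cyclically_equivalent_def
    using key[of e f] key[of f e] Xef S1(2) T2 e by (metis insert_commute)
  then show False using noser[OF efE] Xef(2) by blast
qed

text \<open>Two edges in series form a cut; twisting one side of it together with one of the two edges
  makes them adjacent.\<close>

lemma series_pair_switching:
  assumes B: "block_graph G" and ef: "e \<in> medges G" "f \<in> medges G" "e \<noteq> f"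
    and ser: "cyclically_equivalent (evens G) e f" and big: "3 \<le> card (medges G)"
  shows "\<exists>H a b. whitney_switching\<^sup>*\<^sup>* G H \<and> two_sep H {e, f} (medges G - {e, f}) a b"
proof -
  note G = block_graphD(1)[OF B] and F = block_graph_full[OF B]
  let ?E = "medges G"
  let ?X = "{e, f}"
  have X: "?X \<subseteq> ?E" "?X \<noteq> {}" using ef by auto
  have XE: "?X \<noteq> ?E"
  proof
    assume "?X = ?E"
    then have "card ?E = 2" using ef(3) by (metis card_2_iff)
    then show False using big by simp
  qed
  have loopless: "card (mends G g) = 2" if "g \<in> ?E" for g
    using block_graph_loop[OF B that] ef by (metis singletonD)
  have "orthogonal (evens G) ?X" unfolding orthogonal_def
  proof
    fix Y assume "Y \<in> evens G"
    then have "Y \<inter> ?X = {} \<or> Y \<inter> ?X = ?X" using ser unfolding cyclically_equivalent_def by blast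
    then show "even (card (Y \<inter> ?X))" using ef(3) by auto
  qed
  then obtain U where U: "U \<subseteq> mverts G" "?X = cut G U"
    using orthogonal_is_cut[OF G block_graph_reach[OF B] X(1)] by blast
  have cross: "\<exists>a b. mends G g = {a, b} \<and> a \<in> U \<and> b \<notin> U" if gX: "g \<in> ?X" for g
  proof -
    have g: "g \<in> cut G U" using gX U(2) by simp
    obtain a b where "mends G g = {a, b}" using ends_pair[OF G X(1) gX] by blast
    then show ?thesis using g unfolding cut_def by (auto simp: insert_commute)
  qed
  obtain a1 b1 where e: "mends G e = {a1, b1}" "a1 \<in> U" "b1 \<notin> U" using cross[of e] by auto
  obtain a2 b2 where f: "mends G f = {a2, b2}" "a2 \<in> U" "b2 \<notin> U" using cross[of f] by auto
  have finish: ?thesis if H: "whitney_switching\<^sup>*\<^sup>* G H"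
    "edge_verts H ?X \<inter> edge_verts H (?E - ?X) \<subseteq> {a, b}" for H a b
  proof -
    have sH: "full_mgraph H" "evens H = evens G" "medges H = medges G"
      using switchings_facts[OF H(1) F] by auto
    have "block_graph H" using block_graph_transfer[OF B sH(1,3,2)] .
    then have "two_sep H ?X (?E - ?X) a b" using two_sep_of_subset[of H ?X a b] X XE H(2) sH(3) by simp
    then show ?thesis using H(1) by blast
  qed
  have side: "mends G g \<subseteq> W \<or> mends G g \<inter> W = {}" if "?X = cut G W" "g \<in> ?E - ?X" for g W
    using that unfolding cut_def by blast
  \<comment> \<open>If \<open>e\<close> and \<open>f\<close> share the end \<open>a\<close> in
    \<open>W\<close>, no other edge is incident with \<open>a\<close>: the remaining edges inside
    \<open>W\<close> would be attached to the rest at \<open>a\<close> alone.\<close>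
  have adj: "edge_verts G ?X \<inter> edge_verts G (?E - ?X) \<subseteq> {b, b'}"
    if W: "?X = cut G W" and ab: "mends G e = {a, b}" "mends G f = {a, b'}" "a \<in> W" "b \<notin> W" "b' \<notin> W"
    for W a b b'
  proof -
    have VX: "edge_verts G ?X = {a, b, b'}" using ab(1,2) unfolding edge_verts_def by auto
    have "a \<notin> edge_verts G (?E - ?X)"
    proof
      assume "a \<in> edge_verts G (?E - ?X)"
      then obtain g where g: "g \<in> ?E - ?X" "a \<in> mends G g" unfolding edge_verts_def by blast
      define Y where "Y = {g \<in> ?E - ?X. mends G g \<subseteq> W}"
      have gY: "g \<in> Y" using side[OF W g(1)] g ab(3) unfolding Y_def by blast
      have "x = a" if x: "x \<in> edge_verts G Y" "x \<in> edge_verts G (?E - Y)" for x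
      proof -
        have xW: "x \<in> W" using x(1) unfolding Y_def edge_verts_def by blast
        obtain h where h: "h \<in> ?E - Y" "x \<in> mends G h" using x(2) unfolding edge_verts_def by blast
        have "h \<in> ?X"
        proof (rule ccontr)
          assume "h \<notin> ?X"
          then have "h \<in> Y" using side[OF W, of h] h xW unfolding Y_def by blast
          then show False using h(1) by blast
        qed
        then show "x = a" using h(2) ab xW by auto
      qed
      then have "edge_verts G Y \<inter> edge_verts G (?E - Y) \<subseteq> {a}" by blast
      moreover have "Y \<subseteq> ?E" "Y \<noteq> {}" "Y \<noteq> ?E" using gY ef(1) unfolding Y_def by blast+
      ultimately show False using B unfolding block_graph_def by blast
    qed
    then show ?thesis unfolding VX by blast
  qed
  consider "a1 = a2" | "b1 = b2" | "a1 \<noteq> a2" "b1 \<noteq> b2" by blast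
  then show ?thesis
  proof cases
    case 1
    show ?thesis using finish[OF rtranclp.rtrancl_refl adj[OF U(2) e(1) _ e(2,3) f(3)]] f(1) 1 by simp
  next
    case 2
    let ?W = "- U"
    have W: "?X = cut G ?W" using U(2) unfolding cut_def by blast
    have "mends G e = {b1, a1}" "mends G f = {b1, a2}" using e(1) f(1) 2 by auto
    then show ?thesis using finish[OF rtranclp.rtrancl_refl adj[OF W, of b1 a1 a2]] e f by simp
  next
    case 3
    define EU EV where "EU = {g \<in> ?E - ?X. mends G g \<subseteq> U}" and "EV = {g \<in> ?E - ?X. mends G g \<inter> U = {}}"
    have nonempty_ends: "mends G g \<noteq> {}" if "g \<in> ?E" for g using loopless[OF that] by auto
    have EUV: "EU \<union> EV = ?E - ?X" "EU \<inter> EV = {}"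
      using side[OF U(2)] nonempty_ends unfolding EU_def EV_def by blast+
    \<comment> \<open>The edge \<open>e\<close> joins the \<open>U\<close> side and \<open>f\<close>
      the other one, so the two sets meet exactly in \<open>b1\<close> and \<open>a2\<close>.
      Switching \<open>Y2\<close> moves the end \<open>a2\<close> of \<open>f\<close> to
      \<open>b1\<close>, an end of \<open>e\<close>.\<close>
    define Y1 Y2 where "Y1 = insert e EU" and "Y2 = insert f EV"
    have Y: "Y1 \<union> Y2 = ?E" "Y1 \<inter> Y2 = {}" using EUV ef unfolding Y1_def Y2_def by blast+
    have Y2eq: "?E - Y1 = Y2" using Y by blast
    have VU: "edge_verts G EU \<subseteq> U" and VV: "edge_verts G EV \<inter> U = {}"
      unfolding EU_def EV_def edge_verts_def by blast+
    have "edge_verts G Y1 \<inter> edge_verts G Y2 \<subseteq> {b1, a2}"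
      unfolding Y1_def Y2_def edge_verts_insert e(1) f(1) using VU VV e f by auto
    moreover have "Y1 \<subseteq> ?E" "Y1 \<noteq> {}" "Y1 \<noteq> ?E" using Y unfolding Y1_def Y2_def by blast+
    ultimately have s: "two_sep G Y1 Y2 b1 a2" using two_sep_of_subset[OF B, of Y1 b1 a2] unfolding Y2eq by blast
    define H where "H = switch G Y2 b1 a2"
    have w: "whitney_switching\<^sup>*\<^sup>* G H"
      using whitney_switching_iff[OF F, of H] s unfolding H_def by (auto intro: r_into_rtranclp)
    note D = two_sepD[OF s]
    have "e \<notin> Y2" "f \<in> Y2" using Y(2) unfolding Y1_def Y2_def by blast+
    then have ends: "mends H e = {a1, b1}" "mends H f = vswap b1 a2 ` {a2, b2}"
      unfolding H_def using switch_ends_other[OF G] e(1) f(1) D(10) by auto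
    have "b2 \<noteq> b1" "b2 \<noteq> a2" using 3(2) f(2,3) by auto
    then have "mends H f = {b1, b2}" unfolding ends(2) by simp
    then have VX: "edge_verts H ?X = {a1, b1, b2}" using ends(1) unfolding edge_verts_def by auto
    have VHU: "edge_verts H EU = edge_verts G EU" unfolding H_def
      by (rule edge_verts_switch(1)[OF G D(10)]) (use EUV ef in \<open>auto simp: Y2_def EU_def\<close>)
    have VHV: "edge_verts H EV = vswap b1 a2 ` edge_verts G EV" unfolding H_def
      by (rule edge_verts_switch(2)[OF G D(10)]) (auto simp: Y2_def)
    have "a2 \<notin> edge_verts G EV" using VV f(2) by blast
    then have "b1 \<notin> vswap b1 a2 ` edge_verts G EV" by (metis imageE vswap_simps(2) vswap_simps(3) vswap_simps(1))
    moreover have "b1 \<notin> edge_verts G EU" using VU e(3) by blast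
    ultimately have "b1 \<notin> edge_verts H (?E - ?X)" unfolding EUV(1)[symmetric] edge_verts_Un VHU VHV by blast
    then have "edge_verts H ?X \<inter> edge_verts H (?E - ?X) \<subseteq> {a1, b2}" unfolding VX by blast
    then show ?thesis by (rule finish[OF w])
  qed
qed

theorem whitney_block_graph:
  fixes G :: "('v, 'e) mgraph" and G' :: "('w, 'e) mgraph"
  assumes "block_graph G" "block_graph G'" "medges G' = medges G" "evens G' = evens G"
  shows "\<exists>H. whitney_switching\<^sup>*\<^sup>* G H \<and> mgraph_iso H G'"
  using assms
proof (induction "card (medges G)" arbitrary: G G' rule: less_induct)
  case less
  note B = less.prems(1) and B' = less.prems(2) and E = less.prems(3) and Z = less.prems(4)
  note G = block_graphD(1)[OF B]
  let ?E = "medges G"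
  have fE: "finite ?E" using multigraphD(2)[OF G] .
  \<comment> \<open>Stated for any two graphs on the edge set \<open>?E\<close>, because in the
    series case it is applied after both graphs have been switched. The parts are smaller than
    \<open>G\<close>, as one edge replaces a side with at least two.\<close>
  have sum: "\<exists>H. whitney_switching\<^sup>*\<^sup>* A H \<and> mgraph_iso H A'"
    if A: "block_graph A" "block_graph A'" "medges A' = ?E" "medges A = ?E" "evens A' = evens A"
      and s: "two_sep A X1 X2 u1 u2" "two_sep A' X1 X2 w1 w2" and c: "2 \<le> card X1" "2 \<le> card X2"
    for A :: "('v, 'e) mgraph" and A' :: "('w, 'e) mgraph" and X1 X2 u1 u2 w1 w2
  proof -
    have half: "\<exists>H. whitney_switching\<^sup>*\<^sup>* (part A X m u1 u2) H \<and> mgraph_iso H (part A' X m w1 w2)"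
      if s: "two_sep A X Y u1 u2" "two_sep A' X Y w1 w2" and m: "m \<in> Y" and c: "2 \<le> card Y" for X Y m
    proof (rule less.hyps)
      note D = two_sepD[OF s(1)]
      have fin: "finite X" "finite Y" using D(9,10) A(4) fE finite_subset by auto
      have "card (insert m X) \<le> card X + 1" using card_insert_le_m1 fin by (simp add: card_insert_if)
      also have "\<dots> < card X + card Y" using c by simp
      also have "\<dots> = card ?E" using card_Un_disjoint[OF fin D(2)] D(1) A(4) by simp
      finally show "card (medges (part A X m u1 u2)) < card ?E" by simp
      show "block_graph (part A X m u1 u2)" using block_graph_part[OF A(1) s(1) m] .
      show "block_graph (part A' X m w1 w2)" using block_graph_part[OF A(2) s(2) m] .
      show "medges (part A' X m w1 w2) = medges (part A X m u1 u2)" by simp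
      show "evens (part A' X m w1 w2) = evens (part A X m u1 u2)"
        using evens_part_eq[OF A(1,2) _ _ s m] A(3-5) by simp
    qed
    obtain m1 m2 where m: "m1 \<in> X1" "m2 \<in> X2" using c by (metis all_not_in_conv card.empty not_numeral_le_zero)
    show ?thesis
      by (rule switchings_from_parts[OF block_graph_full[OF A(1)] block_graph_full[OF A(2)] s m])
        (use half[OF s m(2) c(2)] half[OF two_sep_commute[OF s(1)] two_sep_commute[OF s(2)] m(1) c(1)] in auto)
  qed
  let ?sep = "\<lambda>X. X \<subseteq> ?E \<and> 2 \<le> card X \<and> 2 \<le> card (?E - X) \<and>
    (\<exists>p q. edge_verts G X \<inter> edge_verts G (?E - X) \<subseteq> {p, q})"
  consider "card (mverts G) \<le> 2" | "3 \<le> card (mverts G)" "\<not> (\<exists>X. ?sep X)"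
    | X e f where "?sep X" "e \<in> ?E" "f \<in> ?E" "e \<noteq> f" "cyclically_equivalent (evens G) e f"
    | X where "?sep X" "\<And>e f. e \<in> ?E \<Longrightarrow> f \<in> ?E \<Longrightarrow> cyclically_equivalent (evens G) e f \<Longrightarrow> e = f"
    by (metis not_less_eq_eq numeral_2_eq_2 numeral_3_eq_3)
  then show ?case
  proof cases
    case 1
    show ?thesis using iso_at_most_two_verts[OF B B' E Z 1] by blast
  next
    case 2
    have "mgraph_iso G G'" by (rule iso_three_connected[OF B B' E Z 2(1)]) (use 2(2) in blast)
    then show ?thesis by blast
  next
    case (3 X e f)
    have "card ?E = card X + card (?E - X)"
      using 3(1) fE by (metis card_Diff_subset card_mono finite_subset le_add_diff_inverse)
    then have big: "4 \<le> card ?E" using 3(1) by linarith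
    obtain A u1 u2 where A: "whitney_switching\<^sup>*\<^sup>* G A" "two_sep A {e, f} (?E - {e, f}) u1 u2"
      using series_pair_switching[OF B 3(2-5)] big by auto
    have "cyclically_equivalent (evens G') e f" using 3(5) Z by simp
    then obtain A' w1 w2 where A': "whitney_switching\<^sup>*\<^sup>* G' A'" "two_sep A' {e, f} (?E - {e, f}) w1 w2"
      using series_pair_switching[OF B', of e f] 3(2-4) big E by auto
    note fA = switchings_facts[OF A(1) block_graph_full[OF B]]
      and fA' = switchings_facts[OF A'(1) block_graph_full[OF B']]
    have bA: "block_graph A" "block_graph A'" using block_graph_transfer[OF B] block_graph_transfer[OF B'] fA fA' by auto
    have "card (?E - {e, f}) = card ?E - 2" using fE 3(2-4) by (simp add: card_Diff_subset)
    then have c: "2 \<le> card {e, f}" "2 \<le> card (?E - {e, f})" using big 3(4) by auto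
    obtain K where K: "whitney_switching\<^sup>*\<^sup>* A K" "mgraph_iso K A'"
      using sum[OF bA _ _ _ A(2) A'(2) c] fA fA' E Z by auto
    have FK: "full_mgraph K" using switchings_facts[OF K(1)] fA by blast
    \<comment> \<open>Switchings are reversible: those leading from \<open>A'\<close> back to
      \<open>G'\<close> are transported to the copy \<open>K\<close> of \<open>A'\<close>.\<close>
    have "mgraph_iso A' K" using mgraph_iso_sym[OF full_mgraphD(1)[OF FK] K(2)] .
    then obtain H where H: "whitney_switching\<^sup>*\<^sup>* K H" "mgraph_iso G' H"
      using switchings_transport[of A' G' K] fA' FK by blast
    have "mgraph_iso H G'" using mgraph_iso_sym[OF block_graphD(1)[OF B'] H(2)] .
    moreover have "whitney_switching\<^sup>*\<^sup>* G H" using A(1) K(1) H(1) by (meson rtranclp_trans)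
    ultimately show ?thesis by blast
  next
    case (4 X0)
    \<comment> \<open>A side with fewest edges is nonseparable by
      \<open>minimal_two_sep_block\<close>, which is what allows the separation to be found in
      \<open>G'\<close>.\<close>
    obtain X where X: "?sep X" and min: "\<And>Y. ?sep Y \<Longrightarrow> card X \<le> card Y"
      using ex_has_least_nat[of ?sep X0 card] 4(1) by blast
    then obtain p q where pq: "edge_verts G X \<inter> edge_verts G (?E - X) \<subseteq> {p, q}" by blast
    have XE: "X \<subseteq> ?E" "2 \<le> card X" "2 \<le> card (?E - X)" using X by auto
    have ne: "X \<noteq> {}" "X \<noteq> ?E" using XE by auto
    have c: "block_graph (edge_restrict G X)"
      by (rule minimal_two_sep_block[OF B 4(2) XE pq]) (use min in blast)+
    obtain w1 w2 where w: "two_sep G' X (?E - X) w1 w2"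
      using two_sep_transfer[OF B B' E Z XE(1) ne pq c] E by auto
    have "two_sep G X (?E - X) p q" using two_sep_of_subset[OF B XE(1) ne pq] .
    then show ?thesis using sum[OF B B' E refl Z _ w XE(2,3)] by blast
  qed
qed

section \<open>From nonseparable graphs to arbitrary ones\<close>

section \<open>Blocks\<close>

definition separators :: "'e set \<Rightarrow> 'e set set \<Rightarrow> 'e set set" where
  "separators E Z = {S. S \<subseteq> E \<and> (\<forall>X\<in>Z. X \<inter> S \<in> Z)}"

text \<open>Separators are the sets along which \<open>Z\<close> splits as a direct sum, and the
  minimal nonempty ones are the connected components of the cycle matroid. They depend on
  \<open>Z\<close> only, so graphs with the same edges and even sets share them.\<close>

definition space_blocks :: "'e set \<Rightarrow> 'e set set \<Rightarrow> 'e set set" where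
  "space_blocks E Z = {P \<in> separators E Z. P \<noteq> {} \<and> (\<forall>S\<in>separators E Z. S \<subseteq> P \<and> S \<noteq> {} \<longrightarrow> S = P)}"

lemma space_blocksD:
  assumes "P \<in> space_blocks E Z"
  shows "P \<subseteq> E" "P \<noteq> {}" "X \<in> Z \<Longrightarrow> X \<inter> P \<in> Z" "P \<in> separators E Z"
    "S \<in> separators E Z \<Longrightarrow> S \<subseteq> P \<Longrightarrow> S \<noteq> {} \<Longrightarrow> S = P"
  using assms unfolding space_blocks_def separators_def by auto

lemma separators_Int:
  assumes "S \<in> separators E Z" "T \<in> separators E Z" shows "S \<inter> T \<in> separators E Z"
proof -
  have "X \<inter> (S \<inter> T) \<in> Z" if "X \<in> Z" for X
    using assms that unfolding separators_def by (simp add: Int_assoc[symmetric])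
  then show ?thesis using assms unfolding separators_def by blast
qed

lemma separators_Diff:
  assumes Z: "binary_space E Z" and "S \<in> separators E Z" "T \<in> separators E Z"
  shows "S - T \<in> separators E Z"
proof -
  have "X \<inter> (S - T) \<in> Z" if X: "X \<in> Z" for X
  proof -
    have "X \<inter> S \<in> Z" using assms(2) X unfolding separators_def by blast
    moreover from this have "X \<inter> S \<inter> T \<in> Z" using assms(3) unfolding separators_def by blast
    ultimately have "(X \<inter> S) \<oplus> (X \<inter> S \<inter> T) \<in> Z" by (rule binary_spaceD(4)[OF Z])
    moreover have "(X \<inter> S) \<oplus> (X \<inter> S \<inter> T) = X \<inter> (S - T)" by auto
    ultimately show ?thesis by simp
  qed
  then show ?thesis using assms(2) unfolding separators_def by blast
qed

lemma space_blocks_disjoint: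
  assumes "P \<in> space_blocks E Z" "Q \<in> space_blocks E Z" "P \<inter> Q \<noteq> {}"
  shows "P = Q"
proof -
  have "P \<inter> Q \<in> separators E Z" using separators_Int space_blocksD(4) assms(1,2) by blast
  then have "P \<inter> Q = P" "P \<inter> Q = Q" using space_blocksD(5) assms by (metis inf_le1, metis inf_le2)
  then show ?thesis by blast
qed

text \<open>A smallest separator through \<open>e\<close> is minimal, since removing a smaller
  separator from it leaves a separator.\<close>

lemma space_blocks_cover:
  assumes Z: "binary_space E Z" and e: "e \<in> E"
  shows "\<exists>P\<in>space_blocks E Z. e \<in> P"
proof -
  let ?Q = "\<lambda>P. P \<in> separators E Z \<and> e \<in> P"
  have fE: "finite E" using binary_spaceD(1)[OF Z] .
  have "E \<in> separators E Z" unfolding separators_def using binary_spaceD(3)[OF Z] by (auto simp: Int_absorb2)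
  then have "?Q E" using e by blast
  then obtain P where P: "?Q P" and min: "\<And>S. ?Q S \<Longrightarrow> card P \<le> card S"
    using ex_has_least_nat[of ?Q E card] by blast
  have fP: "finite P" using P fE finite_subset unfolding separators_def by blast
  have "S = P" if S: "S \<in> separators E Z" "S \<subseteq> P" "S \<noteq> {}" for S
  proof (cases "e \<in> S")
    case True
    then have "card P \<le> card S" using min S(1) by blast
    then show ?thesis using card_seteq[OF fP S(2)] by blast
  next
    case False
    have "P - S \<in> separators E Z" using separators_Diff[OF Z] P S(1) by blast
    then have "card P \<le> card (P - S)" using min P False by blast
    moreover have "card (P - S) < card P" using fP S(2,3) by (intro psubset_card_mono) auto
    ultimately show ?thesis by simp
  qed
  then have "P \<in> space_blocks E Z" using P unfolding space_blocks_def by blast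
  then show ?thesis using P by blast
qed

lemma space_blocks_connected:
  assumes P: "P \<in> space_blocks E Z"
  shows "connected_space P {X \<in> Z. X \<subseteq> P}"
  unfolding connected_space_def
proof (intro allI impI, rule ccontr)
  fix S assume S: "S \<subseteq> P \<and> S \<noteq> {} \<and> S \<noteq> P" and n: "\<not> (\<exists>X\<in>{X \<in> Z. X \<subseteq> P}. X \<inter> S \<notin> {X \<in> Z. X \<subseteq> P})"
  note D = space_blocksD[OF P]
  have "X \<inter> S \<in> Z" if X: "X \<in> Z" for X
  proof -
    have "X \<inter> P \<inter> S \<in> Z" using n D(3)[OF X] by blast
    moreover have "X \<inter> P \<inter> S = X \<inter> S" using S by blast
    ultimately show ?thesis by simp
  qed
  then have "S \<in> separators E Z" using S D(1) unfolding separators_def by blast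
  then show False using D(5) S by blast
qed

lemma finite_space_blocks: "finite E \<Longrightarrow> finite (space_blocks E Z)"
  by (rule finite_subset[of _ "Pow E"]) (auto simp: space_blocks_def separators_def)

lemma block_graph_space_block:
  assumes G: "multigraph G" and P: "P \<in> space_blocks (medges G) (evens G)"
  shows "block_graph (edge_restrict G P)"
proof (rule connected_space_block_graph)
  note D = space_blocksD[OF P]
  show "multigraph (edge_restrict G P)" using multigraph_edge_restrict[OF G D(1)] .
  show "mverts (edge_restrict G P) = edge_verts (edge_restrict G P) (medges (edge_restrict G P))"
    by (simp add: edge_verts_edge_restrict)
  show "connected_space (medges (edge_restrict G P)) (evens (edge_restrict G P))"
    using space_blocks_connected[OF P] evens_edge_restrict[OF D(1)] by simp
qed

lemma connected_full_mgraph: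
  assumes G: "multigraph G" and c: "connected_mgraph G" and E: "medges G \<noteq> {}"
  shows "full_mgraph G"
proof -
  have "v \<in> edge_verts G (medges G)" if v: "v \<in> mverts G" for v
  proof (rule ccontr)
    assume n: "v \<notin> edge_verts G (medges G)"
    obtain e where e: "e \<in> medges G" using E by blast
    obtain a b where ab: "mends G e = {a, b}" using ends_pair[OF G order.refl e] by blast
    have aV: "a \<in> edge_verts G (medges G)" using edge_vertsI[OF e, of a G] ab by simp
    have "a \<in> mverts G" using multigraphD(3)[OF G e] ab by simp
    then have r: "reach G (medges G) v a" using c v connected_mgraph_reach[OF G] by blast
    have "a \<in> {v}"
    proof (rule reach_closed[OF G order.refl r])
      fix f assume "f \<in> medges G" "mends G f \<inter> {v} \<noteq> {}"
      then have "v \<in> edge_verts G (medges G)" unfolding edge_verts_def by blast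
      then show "mends G f \<subseteq> {v}" using n by blast
    qed simp
    then show False using aV n by simp
  qed
  then show ?thesis unfolding full_mgraph_def using G edge_verts_subset[OF G] by blast
qed

lemma nonseparable_block_graph:
  assumes H: "multigraph H" "nonseparable H" "medges H \<noteq> {}"
  shows "block_graph H"
proof -
  have c: "connected_mgraph H" using H(2) unfolding nonseparable_def by blast
  have F: "full_mgraph H" using connected_full_mgraph[OF H(1) c H(3)] .
  have False if X: "X \<subseteq> medges H" "X \<noteq> {}" "X \<noteq> medges H"
      and v: "edge_verts H X \<inter> edge_verts H (medges H - X) \<subseteq> {v}" for X v
  proof (cases "edge_verts H X \<inter> edge_verts H (medges H - X) = {}")
    case False
    then have eq: "edge_verts H X \<inter> edge_verts H (medges H - X) = {v}" using v by blast
    have "\<exists>X1 X2 v. X1 \<noteq> {} \<and> X2 \<noteq> {} \<and> X1 \<union> X2 = medges H \<and> X1 \<inter> X2 = {} \<and>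
        mverts (edge_restrict H X1) \<inter> mverts (edge_restrict H X2) = {v}"
      by (rule exI[of _ X], rule exI[of _ "medges H - X"], rule exI[of _ v]) (use X eq in auto)
    with H(2) show False unfolding nonseparable_def by argo
  next
    case True
    obtain e where e: "e \<in> X" using X(2) by blast
    obtain f where f: "f \<in> medges H - X" using X(1,3) by blast
    obtain a a' where a: "mends H e = {a, a'}" using ends_pair[OF H(1) X(1) e] by blast
    obtain b b' where b: "mends H f = {b, b'}" using ends_pair[OF H(1) order.refl, of f] f by blast
    have aX: "a \<in> edge_verts H X" using edge_vertsI[OF e, of a H] a by simp
    have bX: "b \<in> edge_verts H (medges H - X)" using edge_vertsI[OF f, of b H] b by simp
    have "a \<in> mverts H" "b \<in> mverts H" using aX bX edge_verts_subset[OF H(1)] by blast+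
    then have r: "reach H (medges H) a b" using c connected_mgraph_reach[OF H(1)] by blast
    have "b \<in> edge_verts H X"
    proof (rule reach_closed[OF H(1) order.refl r aX])
      fix g assume g: "g \<in> medges H" "mends H g \<inter> edge_verts H X \<noteq> {}"
      have "g \<in> X"
      proof (rule ccontr)
        assume "g \<notin> X"
        then have "mends H g \<subseteq> edge_verts H (medges H - X)" using g(1) unfolding edge_verts_def by blast
        then show False using g(2) True by blast
      qed
      then show "mends H g \<subseteq> edge_verts H X" unfolding edge_verts_def by blast
    qed
    then show False using bX True by blast
  qed
  then show ?thesis using F unfolding block_graph_def full_mgraph_def by blast
qed

lemma block_graph_nonseparable:
  assumes B: "block_graph H" and E: "medges H \<noteq> {}"
  shows "nonseparable H"
proof -
  note H = block_graphD(1)[OF B]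
  obtain e where e: "e \<in> medges H" using E by blast
  obtain a b where "mends H e = {a, b}" using ends_pair[OF H order.refl e] by blast
  then have "mverts H \<noteq> {}" using multigraphD(3)[OF H e] by auto
  then have "connected_mgraph H" using connected_mgraph_reach[OF H] block_graph_reach[OF B] by blast
  moreover have "\<not> (\<exists>X1 X2 v. X1 \<noteq> {} \<and> X2 \<noteq> {} \<and> X1 \<union> X2 = medges H \<and> X1 \<inter> X2 = {} \<and>
          mverts (edge_restrict H X1) \<inter> mverts (edge_restrict H X2) = {v})"
  proof
    assume "\<exists>X1 X2 v. X1 \<noteq> {} \<and> X2 \<noteq> {} \<and> X1 \<union> X2 = medges H \<and> X1 \<inter> X2 = {} \<and>
          mverts (edge_restrict H X1) \<inter> mverts (edge_restrict H X2) = {v}"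
    then obtain X1 X2 v where X: "X1 \<noteq> {}" "X2 \<noteq> {}" "X1 \<union> X2 = medges H" "X1 \<inter> X2 = {}"
          "edge_verts H X1 \<inter> edge_verts H X2 = {v}" unfolding edge_restrict_sel(1) by blast
    have "medges H - X1 = X2" "X1 \<subseteq> medges H" "X1 \<noteq> medges H" using X(2-4) by blast+
    then show False using B X(1,5) unfolding block_graph_def by blast
  qed
  ultimately show ?thesis unfolding nonseparable_def by blast
qed

lemma msubgraph_edge_restrict:
  assumes "multigraph G" "X \<subseteq> medges G"
  shows "msubgraph (edge_restrict G X) G"
  unfolding msubgraph_def using multigraph_edge_restrict[OF assms] assms edge_verts_subset[OF assms(1)] by auto

text \<open>Blocks are maximal subgraphs while \<open>space_blocks\<close> are minimal separators.
  They agree because a nonseparable subgraph sharing an edge with a minimal separator lies inside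
  it.\<close>

lemma mblocks_eq:
  assumes F: "full_mgraph G"
  shows "mblocks G = edge_restrict G ` space_blocks (medges G) (evens G)"
proof -
  note G = full_mgraphD(1)[OF F]
  let ?B = "space_blocks (medges G) (evens G)"
  have Z: "binary_space (medges G) (evens G)" using binary_space_evens[OF G] .
  have inter: "medges K \<subseteq> P"
    if P: "P \<in> ?B" and K: "msubgraph K G" "block_graph K" and ne: "medges K \<inter> P \<noteq> {}" for P K
  proof -
    note DK = msubgraphD[OF K(1)] and DP = space_blocksD[OF P]
    have "X \<inter> (medges K \<inter> P) \<in> evens K" if X: "X \<in> evens K" for X
    proof -
      have "X \<in> evens G" "X \<subseteq> medges K" using X evens_msubgraph[OF K(1)] by auto
      then have "X \<inter> P \<in> evens K" using DP(3) evens_msubgraph[OF K(1)] by auto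
      moreover have "X \<inter> (medges K \<inter> P) = X \<inter> P" using \<open>X \<subseteq> medges K\<close> by blast
      ultimately show ?thesis by simp
    qed
    then have "medges K \<inter> P = medges K"
      using block_graph_connected_space[OF K(2)] ne unfolding connected_space_def by (metis inf_le1)
    then show ?thesis by blast
  qed
  have sub: "msubgraph K (edge_restrict G P)"
    if K: "msubgraph K G" "medges K \<subseteq> P" "mverts K \<subseteq> edge_verts G P" for P K
    unfolding msubgraph_def using msubgraphD[OF K(1)] K(2,3) by auto
  have nonsepP: "nonseparable (edge_restrict G P)" if P: "P \<in> ?B" for P
    using block_graph_nonseparable[OF block_graph_space_block[OF G P]] space_blocksD(2)[OF P] by simp
  show ?thesis
  proof (intro equalityI subsetI)
    fix H assume "H \<in> mblocks G"
    then have H: "msubgraph H G" "nonseparable H"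
      and max: "\<And>K. msubgraph K G \<Longrightarrow> nonseparable K \<Longrightarrow> msubgraph H K \<Longrightarrow> K = H"
      unfolding mblocks_def by auto
    note DH = msubgraphD[OF H(1)]
    have "\<exists>P\<in>?B. msubgraph H (edge_restrict G P)"
    proof (cases "medges H = {}")
      \<comment> \<open>A single vertex is nonseparable too, but it lies on some edge and hence
        inside the subgraph of a member of \<open>?B\<close>.\<close>
      case True
      have c: "connected_mgraph H" using H(2) unfolding nonseparable_def by blast
      then obtain v where v: "v \<in> mverts H" unfolding connected_mgraph_def by blast
      have "w = v" if w: "w \<in> mverts H" for w
      proof -
        have r: "reach H (medges H) v w" using c v w connected_mgraph_reach[OF DH(1)] by blast
        have "w \<in> {v}" by (rule reach_closed[OF DH(1) order.refl r]) (use True in auto)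
        then show ?thesis by simp
      qed
      then have VH: "mverts H = {v}" using v by blast
      have "v \<in> edge_verts G (medges G)" using v DH(2) full_mgraphD(2)[OF F] by blast
      then obtain e where e: "e \<in> medges G" "v \<in> mends G e" using edge_vertsE by metis
      then obtain P where P: "P \<in> ?B" "e \<in> P" using space_blocks_cover[OF Z] by blast
      have "v \<in> edge_verts G P" using edge_vertsI[OF P(2) e(2)] .
      then show ?thesis using sub[OF H(1)] True VH P(1) by auto
    next
      case False
      have bH: "block_graph H" using nonseparable_block_graph[OF DH(1) H(2) False] .
      obtain e where e: "e \<in> medges H" using False by blast
      then obtain P where P: "P \<in> ?B" "e \<in> P" using space_blocks_cover[OF Z, of e] DH(3) by blast
      have HP: "medges H \<subseteq> P" using inter[OF P(1) H(1) bH] e P(2) by blast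
      have "mverts H = edge_verts G (medges H)"
        using block_graphD(2)[OF bH] edge_verts_cong[of "medges H" H G] DH(4) by simp
      then have "mverts H \<subseteq> edge_verts G P" using edge_verts_mono[OF HP, of G] by simp
      then show ?thesis using sub[OF H(1) HP] P(1) by blast
    qed
    then obtain P where P: "P \<in> ?B" "msubgraph H (edge_restrict G P)" by blast
    have "edge_restrict G P = H"
      by (rule max[OF msubgraph_edge_restrict[OF G space_blocksD(1)[OF P(1)]] nonsepP[OF P(1)] P(2)])
    then show "H \<in> edge_restrict G ` ?B" using P(1) by blast
  next
    fix H assume "H \<in> edge_restrict G ` ?B"
    then obtain P where P: "P \<in> ?B" "H = edge_restrict G P" by blast
    note DP = space_blocksD[OF P(1)]
    have HG: "msubgraph H G" unfolding P(2) by (rule msubgraph_edge_restrict[OF G DP(1)])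
    have "K = H" if K: "msubgraph K G" "nonseparable K" "msubgraph H K" for K
    proof -
      have PK: "P \<subseteq> medges K" using msubgraphD(3)[OF K(3)] P(2) by simp
      then have "medges K \<noteq> {}" "medges K \<inter> P \<noteq> {}" using DP(2) by blast+
      then have bK: "block_graph K" and KP: "medges K \<subseteq> P"
        using nonseparable_block_graph[OF msubgraphD(1)[OF K(1)] K(2)] inter[OF P(1) K(1)] by blast+
      have "mverts K = edge_verts G (medges K)"
        using block_graphD(2)[OF bK] edge_verts_cong[of "medges K" K G] msubgraphD(4)[OF K(1)] by simp
      then have "mverts K \<subseteq> edge_verts G P" using edge_verts_mono[OF KP, of G] by simp
      then have "msubgraph K H" unfolding P(2) by (rule sub[OF K(1) KP])
      then show "K = H" using msubgraph_antisym K(3) by blast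
    qed
    then show "H \<in> mblocks G" unfolding mblocks_def using HG nonsepP[OF P(1)] P(2) by blast
  qed
qed

section \<open>Identifying vertices through a map\<close>

section \<open>Quotients of graphs\<close>

lemma cut_quotient:
  assumes "medges G = medges F" "\<And>e. e \<in> medges F \<Longrightarrow> mends G e = f ` mends F e" "\<And>e. e \<in> medges F \<Longrightarrow> mends F e \<subseteq> V"
  shows "cut G {w} = cut F {x \<in> V. f x = w}"
proof -
  have "mends G e \<inter> {w} \<noteq> {} \<longleftrightarrow> mends F e \<inter> {x \<in> V. f x = w} \<noteq> {}"
    "mends G e \<subseteq> {w} \<longleftrightarrow> mends F e \<subseteq> {x \<in> V. f x = w}" if "e \<in> medges F" for e
    using assms(2,3)[OF that] by auto
  then show ?thesis unfolding cut_def using assms(1) by blast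
qed

text \<open>The star of a vertex of the quotient is the cut of its preimage, so even sets remain
  even.\<close>

lemma evens_quotient:
  assumes F: "multigraph F" and G: "multigraph G" and E: "medges G = medges F"
    and f: "\<And>e. e \<in> medges F \<Longrightarrow> mends G e = f ` mends F e"
  shows "evens F \<subseteq> evens G"
proof
  fix X assume X: "X \<in> evens F"
  show "X \<in> evens G"
  proof (rule evens_by_stars[OF G])
    show "X \<subseteq> medges G" using evensD(1)[OF X] E by simp
    fix w
    have "cut G {w} = cut F {x \<in> mverts F. f x = w}" by (rule cut_quotient[OF E f multigraphD(3)[OF F]])
    then show "even (card (X \<inter> cut G {w}))"
      using orthogonal_cut[OF F] X unfolding orthogonal_def by metis
  qed
qed

lemma evens_iso:
  assumes G: "multigraph G" and H: "multigraph H" and iso: "mgraph_iso G H"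
  shows "evens H = evens G" "medges H = medges G"
proof -
  have *: "evens A \<subseteq> evens C \<and> medges C = medges A"
    if A: "multigraph A" "multigraph C" "mgraph_iso A C" for A :: "('x, 'b) mgraph" and C :: "('y, 'b) mgraph"
  proof -
    obtain f where "medges C = medges A" "\<And>e. e \<in> medges A \<Longrightarrow> mends C e = f ` mends A e"
      using A(3) unfolding mgraph_iso_def by blast
    then show ?thesis using evens_quotient[OF A(1,2)] by blast
  qed
  show "evens H = evens G" "medges H = medges G"
    using *[OF G H iso] *[OF H G mgraph_iso_sym[OF G iso]] by auto
qed

text \<open>If the quotient map is not injective, then two vertices with the same image lie in distinct
  components, as a path between them would become an even set in the quotient only.\<close>

lemma merge_components:
  fixes F :: "('u, 'e) mgraph" and G :: "('w, 'e) mgraph"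
  assumes "multigraph F" "multigraph G" "medges G = medges F"
    "\<And>e. e \<in> medges F \<Longrightarrow> mends G e = f ` mends F e" "f ` mverts F = mverts G" "evens G = evens F"
  shows "\<exists>H. vertex_identification\<^sup>*\<^sup>* F H \<and> mgraph_iso H G"
  using assms
proof (induction "card (mverts F)" arbitrary: F rule: less_induct)
  case less
  note F = less.prems(1) and G = less.prems(2) and E = less.prems(3) and f = less.prems(4)
    and im = less.prems(5) and Z = less.prems(6)
  have fV: "finite (mverts F)" using multigraphD(1)[OF F] .
  show ?case
  proof (cases "inj_on f (mverts F)")
    case True
    then have "bij_betw f (mverts F) (mverts G)" using im unfolding bij_betw_def by simp
    then have "mgraph_iso F G" unfolding mgraph_iso_def using E f by blast
    then show ?thesis by blast
  next
    case False
    then obtain u v where uv: "u \<in> mverts F" "v \<in> mverts F" "u \<noteq> v" "f u = f v" unfolding inj_on_def by blast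
    have nr: "\<not> reach F (medges F) u v"
    proof
      assume "reach F (medges F) u v"
      then obtain Q where Q: "Q \<subseteq> medges F" "bd F Q = {u} \<oplus> {v}" unfolding reach_def by blast
      have Q2: "bd F Q = {u, v}" using Q(2) symd_singles[OF uv(3)] by simp
      have "Q \<in> evens G"
      proof (rule evens_by_stars[OF G])
        show "Q \<subseteq> medges G" using Q(1) E by simp
        fix w
        let ?U = "{x \<in> mverts F. f x = w}"
        have "{u, v} \<inter> ?U = {} \<or> {u, v} \<inter> ?U = {u, v}" using uv by auto
        then have "even (card (bd F Q \<inter> ?U))" unfolding Q2 using uv(3) by auto
        then have "even (card (Q \<inter> cut F ?U))" using handshake[OF F Q(1)] by blast
        moreover have "cut G {w} = cut F ?U" by (rule cut_quotient[OF E f multigraphD(3)[OF F]])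
        ultimately show "even (card (Q \<inter> cut G {w}))" by simp
      qed
      then show False using Z evensD(2) Q2 by blast
    qed
    let ?id = "id(v := u)"
    define F' where "F' = make_mgraph (mverts F - {v}) (medges F) (\<lambda>e. ?id ` mends F e)"
    have sel: "mverts F' = mverts F - {v}" "medges F' = medges F" "\<And>e. e \<in> medges F \<Longrightarrow> mends F' e = ?id ` mends F e"
      unfolding F'_def by auto
    let ?C = "\<lambda>x. reach_class F (medges F) x"
    have comp: "induced F (?C x) \<in> mcomponents F" if "x \<in> mverts F" for x
      using that unfolding mcomponents_eq[OF F] by blast
    have "?C u \<noteq> ?C v" using reach_class_eq[OF F order.refl uv(1,2)] nr by blast
    then have "induced F (?C u) \<noteq> induced F (?C v)" by (metis induced_def make_mgraph_sel(1))
    moreover have "u \<in> mverts (induced F (?C u))" "v \<in> mverts (induced F (?C v))"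
      using reach_class_self uv(1,2) unfolding induced_def by fastforce+
    ultimately have vi: "vertex_identification F F'"
      unfolding vertex_identification_def F'_def using comp uv(1,2) by blast
    have mF': "multigraph F'" unfolding multigraph_def
    proof (intro conjI ballI allI impI)
      show "finite (mverts F')" "finite (medges F')" using sel fV multigraphD(2)[OF F] by auto
      fix e
      { assume e: "e \<in> medges F'"
        then have eF: "e \<in> medges F" using sel(2) by simp
        show "mends F' e \<subseteq> mverts F'" unfolding sel(3)[OF eF] sel(1)
          using multigraphD(3)[OF F eF] uv by auto
        obtain a b where ab: "mends F e = {a, b}" using ends_pair[OF F order.refl eF] by blast
        have "card {?id a, ?id b} \<in> {1, 2}" by (simp add: card_insert_if del: fun_upd_apply)
        then show "card (mends F' e) \<in> {1, 2}" unfolding sel(3)[OF eF] ab image_insert image_empty . }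
      { assume "e \<notin> medges F'"
        then show "mends F' e = {}" unfolding F'_def by simp }
    qed
    have fid: "f (?id x) = f x" for x using uv(4) by simp
    have f': "mends G e = f ` mends F' e" if "e \<in> medges F'" for e
    proof -
      have "e \<in> medges F" using that sel(2) by simp
      then show ?thesis using f sel(3) by (simp only: image_image fid)
    qed
    have im': "f ` mverts F' = mverts G"
    proof -
      have "f v \<in> f ` (mverts F - {v})" using uv by (metis DiffI imageI singletonD)
      then have "f ` (mverts F - {v}) = f ` mverts F" using uv(2) by blast
      then show ?thesis using im sel(1) by simp
    qed
    have E': "medges G = medges F'" using E sel(2) by simp
    have "evens F \<subseteq> evens F'" by (rule evens_quotient[OF F mF' sel(2,3)])
    moreover have "evens F' \<subseteq> evens G" by (rule evens_quotient[OF mF' G E' f'])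
    ultimately have Z': "evens G = evens F'" using Z by blast
    have "card (mverts F') < card (mverts F)" unfolding sel(1) using fV uv(2) by (rule card_Diff1_less)
    from less.hyps[OF this mF' G E' f' im' Z'] obtain H where
      H: "vertex_identification\<^sup>*\<^sup>* F' H" "mgraph_iso H G" by blast
    then show ?thesis using vi by (meson converse_rtranclp_into_rtranclp)
  qed
qed

section \<open>Switching the blocks of a graph independently\<close>

lemma lift_switching_component:
  assumes F: "full_mgraph F" and P: "P \<subseteq> medges F" and d: "edge_verts F P \<inter> edge_verts F (medges F - P) = {}"
    and w: "whitney_switching (edge_restrict F P) K"
  shows "\<exists>F'. whitney_switching F F' \<and> edge_restrict F' P = K \<and>
    (\<forall>Q. Q \<inter> P = {} \<longrightarrow> edge_restrict F' Q = edge_restrict F Q)"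
proof -
  note mF = full_mgraphD(1)[OF F]
  let ?R = "edge_restrict F P"
  have FR: "full_mgraph ?R" unfolding full_mgraph_def
    using multigraph_edge_restrict[OF mF P] by (simp add: edge_verts_edge_restrict)
  obtain Y1 Y2 y1 y2 where s: "two_sep ?R Y1 Y2 y1 y2" and K: "K = switch ?R Y2 y1 y2"
    using w whitney_switching_iff[OF FR] by blast
  note D = two_sepD[OF s]
  have Y: "Y1 \<union> Y2 = P" "Y1 \<subseteq> P" "Y2 \<subseteq> P" using D(1,9,10) by auto
  have V: "edge_verts ?R Y1 = edge_verts F Y1" "edge_verts ?R Y2 = edge_verts F Y2"
    by (rule edge_verts_edge_restrict[OF Y(2)], rule edge_verts_edge_restrict[OF Y(3)])
  \<comment> \<open>All edges outside \<open>P\<close> join the first side. They share no vertex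
    with \<open>P\<close>, so they add no attachment.\<close>
  let ?Z = "Y1 \<union> (medges F - P)"
  have "edge_verts F Y2 \<subseteq> edge_verts F P" using edge_verts_mono[OF Y(3)] .
  then have "edge_verts F ?Z \<inter> edge_verts F Y2 = {y1, y2}"
    using d D(4) unfolding edge_verts_Un V by blast
  moreover have "?Z \<union> Y2 = medges F" "?Z \<inter> Y2 = {}" using Y P D(2) by blast+
  ultimately have sF: "two_sep F ?Z Y2 y1 y2" using D(3) unfolding two_sep_def by simp
  define F' where "F' = switch F Y2 y1 y2"
  have wF: "whitney_switching F F'" using whitney_switching_iff[OF F] sF unfolding F'_def by blast
  have Y2F: "Y2 \<subseteq> medges F" using Y(3) P by blast
  have ends: "mends F' e = mends K e" if e: "e \<in> P" for e
  proof (cases "e \<in> Y2")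
    case True
    then show ?thesis unfolding F'_def K using Y2F D(10) e by simp
  next
    case False
    then show ?thesis unfolding F'_def K
      using switch_ends_other[OF mF False] switch_ends_other[OF full_mgraphD(1)[OF FR] False] e by simp
  qed
  note fK = whitney_switching_facts[OF FR w] and fF' = whitney_switching_facts[OF F wF]
  have "edge_restrict F' P = K"
  proof (rule mgraph_eqI)
    show "multigraph (edge_restrict F' P)"
      using multigraph_edge_restrict[OF full_mgraphD(1)[OF fF'(1)]] fF'(4) P by simp
    show "multigraph K" using full_mgraphD(1)[OF fK(1)] .
    have "edge_verts F' P = edge_verts K P" by (rule edge_verts_cong) (rule ends)
    then show "mverts (edge_restrict F' P) = mverts K" using full_mgraphD(2)[OF fK(1)] fK(4) by simp
    show "medges (edge_restrict F' P) = medges K" using fK(4) by simp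
    show "mends (edge_restrict F' P) e = mends K e" if "e \<in> medges (edge_restrict F' P)" for e
      using that ends by simp
  qed
  moreover have "edge_restrict F' Q = edge_restrict F Q" if "Q \<inter> P = {}" for Q
  proof -
    have e: "mends F' e = mends F e" if "e \<in> Q" for e
      unfolding F'_def by (rule switch_ends_other[OF mF]) (use that \<open>Q \<inter> P = {}\<close> Y(3) in blast)
    have "(\<Union>e\<in>Q. mends F' e) = (\<Union>e\<in>Q. mends F e)" using e by simp
    moreover have "(\<lambda>e. if e \<in> Q then mends F' e else {}) = (\<lambda>e. if e \<in> Q then mends F e else {})"
      using e by (intro ext) simp
    ultimately show ?thesis unfolding edge_restrict_def make_mgraph_def by simp
  qed
  ultimately show ?thesis using wF by blast
qed

lemma lift_switchings_component:
  assumes w: "whitney_switching\<^sup>*\<^sup>* (edge_restrict F P) K"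
    and F: "full_mgraph F" and P: "P \<subseteq> medges F" and d: "edge_verts F P \<inter> edge_verts F (medges F - P) = {}"
  shows "\<exists>F'. whitney_switching\<^sup>*\<^sup>* F F' \<and> edge_restrict F' P = K \<and>
    (\<forall>Q. Q \<inter> P = {} \<longrightarrow> edge_restrict F' Q = edge_restrict F Q)"
  using w
proof (induction rule: rtranclp_induct)
  case base
  then show ?case by blast
next
  case (step K L)
  obtain F' where F': "whitney_switching\<^sup>*\<^sup>* F F'" "edge_restrict F' P = K"
    "\<forall>Q. Q \<inter> P = {} \<longrightarrow> edge_restrict F' Q = edge_restrict F Q" using step.IH by blast
  have FF': "full_mgraph F'" and EF': "medges F' = medges F" using switchings_facts[OF F'(1) F] by auto
  have FR: "full_mgraph (edge_restrict F P)" unfolding full_mgraph_def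
    using multigraph_edge_restrict[OF full_mgraphD(1)[OF F] P] by (simp add: edge_verts_edge_restrict)
  have "mverts K = edge_verts F P" using switchings_facts[OF step.hyps(1) FR] by simp
  then have 1: "edge_verts F' P = edge_verts F P" using F'(2) by (metis edge_restrict_sel(1))
  have "(medges F - P) \<inter> P = {}" by blast
  then have 2: "edge_verts F' (medges F - P) = edge_verts F (medges F - P)"
    using F'(3) by (metis edge_restrict_sel(1))
  have d': "edge_verts F' P \<inter> edge_verts F' (medges F' - P) = {}" using d 1 2 EF' by simp
  have P': "P \<subseteq> medges F'" using P EF' by simp
  obtain L' where L': "whitney_switching F' L'" "edge_restrict L' P = L"
    "\<forall>Q. Q \<inter> P = {} \<longrightarrow> edge_restrict L' Q = edge_restrict F' Q"
    using lift_switching_component[OF FF' P' d', of L] step.hyps(2) F'(2) by auto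
  have "whitney_switching\<^sup>*\<^sup>* F L'" using F'(1) L'(1) by (rule rtranclp.rtrancl_into_rtrancl)
  moreover have "\<forall>Q. Q \<inter> P = {} \<longrightarrow> edge_restrict L' Q = edge_restrict F Q" using L'(3) F'(3) by simp
  ultimately show ?case using L'(2) by blast
qed

text \<open>The blocks are treated one at a time. The last conjunct, that all blocks stay
  vertex-disjoint from the remaining edges, is what permits lifting the switchings of the next
  block.\<close>

lemma switch_all_blocks:
  fixes F :: "('v, 'e) mgraph" and G :: "('w, 'e) mgraph"
  assumes F: "full_mgraph F" and G: "multigraph G" and E: "medges G = medges F" and Z: "evens G = evens F"
    and disj: "\<And>P. P \<in> space_blocks (medges F) (evens F) \<Longrightarrow>
      edge_verts F P \<inter> edge_verts F (medges F - P) = {}"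
    and Q: "finite \<Q>" "\<Q> \<subseteq> space_blocks (medges F) (evens F)"
  shows "\<exists>F'. whitney_switching\<^sup>*\<^sup>* F F' \<and>
    (\<forall>P\<in>\<Q>. mgraph_iso (edge_restrict F' P) (edge_restrict G P)) \<and>
    (\<forall>P\<in>space_blocks (medges F) (evens F).
      edge_verts F' P \<inter> edge_verts F' (medges F - P) = {})"
  using Q
proof (induction \<Q> rule: finite_induct)
  case empty
  then show ?case using disj by (intro exI[of _ F]) auto
next
  case (insert P \<Q>)
  let ?B = "space_blocks (medges F) (evens F)"
  obtain F' where F': "whitney_switching\<^sup>*\<^sup>* F F'"
    and iso: "\<forall>P\<in>\<Q>. mgraph_iso (edge_restrict F' P) (edge_restrict G P)"
    and disj': "\<forall>P\<in>?B. edge_verts F' P \<inter> edge_verts F' (medges F - P) = {}"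
    using insert.IH insert.prems by blast
  have P: "P \<in> ?B" using insert.prems by blast
  note f' = switchings_facts[OF F' F]
  have FF': "full_mgraph F'" and EF': "medges F' = medges F" and ZF': "evens F' = evens F" using f' by auto
  note PE = space_blocksD(1)[OF P]
  have PF': "P \<in> space_blocks (medges F') (evens F')" and PG: "P \<in> space_blocks (medges G) (evens G)"
    using P EF' ZF' E Z by auto
  have "medges (edge_restrict G P) = medges (edge_restrict F' P)" by simp
  moreover have "evens (edge_restrict G P) = evens (edge_restrict F' P)"
    using evens_edge_restrict[of P G] evens_edge_restrict[of P F'] PE E EF' Z ZF' by simp
  ultimately obtain K where K: "whitney_switching\<^sup>*\<^sup>* (edge_restrict F' P) K" "mgraph_iso K (edge_restrict G P)"
    using whitney_block_graph[OF block_graph_space_block[OF full_mgraphD(1)[OF FF'] PF'] block_graph_space_block[OF G PG]]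
    by blast
  have d: "edge_verts F' P \<inter> edge_verts F' (medges F' - P) = {}" using disj' P EF' by simp
  have PE': "P \<subseteq> medges F'" using PE EF' by simp
  obtain H where H: "whitney_switching\<^sup>*\<^sup>* F' H" "edge_restrict H P = K"
    "\<forall>Q. Q \<inter> P = {} \<longrightarrow> edge_restrict H Q = edge_restrict F' Q"
    using lift_switchings_component[OF K(1) FF' PE' d] by blast
  have other: "Q \<inter> P = {}" if "Q \<in> ?B" "Q \<noteq> P" for Q using space_blocks_disjoint[OF that(1) P] that(2) by blast
  have FR: "full_mgraph (edge_restrict F' P)"
    using block_graph_full[OF block_graph_space_block[OF full_mgraphD(1)[OF FF'] PF']] .
  have VP: "edge_verts H P = edge_verts F' P"
    using switchings_facts[OF K(1) FR] H(2) by (metis edge_restrict_sel(1))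
  have VQ: "edge_verts H Q = edge_verts F' Q" if "Q \<inter> P = {}" for Q
    using H(3) that by (metis edge_restrict_sel(1))
  have Vall: "edge_verts H X = edge_verts F' X" if X: "P \<subseteq> X" for X
  proof -
    have "X = P \<union> (X - P)" using X by blast
    then have "edge_verts A X = edge_verts A P \<union> edge_verts A (X - P)" for A :: "('v, 'e) mgraph"
      using edge_verts_Un by metis
    moreover have "(X - P) \<inter> P = {}" by blast
    ultimately show ?thesis using VP VQ by metis
  qed
  have "edge_verts H Q \<inter> edge_verts H (medges F - Q) = {}" if Q: "Q \<in> ?B" for Q
  proof (cases "Q = P")
    case True
    have "(medges F - P) \<inter> P = {}" by blast
    then show ?thesis unfolding True using VP VQ disj' P by metis
  next
    case False
    then have QP: "Q \<inter> P = {}" using other Q by blast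
    then have "P \<subseteq> medges F - Q" using PE by blast
    then show ?thesis using VQ[OF QP] Vall disj' Q by simp
  qed
  moreover have "\<forall>Q\<in>insert P \<Q>. mgraph_iso (edge_restrict H Q) (edge_restrict G Q)"
  proof
    fix Q assume Q: "Q \<in> insert P \<Q>"
    show "mgraph_iso (edge_restrict H Q) (edge_restrict G Q)"
    proof (cases "Q = P")
      case True
      then show ?thesis using H(2) K(2) by simp
    next
      case False
      then have "Q \<in> \<Q>" "Q \<inter> P = {}" using Q other insert.prems by blast+
      then show ?thesis using H(3) iso by simp
    qed
  qed
  moreover have "whitney_switching\<^sup>*\<^sup>* F H" using F' H(1) by simp
  ultimately show ?case by blast
qed

lemma nat_copy:
  assumes F: "full_mgraph G"
  shows "\<exists>H :: (nat, 'e) mgraph. full_mgraph H \<and> mgraph_iso (G :: ('v, 'e) mgraph) H"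
proof -
  note G = full_mgraphD(1)[OF F]
  obtain c :: "'v \<Rightarrow> nat" where c: "inj_on c (mverts G)"
    using finite_imp_inj_to_nat_seg[OF multigraphD(1)[OF G]] by metis
  define H where "H = make_mgraph (c ` mverts G) (medges G) (\<lambda>e. c ` mends G e)"
  have iso: "mgraph_iso G H" unfolding mgraph_iso_def H_def using c by (auto simp: bij_betw_def)
  have "multigraph H" unfolding multigraph_def
  proof (intro conjI ballI allI impI)
    show "finite (mverts H)" "finite (medges H)" unfolding H_def using multigraphD[OF G] by auto
    fix e
    { assume "e \<in> medges H"
      then have e: "e \<in> medges G" unfolding H_def by simp
      show "mends H e \<subseteq> mverts H" unfolding H_def using e multigraphD(3)[OF G e] by auto
      have "card (c ` mends G e) = card (mends G e)"
        using inj_on_subset[OF c multigraphD(3)[OF G e]] by (rule card_image)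
      then show "card (mends H e) \<in> {1, 2}" unfolding H_def using e multigraphD(4)[OF G e] by auto }
    { assume "e \<notin> medges H"
      then show "mends H e = {}" unfolding H_def by simp }
  qed
  moreover have "edge_verts H (medges G) = c ` edge_verts G (medges G)"
    by (rule edge_verts_iso) (simp add: H_def)
  then have "mverts H = edge_verts H (medges H)" unfolding H_def using full_mgraphD(2)[OF F] by simp
  ultimately show ?thesis using iso unfolding full_mgraph_def by blast
qed

text \<open>The disjoint union of the blocks: a vertex is copied once for every block through it.
  The injection \<open>c\<close> codes pairs of a block and a vertex by numbers, since
  \<open>two_isomorphic\<close> works with vertices in \<open>nat\<close>.\<close>

lemma block_split:
  fixes H :: "('v, 'e) mgraph"
  assumes FH: "full_mgraph H"
  shows "\<exists>F :: (nat, 'e) mgraph. full_mgraph F \<and> medges F = medges H \<and> evens F = evens H \<and>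
    (\<forall>P\<in>space_blocks (medges H) (evens H). edge_verts F P \<inter> edge_verts F (medges F - P) = {}) \<and>
    (\<exists>b. bij_betw b (mcomponents F) (mblocks H) \<and> (\<forall>C\<in>mcomponents F. mgraph_iso C (b C)))"
proof -
  note H = full_mgraphD(1)[OF FH]
  let ?E = "medges H"
  define \<B> where "\<B> = space_blocks ?E (evens H)"
  have Z: "binary_space ?E (evens H)" using binary_space_evens[OF H] .
  have fE: "finite ?E" using multigraphD(2)[OF H] .
  have f\<B>: "finite \<B>" unfolding \<B>_def using finite_space_blocks[OF fE] .
  have fV: "finite (mverts H)" using multigraphD(1)[OF H] .
  obtain c :: "'e set \<times> 'v \<Rightarrow> nat" where c: "inj_on c (\<B> \<times> mverts H)"
    using finite_imp_inj_to_nat_seg[OF finite_cartesian_product[OF f\<B> fV]] by metis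
  have c_eq: "P = Q \<and> v = w" if "c (P, v) = c (Q, w)" "P \<in> \<B>" "Q \<in> \<B>" "v \<in> mverts H" "w \<in> mverts H" for P Q v w
    using inj_onD[OF c that(1)] that(2-5) by simp
  define blk where "blk e = (SOME P. P \<in> \<B> \<and> e \<in> P)" for e
  have blk: "blk e \<in> \<B>" "e \<in> blk e" if "e \<in> ?E" for e
    using someI_ex[of "\<lambda>P. P \<in> \<B> \<and> e \<in> P"] space_blocks_cover[OF Z that] unfolding blk_def \<B>_def by blast+
  have P\<B>: "P \<subseteq> ?E" "P \<noteq> {}" if "P \<in> \<B>" for P using space_blocksD[of P] that unfolding \<B>_def by blast+
  have blk_eq: "blk e = P" if "e \<in> P" "P \<in> \<B>" for e P
  proof -
    have e: "e \<in> ?E" using P\<B> that by blast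
    have "blk e \<inter> P \<noteq> {}" using blk(2)[OF e] that(1) by blast
    then show ?thesis using space_blocks_disjoint[of "blk e" ?E "evens H" P] blk(1)[OF e] that(2) unfolding \<B>_def by blast
  qed
  have VH: "edge_verts H X \<subseteq> mverts H" for X using edge_verts_subset[OF H] .
  define F where "F = make_mgraph (\<Union>P\<in>\<B>. (\<lambda>v. c (P, v)) ` edge_verts H P) ?E (\<lambda>e. (\<lambda>v. c (blk e, v)) ` mends H e)"
  have EF: "medges F = ?E" unfolding F_def by simp
  have ends: "mends F e = (\<lambda>v. c (P, v)) ` mends H e" if "e \<in> P" "P \<in> \<B>" for e P
    using that P\<B> blk_eq[OF that] unfolding F_def by auto
  have injP: "inj_on (\<lambda>v. c (P, v)) (mverts H)" if "P \<in> \<B>" for P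
    by (rule inj_onI) (use c_eq that in blast)
  have mF: "multigraph F" unfolding multigraph_def
  proof (intro conjI ballI allI impI)
    show "finite (mverts F)" unfolding F_def using f\<B> fV VH finite_subset by fastforce
    show "finite (medges F)" unfolding EF by (rule fE)
    fix e
    { assume "e \<in> medges F"
      then have e: "e \<in> ?E" unfolding EF .
      note eq = ends[OF blk(2,1)[OF e]]
      have sub: "mends H e \<subseteq> edge_verts H (blk e)" using blk(2)[OF e] unfolding edge_verts_def by blast
      show "mends F e \<subseteq> mverts F" unfolding eq using sub blk(1)[OF e] unfolding F_def by auto
      have "card (mends F e) = card (mends H e)" unfolding eq
        using inj_on_subset[OF injP[OF blk(1)[OF e]] multigraphD(3)[OF H e]] by (rule card_image)
      then show "card (mends F e) \<in> {1, 2}" using multigraphD(4)[OF H e] by auto }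
    { assume "e \<notin> medges F"
      then show "mends F e = {}" unfolding F_def by simp }
  qed
  have VF: "edge_verts F P = (\<lambda>v. c (P, v)) ` edge_verts H P" if "P \<in> \<B>" for P
    by (rule edge_verts_iso) (use ends that in blast)
  have E\<B>: "?E = \<Union>\<B>" using blk P\<B>(1) by blast
  have "edge_verts F ?E = (\<Union>P\<in>\<B>. edge_verts F P)" unfolding E\<B> edge_verts_def by blast
  then have "mverts F = edge_verts F (medges F)" unfolding EF using VF by (simp add: F_def)
  then have FF: "full_mgraph F" unfolding full_mgraph_def using mF by blast
  have disj: "edge_verts F P \<inter> edge_verts F (?E - P) = {}" if P: "P \<in> \<B>" for P
  proof -
    have False if x: "x \<in> edge_verts F P" "x \<in> edge_verts F (?E - P)" for x
    proof -
      obtain v where v: "x = c (P, v)" "v \<in> mverts H" using x(1) VF[OF P] VH by blast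
      obtain e where e: "e \<in> ?E - P" "x \<in> mends F e" using x(2) unfolding edge_verts_def by blast
      have eE: "e \<in> ?E" using e(1) by blast
      obtain w where w: "x = c (blk e, w)" "w \<in> mends H e" using e(2) unfolding ends[OF blk(2,1)[OF eE]] by blast
      have "w \<in> mverts H" using w(2) multigraphD(3)[OF H eE] by blast
      then have "P = blk e" using c_eq[of P v "blk e" w] v w(1) P blk(1)[OF eE] by simp
      then show False using e(1) blk(2)[OF eE] by blast
    qed
    then show ?thesis by blast
  qed
  have isoP: "mgraph_iso (edge_restrict H P) (edge_restrict F P)" if P: "P \<in> \<B>" for P
    unfolding mgraph_iso_def
  proof (intro conjI exI)
    show "bij_betw (\<lambda>v. c (P, v)) (mverts (edge_restrict H P)) (mverts (edge_restrict F P))"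
      unfolding bij_betw_def using VF[OF P] inj_on_subset[OF injP[OF P] VH[of P]] by simp
    show "\<forall>e\<in>medges (edge_restrict H P). mends (edge_restrict F P) e = (\<lambda>v. c (P, v)) ` mends (edge_restrict H P) e"
      using ends P by simp
  qed simp
  \<comment> \<open>Merging the copies gives one inclusion. For the other, an even set of
    \<open>H\<close> is even on every block, and the blocks of \<open>F\<close> share no
    vertices.\<close>
  have evF: "evens F = evens H"
  proof
    show "evens F \<subseteq> evens H"
    proof (rule evens_quotient[OF mF H])
      show "?E = medges F" using EF by simp
      fix e assume "e \<in> medges F"
      then have e: "e \<in> ?E" unfolding EF .
      let ?f = "\<lambda>x. snd (inv_into (\<B> \<times> mverts H) c x)"
      have "?f (c (blk e, v)) = v" if "v \<in> mends H e" for v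
        using inv_into_f_f[OF c, of "(blk e, v)"] blk(1)[OF e] multigraphD(3)[OF H e] that by auto
      then show "mends H e = ?f ` mends F e" unfolding ends[OF blk(2,1)[OF e]] image_image by simp
    qed
    show "evens H \<subseteq> evens F"
    proof
      fix X assume X: "X \<in> evens H"
      have XE: "X \<subseteq> ?E" using evensD(1)[OF X] .
      have fX: "finite X" using XE fE finite_subset by blast
      have "x \<notin> bd F X" for x
      proof
        assume x: "x \<in> bd F X"
        then obtain e where e: "e \<in> X" "x \<in> mends F e" using bd_subset[of F X] unfolding edge_verts_def by blast
        define P where "P = blk e"
        have eE: "e \<in> ?E" using e(1) XE by blast
        have P: "P \<in> \<B>" "e \<in> P" using blk[OF eE] unfolding P_def by auto
        have "X \<inter> P \<in> evens H" using space_blocksD(3)[of P ?E "evens H" X] P(1) X unfolding \<B>_def by blast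
        then have "X \<inter> P \<in> evens (edge_restrict H P)" unfolding evens_edge_restrict[OF P\<B>(1)[OF P(1)]] by blast
        also have "evens (edge_restrict H P) = evens (edge_restrict F P)"
          using evens_iso(1)[OF multigraph_edge_restrict[OF H P\<B>(1)[OF P(1)]] _ isoP[OF P(1)]]
            multigraph_edge_restrict[OF mF, of P] P\<B>(1)[OF P(1)] EF by simp
        finally have "bd F (X \<inter> P) = {}" using evensD(2)[of "X \<inter> P" "edge_restrict F P"] by (simp add: bd_edge_restrict)
        moreover have "bd F ((X \<inter> P) \<union> (X - P)) = bd F (X \<inter> P) \<oplus> bd F (X - P)"
          by (rule bd_Un) (use fX in auto)
        moreover have "(X \<inter> P) \<union> (X - P) = X" by blast
        ultimately have "x \<in> bd F (X - P)" using x by simp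
        then have "x \<in> edge_verts F (X - P)" using bd_subset[of F "X - P"] by blast
        moreover have "edge_verts F (X - P) \<subseteq> edge_verts F (?E - P)" by (rule edge_verts_mono) (use XE in blast)
        moreover have "x \<in> edge_verts F P" using edge_vertsI[OF P(2) e(2)] .
        ultimately show False using disj[OF P(1)] by blast
      qed
      then have "bd F X = {}" by blast
      then show "X \<in> evens F" using XE EF unfolding evens_def by simp
    qed
  qed
  have ends_ne: "mends F e \<noteq> {}" if "e \<in> ?E" for e
    using multigraphD(4)[OF mF, of e] that EF by auto
  have touch: "e \<in> P \<and> mends F e \<subseteq> edge_verts F P"
    if P: "P \<in> \<B>" and e: "e \<in> ?E" "mends F e \<inter> edge_verts F P \<noteq> {}" for e P
  proof -
    have "e \<in> P"
    proof (rule ccontr)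
      assume "e \<notin> P"
      then have "mends F e \<subseteq> edge_verts F (?E - P)" using e(1) unfolding edge_verts_def by blast
      then show False using e(2) disj[OF P] by blast
    qed
    then show ?thesis unfolding edge_verts_def by blast
  qed
  have inP: "msubgraph K (edge_restrict F P)"
    if K: "msubgraph K F" "connected_mgraph K" "v \<in> mverts K" and P: "P \<in> \<B>" "v \<in> edge_verts F P" for K P v
  proof -
    note DK = msubgraphD[OF K(1)]
    have w: "w \<in> edge_verts F P" if w: "w \<in> mverts K" for w
    proof -
      have "reach K (medges K) v w" using K(2,3) w connected_mgraph_reach[OF DK(1)] by blast
      then have r: "reach F (medges K) v w" using reach_cong[of "medges K" K F] DK(4) by blast
      show ?thesis
        by (rule reach_closed[OF mF DK(3) r P(2)]) (use touch[OF P(1)] DK(3) EF in blast)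
    qed
    moreover have "e \<in> P" if e: "e \<in> medges K" for e
    proof -
      have eE: "e \<in> ?E" using e DK(3) EF by blast
      have "mends F e \<subseteq> edge_verts F P" using multigraphD(3)[OF DK(1) e] DK(4)[OF e] w by blast
      then have "mends F e \<inter> edge_verts F P \<noteq> {}" using ends_ne[OF eE] by blast
      then show ?thesis using touch[OF P(1) eE] by blast
    qed
    ultimately show ?thesis unfolding msubgraph_def using DK(1,4) by auto
  qed
  have conP: "connected_mgraph (edge_restrict F P)" if P: "P \<in> \<B>" for P
  proof -
    have "P \<in> space_blocks (medges F) (evens F)" using P unfolding \<B>_def EF evF .
    then have "nonseparable (edge_restrict F P)"
      using block_graph_nonseparable[OF block_graph_space_block[OF mF]] P\<B>(2)[OF P] by simp
    then show ?thesis unfolding nonseparable_def by blast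
  qed
  have subP: "msubgraph (edge_restrict F P) F" if "P \<in> \<B>" for P
    by (rule msubgraph_edge_restrict[OF mF]) (use P\<B>(1)[OF that] EF in simp)
  have comps: "mcomponents F = edge_restrict F ` \<B>"
  proof (intro equalityI subsetI)
    fix C assume "C \<in> mcomponents F"
    then have C: "msubgraph C F" "connected_mgraph C"
      and max: "\<And>K. msubgraph K F \<Longrightarrow> connected_mgraph K \<Longrightarrow> msubgraph C K \<Longrightarrow> K = C"
      unfolding mcomponents_def by auto
    obtain v where v: "v \<in> mverts C" using C(2) unfolding connected_mgraph_def by blast
    have "v \<in> mverts F" using v msubgraphD(2)[OF C(1)] by blast
    then obtain P where P: "P \<in> \<B>" "v \<in> edge_verts F P" unfolding F_def using VF by (auto simp: F_def)
    have "edge_restrict F P = C"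
      by (rule max[OF subP[OF P(1)] conP[OF P(1)] inP[OF C v P]])
    then show "C \<in> edge_restrict F ` \<B>" using P(1) by blast
  next
    fix C assume "C \<in> edge_restrict F ` \<B>"
    then obtain P where P: "P \<in> \<B>" "C = edge_restrict F P" by blast
    have "K = C" if K: "msubgraph K F" "connected_mgraph K" "msubgraph C K" for K
    proof -
      obtain v where v: "v \<in> mverts C" using conP[OF P(1)] P(2) unfolding connected_mgraph_def by blast
      then have "v \<in> mverts K" "v \<in> edge_verts F P" using msubgraphD(2)[OF K(3)] P(2) by auto
      then have "msubgraph K C" unfolding P(2) using inP[OF K(1,2) _ P(1)] by blast
      then show "K = C" using msubgraph_antisym K(3) by blast
    qed
    then show "C \<in> mcomponents F" unfolding mcomponents_def using subP conP P by blast
  qed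
  define b where "b C = edge_restrict H (medges C)" for C :: "(nat, 'e) mgraph"
  have "bij_betw b (mcomponents F) (mblocks H)"
    unfolding bij_betw_def
  proof
    show "inj_on b (mcomponents F)" unfolding comps
    proof (rule inj_onI)
      fix C D assume CD: "C \<in> edge_restrict F ` \<B>" "D \<in> edge_restrict F ` \<B>" "b C = b D"
      then have "medges C = medges D" unfolding b_def by (metis edge_restrict_sel(2))
      then show "C = D" using CD(1,2) by auto
    qed
    have "b ` edge_restrict F ` \<B> = edge_restrict H ` \<B>" unfolding image_image b_def by simp
    then show "b ` mcomponents F = mblocks H" unfolding comps mblocks_eq[OF FH] \<B>_def .
  qed
  moreover have "mgraph_iso C (b C)" if C: "C \<in> mcomponents F" for C
  proof -
    obtain P where P: "P \<in> \<B>" "C = edge_restrict F P" using C comps by blast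
    then show ?thesis unfolding b_def
      using mgraph_iso_sym[OF multigraph_edge_restrict[OF H P\<B>(1)[OF P(1)]] isoP[OF P(1)]] by simp
  qed
  ultimately show ?thesis using FF EF evF disj unfolding \<B>_def by (intro exI[of _ F]) auto
qed

lemma whitney_steps_switching: "whitney_switching\<^sup>*\<^sup>* G H \<Longrightarrow> whitney_step\<^sup>*\<^sup>* G H"
  by (induction rule: rtranclp_induct) (auto intro: rtranclp.rtrancl_into_rtrancl whitney_step.switching)

lemma whitney_steps_identification: "vertex_identification\<^sup>*\<^sup>* G H \<Longrightarrow> whitney_step\<^sup>*\<^sup>* G H"
  by (induction rule: rtranclp_induct) (auto intro: rtranclp.rtrancl_into_rtrancl whitney_step.identification)

text \<open>The isomorphisms of the blocks glue to a map \<open>f\<close>, because distinct blocks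
  of \<open>F'\<close> share no vertex. So \<open>G2\<close> is a quotient of \<open>F'\<close> with
  the same even sets, and vertex identifications lead on to it; no step has to be reversed.\<close>

theorem whitney_two_isomorphism:
  fixes G1 :: "('v, 'e) mgraph" and G2 :: "('w, 'e) mgraph"
  assumes F1: "full_mgraph G1" and F2: "full_mgraph G2" and E: "medges G1 = medges G2" and Z: "evens G1 = evens G2"
  shows "two_isomorphic G1 G2"
proof -
  note G1 = full_mgraphD(1)[OF F1] and G2 = full_mgraphD(1)[OF F2]
  obtain H :: "(nat, 'e) mgraph" where H: "full_mgraph H" "mgraph_iso G1 H" using nat_copy[OF F1] by blast
  note mH = full_mgraphD(1)[OF H(1)]
  have HE: "medges H = medges G2" "evens H = evens G2" using evens_iso[OF G1 mH H(2)] E Z by auto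
  obtain F :: "(nat, 'e) mgraph" where F: "full_mgraph F" "medges F = medges H" "evens F = evens H"
    "\<forall>P\<in>space_blocks (medges H) (evens H). edge_verts F P \<inter> edge_verts F (medges F - P) = {}"
    "\<exists>b. bij_betw b (mcomponents F) (mblocks H) \<and> (\<forall>C\<in>mcomponents F. mgraph_iso C (b C))"
    using block_split[OF H(1)] by blast
  note mF = full_mgraphD(1)[OF F(1)]
  have HF: "whitney_step H F"
    by (rule whitney_step.partition) (use mF F(5) in \<open>simp add: block_partition_def\<close>)
  define \<B> where "\<B> = space_blocks (medges F) (evens F)"
  have f\<B>: "finite \<B>" unfolding \<B>_def using finite_space_blocks[OF multigraphD(2)[OF mF]] .
  have d: "edge_verts F P \<inter> edge_verts F (medges F - P) = {}" if "P \<in> \<B>" for P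
    using F(2-4) that unfolding \<B>_def by simp
  have EF: "medges G2 = medges F" "evens G2 = evens F" using F(2,3) HE by auto
  obtain F' where F': "whitney_switching\<^sup>*\<^sup>* F F'"
    and iso: "\<forall>P\<in>\<B>. mgraph_iso (edge_restrict F' P) (edge_restrict G2 P)"
    and disj: "\<forall>P\<in>\<B>. edge_verts F' P \<inter> edge_verts F' (medges F - P) = {}"
    using switch_all_blocks[OF F(1) G2 EF d[unfolded \<B>_def] f\<B>[unfolded \<B>_def] order.refl]
    unfolding \<B>_def[symmetric] by blast
  note f' = switchings_facts[OF F' F(1)]
  have FF': "full_mgraph F'" and EF': "medges F' = medges F" and ZF': "evens F' = evens F" using f' by auto
  note mF' = full_mgraphD(1)[OF FF']
  have cover: "\<exists>P\<in>\<B>. e \<in> P" if "e \<in> medges F" for e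
    using space_blocks_cover[OF binary_space_evens[OF mF] that] unfolding \<B>_def .
  have P\<B>: "P \<subseteq> medges F" if "P \<in> \<B>" for P using space_blocksD(1) that unfolding \<B>_def by blast
  have "\<forall>P\<in>\<B>. \<exists>g. bij_betw g (edge_verts F' P) (edge_verts G2 P) \<and> (\<forall>e\<in>P. mends G2 e = g ` mends F' e)"
    using iso unfolding mgraph_iso_def by simp
  then obtain g where g: "\<And>P. P \<in> \<B> \<Longrightarrow> bij_betw (g P) (edge_verts F' P) (edge_verts G2 P)"
    "\<And>P e. P \<in> \<B> \<Longrightarrow> e \<in> P \<Longrightarrow> mends G2 e = g P ` mends F' e" by metis
  define blk where "blk x = (SOME P. P \<in> \<B> \<and> x \<in> edge_verts F' P)" for x
  have blk: "blk x = P" if x: "x \<in> edge_verts F' P" "P \<in> \<B>" for x P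
  proof -
    have b: "blk x \<in> \<B>" "x \<in> edge_verts F' (blk x)"
      using someI[of "\<lambda>P. P \<in> \<B> \<and> x \<in> edge_verts F' P" P] x unfolding blk_def by blast+
    show ?thesis
    proof (rule ccontr)
      assume "blk x \<noteq> P"
      then have "blk x \<inter> P = {}"
        using space_blocks_disjoint[of "blk x" "medges F" "evens F" P] b(1) x(2) unfolding \<B>_def by blast
      then have "blk x \<subseteq> medges F - P" using P\<B>[OF b(1)] by blast
      then have "x \<in> edge_verts F' (medges F - P)" using b(2) edge_verts_mono[of "blk x" "medges F - P" F'] by blast
      then show False using x disj by blast
    qed
  qed
  define f where "f x = g (blk x) x" for x
  have fP: "f x = g P x" if "x \<in> edge_verts F' P" "P \<in> \<B>" for x P
    unfolding f_def using blk[OF that] by simp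
  have ends: "mends G2 e = f ` mends F' e" if e: "e \<in> medges F'" for e
  proof -
    obtain P where P: "P \<in> \<B>" "e \<in> P" using cover e EF' by auto
    have "g P ` mends F' e = f ` mends F' e"
      by (rule image_cong) (use fP[OF _ P(1)] edge_vertsI[OF P(2), where G = F'] in auto)
    then show ?thesis using g(2)[OF P] by simp
  qed
  have "edge_verts G2 (medges F) = f ` edge_verts F' (medges F)"
    by (rule edge_verts_iso) (use ends EF' in simp)
  then have im: "f ` mverts F' = mverts G2"
    using full_mgraphD(2)[OF FF'] full_mgraphD(2)[OF F2] EF' EF(1) by simp
  have E2: "medges G2 = medges F'" "evens G2 = evens F'" using EF EF' ZF' by auto
  obtain H' where H': "vertex_identification\<^sup>*\<^sup>* F' H'" "mgraph_iso H' G2"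
    using merge_components[OF mF' G2 E2(1) ends im E2(2)] by blast
  have "whitney_step\<^sup>*\<^sup>* H H'"
    using HF whitney_steps_switching[OF F'] whitney_steps_identification[OF H'(1)]
    by (meson converse_rtranclp_into_rtranclp rtranclp_trans)
  then show ?thesis unfolding two_isomorphic_def using mH H(2) H'(2) by blast
qed

theorem corollary1p3:
  fixes G1 :: "('v, 'e) mgraph" and G2 :: "('w, 'e) mgraph"
    and co_G1 :: "('v set set, 'e) mgraph"
  assumes "multigraph G1" and "multigraph G2"
    and "connected_mgraph G1" and "connected_mgraph G2"
    and "bicircular_lift G1 = bicircular_lift G2"
    and "card (circuits (bicircular_lift G1)) \<ge> 2"
    and "is_co G1 co_G1" and "card (mverts co_G1) \<ge> 5"
  shows "two_isomorphic G1 G2"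
proof -
  note ev = same_bicircular_lift_same_evens[OF assms(1-3,5,7,8)]
  \<comment> \<open>A connected graph with an edge has no isolated vertices, as
    \<open>whitney_two_isomorphism\<close> requires.\<close>
  have "medges G2 \<noteq> {}" using ev(1,3) by simp
  then have "full_mgraph G2" using connected_full_mgraph[OF assms(2,4)] by blast
  moreover have "full_mgraph G1" using connected_full_mgraph[OF assms(1,3) ev(3)] .
  ultimately show ?thesis using whitney_two_isomorphism ev(1,2) by blast
qed

end
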